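(* The polyhedral complex $\Sigma$ is isomorphic to the boundary complex of a $d$-dimensional polytope, and is therefore topologically a $(d-1)$-sphere.
   Context: $\Delta^\vee\subset\mathbb R^d$ is a reflexive polytope: the convex hull of finitely many points of $\mathbb Z^d$, with $0$ in its interior, such that all vertices of the dual polytope $\Delta=\{m\in(\mathbb R^d)^*: \langle m,n\rangle\le 1\ \forall n\in\Delta^\vee\}$ lie in $(\mathbb Z^d)^*$. $\lambda\in\mathbb Z^{\Delta\cap(\mathbb Z^d)^*}$ and $\nu\in\mathbb Z^{\Delta^\vee\cap\mathbb Z^d}$ are sufficiently generic vectors inducing central coherent triangulations $\{0\}*S$ of $\Delta$ and $\{0\}*T$ of $\Delta^\vee$, where $S$, $T$ are triangulations of $\partial\Delta$, $\partial\Delta^\vee$. Here the coherent triangulation induced by $\lambda$ consists of the projections of the upper faces of $\operatorname{conv}\{(m,\lambda(m))\}$ (similarly for $\nu$); generic means that every upper face is a simplex and contains no lifted lattice point other than its vertices; central means that every maximal simplex has $0$ as a vertex. (Not every lattice point need be a vertex.) $|\Sigma|=\{(m,n)\in\Delta\times\Delta^\vee:\langle m,n\rangle=1\}$, which is the union of the sets $F\times F^\vee$ over all proper faces $F$ of $\Delta$, with $F^\vee$ the dual face of $\Delta^\vee$. $\Sigma$ is the polyhedral complex obtained by restricting to $|\Sigma|$ the product $\operatorname{bsd}(S)\times\operatorname{bsd}(T)$ of the barycentric subdivisions of $S$ and $T$ (its cells are the products of a simplex of $\operatorname{bsd}(S)$ and a simplex of $\operatorname{bsd}(T)$ that are contained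 in $|\Sigma|$). Isomorphism of polyhedral complexes means isomorphism of face posets. *)

theory Defs
  imports "HOL-Analysis.Analysis"
begin

text \<open>The dual space of \<open>\<real>\<^sup>d\<close> and its lattice are identified with
  \<open>real ^ 'n\<close>, \<open>d = CARD('n)\<close>, and its integer points through the standard inner product.\<close>

definition lattice_points :: "(real ^ 'n) set" where
  "lattice_points = {x. \<forall>i. x $ i \<in> \<int>}"

definition polar_dual :: "(real ^ 'n) set \<Rightarrow> (real ^ 'n) set" where
  "polar_dual P = {m. \<forall>n\<in>P. m \<bullet> n \<le> 1}"

definition reflexive_polytope :: "(real ^ 'n) set \<Rightarrow> bool" where
  "reflexive_polytope P \<longleftrightarrow>
     (\<exists>V. finite V \<and> V \<subseteq> lattice_points \<and> P = convex hull V) \<and>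
     0 \<in> interior P \<and>
     (\<forall>v. v extreme_point_of (polar_dual P) \<longrightarrow> v \<in> lattice_points)"

text \<open>A height function is total for convenience; only its values at the lattice points of
  the polytope \<open>P\<close> are ever used.\<close>

definition lift_point :: "(real ^ 'n \<Rightarrow> int) \<Rightarrow> real ^ 'n \<Rightarrow> (real ^ 'n) \<times> real" where
  "lift_point h m = (m, of_int (h m))"

definition lifted_polytope ::
    "(real ^ 'n) set \<Rightarrow> (real ^ 'n \<Rightarrow> int) \<Rightarrow> ((real ^ 'n) \<times> real) set" where
  "lifted_polytope P h = convex hull (lift_point h ` (P \<inter> lattice_points))"

text \<open>The upper faces are the nonempty faces having an outer normal with positive last
  coordinate, here normalised to the form \<open>(- u, 1)\<close>.\<close>

definition upper_face_of ::
    "((real ^ 'n) \<times> real) set \<Rightarrow> ((real ^ 'n) \<times> real) set \<Rightarrow> bool"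
    (infixr "(upper'_face'_of)" 50) where
  "F upper_face_of Q \<longleftrightarrow> F \<noteq> {} \<and>
     (\<exists>u c. (\<forall>(x, t)\<in>Q. t \<le> u \<bullet> x + c) \<and> F = {(x, t)\<in>Q. t = u \<bullet> x + c})"

definition coherent_triangulation ::
    "(real ^ 'n) set \<Rightarrow> (real ^ 'n \<Rightarrow> int) \<Rightarrow> (real ^ 'n) set set" where
  "coherent_triangulation P h = {fst ` F | F. F upper_face_of (lifted_polytope P h)}"

definition generic_heights :: "(real ^ 'n) set \<Rightarrow> (real ^ 'n \<Rightarrow> int) \<Rightarrow> bool" where
  "generic_heights P h \<longleftrightarrow>
     (\<forall>F. F upper_face_of (lifted_polytope P h) \<longrightarrow>
        (\<exists>k. k simplex F) \<and>
        (\<forall>m \<in> P \<inter> lattice_points.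
            lift_point h m \<in> F \<longrightarrow> (lift_point h m) extreme_point_of F))"

definition central_heights :: "(real ^ 'n) set \<Rightarrow> (real ^ 'n \<Rightarrow> int) \<Rightarrow> bool" where
  "central_heights P h \<longleftrightarrow>
     (\<forall>\<sigma> \<in> coherent_triangulation P h.
        (\<forall>\<tau> \<in> coherent_triangulation P h. \<sigma> \<subseteq> \<tau> \<longrightarrow> \<tau> = \<sigma>) \<longrightarrow> 0 extreme_point_of \<sigma>)"

text \<open>For generic central heights the coherent triangulation is the cone \<open>{0} * S\<close>, and its
  base \<open>S\<close> consists of the simplices lying in the boundary of \<open>P\<close>.\<close>

definition boundary_triangulation ::
    "(real ^ 'n) set \<Rightarrow> (real ^ 'n \<Rightarrow> int) \<Rightarrow> (real ^ 'n) set set" where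
  "boundary_triangulation P h = {\<sigma> \<in> coherent_triangulation P h. \<sigma> \<subseteq> frontier P}"

definition barycenter :: "(real ^ 'n) set \<Rightarrow> real ^ 'n" where
  "barycenter \<sigma> = (\<Sum>v | v extreme_point_of \<sigma>. v) /\<^sub>R real (card {v. v extreme_point_of \<sigma>})"

text \<open>The nonempty simplices of the barycentric subdivision: one for each nonempty chain of
  nonempty simplices.\<close>

definition bsd :: "(real ^ 'n) set set \<Rightarrow> (real ^ 'n) set set" where
  "bsd K = {convex hull (barycenter ` C) | C.
     C \<subseteq> K - {{}} \<and> C \<noteq> {} \<and> (\<forall>\<sigma>\<in>C. \<forall>\<tau>\<in>C. \<sigma> \<subseteq> \<tau> \<or> \<tau> \<subseteq> \<sigma>)}"

definition Sigma_space :: "(real ^ 'n) set \<Rightarrow> ((real ^ 'n) \<times> (real ^ 'n)) set" where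
  "Sigma_space Dv = {(m, n). m \<in> polar_dual Dv \<and> n \<in> Dv \<and> m \<bullet> n = 1}"

definition Sigma_complex ::
    "(real ^ 'n) set \<Rightarrow> (real ^ 'n \<Rightarrow> int) \<Rightarrow> (real ^ 'n \<Rightarrow> int)
       \<Rightarrow> ((real ^ 'n) \<times> (real ^ 'n)) set set" where
  "Sigma_complex Dv l v = {\<sigma> \<times> \<tau> | \<sigma> \<tau>.
     \<sigma> \<in> bsd (boundary_triangulation (polar_dual Dv) l) \<and>
     \<tau> \<in> bsd (boundary_triangulation Dv v) \<and>
     \<sigma> \<times> \<tau> \<subseteq> Sigma_space Dv}"

text \<open>Complexes are represented by their sets of nonempty cells.\<close>

definition boundary_complex :: "'a::euclidean_space set \<Rightarrow> 'a set set" where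
  "boundary_complex Q = {F. F face_of Q \<and> F \<noteq> {} \<and> F \<noteq> Q}"

definition isomorphic_complexes :: "'a set set \<Rightarrow> 'b set set \<Rightarrow> bool" where
  "isomorphic_complexes K L \<longleftrightarrow>
     (\<exists>f. bij_betw f K L \<and> (\<forall>\<sigma>\<in>K. \<forall>\<tau>\<in>K. \<sigma> \<subseteq> \<tau> \<longleftrightarrow> f \<sigma> \<subseteq> f \<tau>))"

end

theory Submission
  imports Defs
begin

text \<open>The polytope is a Minkowski sum \<open>A + B\<close> of polytopes whose boundary complexes are \<open>bsd S\<close> and
  \<open>bsd T\<close>; their faces in a direction \<open>y\<close> are given by chains \<open>C\<close> in \<open>S\<close> and \<open>D\<close> in \<open>T\<close>, and
  the face of the sum by the pair \<open>(C, D)\<close>. For \<open>B\<close> one takes the dual of the polytope obtained by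
  cutting off the faces of a convex model of \<open>T\<close> in order of increasing dimension, and for \<open>A\<close> the
  hull of the barycentres of \<open>S\<close>, pulled outwards into convex position but so close to \<open>\<Delta>\<close> that \<open>C\<close> and \<open>D\<close> pair
  to 1 for every \<open>y\<close>. Hence every proper face of \<open>A + B\<close> is a cell of \<open>\<Sigma>\<close>, and the boundary of
  \<open>A + B\<close> embeds in \<open>|\<Sigma>|\<close>. On the other hand \<open>\<langle>m, n\<rangle> = 1\<close> is a monotone relation on
  \<open>\<Delta> \<times> \<Delta>\<^sup>\<or>\<close>, so the direction of \<open>m + n\<close> embeds \<open>|\<Sigma>|\<close> in a sphere of the same dimension.
  By invariance of domain both embeddings are onto, so no cell is missing.\<close>

subsection \<open>Complexes realized by polytopes\<close>

text \<open>The pairings must equal 1 exactly although both polytopes are perturbed, and this fixes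
  the order of the choices. The depths of the cuts for B are set beforehand; they yield one constant
  \<open>k\<close>, valid for all directions, such that every vertex of a simplex selected by B has
  relative coordinate at least \<open>k\<close>. Only then is A moved, by less than \<open>k\<close>
  times a lower bound for the defects \<open>1 - m \<bullet> w\<close> of the pairs with pairing
  below 1. The boundary of a polytope is flat along its faces, so a triangulation of it has no
  strict convexity of its own; this comes from the heights, as functionals \<open>\<phi> t\<close>
  that touch a function \<open>\<kappa>\<close> exactly on \<open>t\<close>. They are mixed with
  supporting functionals \<open>\<psi> t\<close> of the polytope in opposite proportions: mainly
  \<open>\<phi>\<close> with a little \<open>\<psi>\<close> for B, mainly \<open>\<psi>\<close> with
  a little \<open>\<phi>\<close> for A, so that A stays close to \<Delta>. No normal vector is ever
  constructed for a given compatible pair of chains; this is the gap that the topological argument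
  closes.\<close>

lemma sphere_injective_imp_surjective:
  fixes f :: "'a::euclidean_space \<Rightarrow> 'a"
  assumes "continuous_on (sphere 0 1) f" "inj_on f (sphere 0 1)" "f ` sphere 0 1 \<subseteq> sphere 0 1"
  shows "f ` sphere 0 1 = sphere 0 1"
proof (rule ccontr)
  assume "f ` sphere 0 1 \<noteq> sphere 0 1"
  then obtain b where b: "b \<in> sphere 0 1" "b \<notin> f ` sphere 0 1"
    using assms(3) by blast
  then have "b \<noteq> 0" by auto
  define T where "T = {x. b \<bullet> x = 0}"
  have T: "affine T" "aff_dim T < DIM('a)"
    using \<open>b \<noteq> 0\<close> by (auto simp: T_def affine_hyperplane)
  have "(sphere 0 1 - {b}) homeomorphic T"
    unfolding T_def by (rule homeomorphic_punctured_sphere_hyperplane) (use b \<open>b \<noteq> 0\<close> in auto)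
  then obtain h k where hk: "homeomorphism (sphere 0 1 - {b}) T h k"
    by (auto simp: homeomorphic_def)
  define S where "S = (h \<circ> f) ` sphere 0 1"
  have fS: "f ` sphere 0 1 \<subseteq> sphere 0 1 - {b}"
    using assms(3) b(2) by blast
  have cont: "continuous_on (sphere 0 1) (h \<circ> f)"
    by (intro continuous_on_compose assms(1) continuous_on_subset[OF homeomorphism_cont1[OF hk] fS])
  have inj: "inj_on (h \<circ> f) (sphere 0 1)"
    using hk fS by (intro comp_inj_on assms(2) inj_on_inverseI[of _ k]) (auto simp: homeomorphism_def)
  have im: "S \<subseteq> T"
    using hk fS by (auto simp: S_def homeomorphism_def)
  \<comment> \<open>After removal of the missed point, the sphere is a hyperplane, into which it is
    mapped injectively. By invariance of domain the image is open there, and being compact it is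
    closed, so it fills the hyperplane, which is then bounded.\<close>
  have "openin (top_of_set T) S"
    unfolding S_def
    by (rule invariance_of_domain_sphere_affine_set[where a = 0 and r = 1])
      (use cont inj im T in \<open>auto simp: S_def\<close>)
  moreover have "compact S"
    unfolding S_def by (intro compact_continuous_image cont compact_sphere)
  then have "closedin (top_of_set T) S"
    using im by (simp add: closed_subset compact_imp_closed)
  moreover have "connected T"
    by (simp add: T(1) affine_imp_convex convex_connected)
  moreover have "S \<noteq> {}"
    using b by (auto simp: S_def)
  ultimately have "S = T"
    by (metis connected_clopen)
  then have "bounded T"
    using \<open>compact S\<close> compact_imp_bounded by blast
  then obtain c where c: "T = {c}"
    using affine_bounded_eq_trivial[OF T(1)] \<open>S \<noteq> {}\<close> \<open>S = T\<close> by auto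
  \<comment> \<open>Only in dimension 1 is a hyperplane bounded; it is then one point, and antipodal
    points get the same image.\<close>
  have "h (f b) = h (f (- b))"
    using im c b unfolding S_def by (auto simp: image_subset_iff)
  then have "b = - b"
    using inj b by (auto simp: inj_on_def)
  then have "b \<bullet> b = - (b \<bullet> b)"
    using inner_minus_right[of b b] by simp
  then show False
    using \<open>b \<noteq> 0\<close> by simp
qed

text \<open>Weights are functions on the whole index type that vanish off \<open>J\<close>, and sums
  run over one fixed index set. Thus weights on different cells can be compared as functions, and
  indices with equal points stay apart.\<close>

definition weights_on :: "'i set \<Rightarrow> ('i \<Rightarrow> real) \<Rightarrow> bool" where
  "weights_on J c \<longleftrightarrow> (\<forall>i. 0 \<le> c i) \<and> (\<forall>i. i \<notin> J \<longrightarrow> c i = 0) \<and> sum c J = 1"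

lemma weights_on_nonneg: "weights_on J c \<Longrightarrow> 0 \<le> c i"
  and weights_on_outside: "weights_on J c \<Longrightarrow> i \<notin> J \<Longrightarrow> c i = 0"
  by (auto simp: weights_on_def)

lemma weights_on_sum:
  assumes "weights_on J c" "finite I" "J \<subseteq> I"
  shows "sum c I = 1"
  using assms sum.mono_neutral_right[of I J c] by (auto simp: weights_on_def)

lemma weights_on_mono:
  assumes "weights_on J c" "finite J'" "J \<subseteq> J'"
  shows "weights_on J' c"
  using assms weights_on_sum[OF assms] by (auto simp: weights_on_def)

lemma weights_on_restrict:
  assumes "weights_on J c" "finite J" "\<And>i. i \<notin> J' \<Longrightarrow> c i = 0"
  shows "weights_on (J \<inter> J') c"
proof -
  have "sum c (J \<inter> J') = sum c J"
    by (rule sum.mono_neutral_left) (use assms in auto)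
  then show ?thesis
    using assms by (auto simp: weights_on_def)
qed

lemma weights_on_combine:
  assumes "weights_on J c" "weights_on J c'" "0 \<le> u" "u \<le> 1"
  shows "weights_on J (\<lambda>i. (1 - u) * c i + u * c' i)"
  using assms by (auto simp: weights_on_def sum.distrib simp flip: sum_distrib_left)

lemma weights_on_single: "i \<in> J \<Longrightarrow> finite J \<Longrightarrow> weights_on J (\<lambda>k. if k = i then 1 else 0)"
  by (auto simp: weights_on_def)

lemma weights_on_uniform:
  "finite J \<Longrightarrow> J \<noteq> {} \<Longrightarrow> weights_on J (\<lambda>k. if k \<in> J then 1 / real (card J) else 0)"
  by (auto simp: weights_on_def)

lemma convex_hull_image_weights:
  fixes q :: "'i \<Rightarrow> 'a::real_vector"
  assumes I: "finite I" and J: "J \<subseteq> I"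
  shows "convex hull (q ` J) = {(\<Sum>i\<in>I. c i *\<^sub>R q i) | c. weights_on J c}" (is "_ = ?R")
proof
  have fJ: "finite J" using I J finite_subset by blast
  show "convex hull (q ` J) \<subseteq> ?R"
  proof (rule hull_minimal)
    show "q ` J \<subseteq> ?R"
    proof clarify
      fix i assume i: "i \<in> J"
      define e where "e = (\<lambda>k. if k = i then 1 else (0::real))"
      have "(\<Sum>k\<in>I. e k *\<^sub>R q k) = (\<Sum>k\<in>I. if k = i then q k else 0)"
        by (intro sum.cong) (auto simp: e_def)
      also have "\<dots> = q i"
        using i I J by auto
      finally have "q i = (\<Sum>k\<in>I. e k *\<^sub>R q k)" ..
      moreover have "weights_on J e"
        unfolding e_def using weights_on_single[OF i fJ] .
      ultimately show "\<exists>c. q i = (\<Sum>k\<in>I. c k *\<^sub>R q k) \<and> weights_on J c"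
        by blast
    qed
    show "convex ?R"
      unfolding convex_alt
    proof (intro ballI allI impI)
      fix x y u assume "x \<in> ?R" "y \<in> ?R" and u: "0 \<le> u \<and> u \<le> (1::real)"
      then obtain c c' where c: "x = (\<Sum>i\<in>I. c i *\<^sub>R q i)" "weights_on J c"
        and c': "y = (\<Sum>i\<in>I. c' i *\<^sub>R q i)" "weights_on J c'" by blast
      have "(1 - u) *\<^sub>R x + u *\<^sub>R y = (\<Sum>i\<in>I. ((1 - u) * c i + u * c' i) *\<^sub>R q i)"
        by (simp add: c c' scaleR_left_distrib sum.distrib scaleR_sum_right)
      then show "(1 - u) *\<^sub>R x + u *\<^sub>R y \<in> ?R"
        using weights_on_combine[OF c(2) c'(2), of u] u
        unfolding mem_Collect_eq by (intro exI[of _ "\<lambda>i. (1 - u) * c i + u * c' i"] conjI) simp_all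
    qed
  qed
  show "?R \<subseteq> convex hull (q ` J)"
  proof clarify
    fix c assume c: "weights_on J c"
    have "(\<Sum>i\<in>I. c i *\<^sub>R q i) = (\<Sum>i\<in>J. c i *\<^sub>R q i)"
      by (rule sum.mono_neutral_right) (use I J c in \<open>auto simp: weights_on_def\<close>)
    also have "\<dots> \<in> convex hull (q ` J)"
      by (rule convex_sum) (use fJ c in \<open>auto simp: weights_on_def hull_inc\<close>)
    finally show "(\<Sum>i\<in>I. c i *\<^sub>R q i) \<in> convex hull (q ` J)" .
  qed
qed

lemma weighted_mean_eq_max:
  fixes f :: "'i \<Rightarrow> real"
  assumes "finite I" "J \<subseteq> I" "weights_on J c" "\<And>i. i \<in> I \<Longrightarrow> f i \<le> M" "(\<Sum>i\<in>I. c i * f i) = M"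
    and "i \<in> I" "f i \<noteq> M"
  shows "c i = 0"
proof -
  have "(\<Sum>i\<in>I. c i * (M - f i)) = M * sum c I - (\<Sum>i\<in>I. c i * f i)"
    by (simp add: algebra_simps sum_subtractf sum_distrib_left)
  also have "\<dots> = 0"
    using assms weights_on_sum[of J c I] by simp
  finally have "\<forall>i\<in>I. c i * (M - f i) = 0"
    using assms by (subst (asm) sum_nonneg_eq_0_iff) (auto simp: weights_on_nonneg)
  then show ?thesis using assms by auto
qed

text \<open>Here \<open>q\<close> lists candidate vertices of the polytope, \<open>p\<close> the
  vertices of the complex, and \<open>Good\<close> the index sets of cells. Cells need not be
  simplices, so weights are not unique; the hypotheses therefore compare weighted sums instead of
  weights. Only the faces in given directions have to be shown \<open>Good\<close>; that each
  \<open>Good\<close> set is a face is a conclusion.\<close>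

theorem complex_realization:
  fixes q :: "'i \<Rightarrow> 'a::euclidean_space" and p :: "'i \<Rightarrow> 'b::euclidean_space" and g :: "'b \<Rightarrow> 'a"
    and Good :: "'i set set"
  defines "U \<equiv> \<Union>J\<in>Good. convex hull (p ` J)"
  assumes I: "finite I" and Good: "Good \<subseteq> Pow I" "{} \<notin> Good" "I \<notin> Good"
    and argmax: "\<And>y. y \<noteq> 0 \<Longrightarrow> {i\<in>I. \<forall>j\<in>I. y \<bullet> q j \<le> y \<bullet> q i} \<in> Good"
    and q_imp_p: "\<And>J c c'. \<lbrakk>J \<in> Good; weights_on J c; weights_on J c';
           (\<Sum>i\<in>I. c i *\<^sub>R q i) = (\<Sum>i\<in>I. c' i *\<^sub>R q i)\<rbrakk>
         \<Longrightarrow> (\<Sum>i\<in>I. c i *\<^sub>R p i) = (\<Sum>i\<in>I. c' i *\<^sub>R p i)"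
    and p_imp_q: "\<And>J J' c c'. \<lbrakk>J \<in> Good; J' \<in> Good; weights_on J c; weights_on J' c';
           (\<Sum>i\<in>I. c i *\<^sub>R p i) = (\<Sum>i\<in>I. c' i *\<^sub>R p i)\<rbrakk>
         \<Longrightarrow> (\<Sum>i\<in>I. c i *\<^sub>R q i) = (\<Sum>i\<in>I. c' i *\<^sub>R q i)"
    and p_imp_support: "\<And>J J' c c' i. \<lbrakk>J \<in> Good; J' \<in> Good; weights_on J c; weights_on J' c';
           (\<Sum>i\<in>I. c i *\<^sub>R p i) = (\<Sum>i\<in>I. c' i *\<^sub>R p i); i \<notin> J\<rbrakk> \<Longrightarrow> c' i = 0"
    and g: "continuous_on U g" "inj_on g U" "g ` U \<subseteq> sphere 0 1"
  shows "polytope (convex hull (q ` I))" and "aff_dim (convex hull (q ` I)) = DIM('a)"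
    and "isomorphic_complexes ((\<lambda>J. convex hull (p ` J)) ` Good) (boundary_complex (convex hull (q ` I)))"
    and "U homeomorphic sphere (0::'a) 1"
proof -
  define Q where "Q = convex hull (q ` I)"
  define am where "am y = {i\<in>I. \<forall>j\<in>I. y \<bullet> q j \<le> y \<bullet> q i}" for y
  define qs where "qs c = (\<Sum>i\<in>I. c i *\<^sub>R q i)" for c
  define ps where "ps c = (\<Sum>i\<in>I. c i *\<^sub>R p i)" for c
  note q_p = q_imp_p[folded qs_def ps_def] and p_q = p_imp_q[folded qs_def ps_def]
    and p_supp = p_imp_support[folded ps_def]
  have fin: "finite J" "J \<subseteq> I" "J \<noteq> {}" if "J \<in> Good" for J
    using that Good I by (auto intro: finite_subset[of J I])
  have am_Good: "am y \<in> Good" if "y \<noteq> 0" for y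
    using argmax[OF that] by (simp add: am_def)
  have I_ne: "I \<noteq> {}"
  proof -
    obtain y :: 'a where "y \<noteq> 0" using nonempty_Basis nonzero_Basis by blast
    then have "am y \<noteq> {}" "am y \<subseteq> I" using am_Good[of y] Good by auto
    then show ?thesis by blast
  qed
  have hull_q: "convex hull (q ` J) = {qs c | c. weights_on J c}" if "J \<subseteq> I" for J
    unfolding qs_def by (rule convex_hull_image_weights[OF I that])
  have hull_p: "convex hull (p ` J) = {ps c | c. weights_on J c}" if "J \<subseteq> I" for J
    unfolding ps_def by (rule convex_hull_image_weights[OF I that])
  have polyQ: "polytope Q"
    using I by (auto simp: Q_def polytope_def)
  have compQ: "compact Q" and convQ: "convex Q"
    using polyQ by (auto simp: polytope_imp_compact polytope_imp_convex)
  have le_am: "y \<bullet> q j \<le> y \<bullet> q i" if "i \<in> am y" "j \<in> I" for i j y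
    using that by (auto simp: am_def)
  have le_Q: "y \<bullet> x \<le> y \<bullet> q i" if "i \<in> am y" "x \<in> Q" for i x y
  proof -
    have "Q \<subseteq> {x. y \<bullet> x \<le> y \<bullet> q i}"
      unfolding Q_def by (rule hull_minimal) (use that le_am in \<open>auto simp: convex_halfspace_le\<close>)
    then show ?thesis using that by auto
  qed
  have max_support: "c k = 0"
    if "i \<in> am y" "weights_on J c" "J \<subseteq> I" "y \<bullet> qs c = y \<bullet> q i" "k \<notin> am y" for i k c J y
  proof (cases "k \<in> I")
    case True
    have "y \<bullet> q k \<noteq> y \<bullet> q i"
      using that True le_am[of i y] by (force simp: am_def)
    then show ?thesis
      using that True le_am[of i y]
      by (intro weighted_mean_eq_max[where I = I and J = J and f = "\<lambda>k. y \<bullet> q k" and M = "y \<bullet> q i"])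
        (auto simp: I qs_def inner_sum_right)
  next
    case False
    then have "k \<notin> J" using that(3) by blast
    then show ?thesis by (rule weights_on_outside[OF that(2)])
  qed
  have am_value: "y \<bullet> qs c = y \<bullet> q i" if "weights_on (am y) c" "i \<in> am y" for c i y
  proof -
    have "y \<bullet> qs c = (\<Sum>k\<in>I. c k * (y \<bullet> q k))"
      by (simp add: qs_def inner_sum_right)
    also have "\<dots> = (\<Sum>k\<in>I. c k * (y \<bullet> q i))"
    proof (rule sum.cong)
      fix k assume "k \<in> I"
      have "i \<in> I" using that(2) by (simp add: am_def)
      show "c k * (y \<bullet> q k) = c k * (y \<bullet> q i)"
      proof (cases "k \<in> am y")
        case True
        then have "y \<bullet> q k = y \<bullet> q i"
          using le_am[OF True \<open>i \<in> I\<close>] le_am[OF that(2) \<open>k \<in> I\<close>] by linarith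
        then show ?thesis by simp
      qed (simp add: weights_on_outside[OF that(1)])
    qed simp
    also have "\<dots> = sum c I * (y \<bullet> q i)"
      by (rule sum_distrib_right[symmetric])
    also have "sum c I = 1"
      by (rule weights_on_sum[OF that(1) I]) (simp add: am_def)
    also have "1 * (y \<bullet> q i) = y \<bullet> q i" by simp
    finally show ?thesis .
  qed
  have ex_am: "\<exists>i. i \<in> am y" if "y \<noteq> 0" for y
    using fin(3)[OF am_Good[OF that]] by blast

  have intQ: "interior Q \<noteq> {}"
  proof
    assume "interior Q = {}"
    then obtain a b where "a \<noteq> 0" and ab: "Q \<subseteq> {x. a \<bullet> x = b}"
      using empty_interior_subset_hyperplane[OF convQ] by blast
    have "a \<bullet> q i = b" if "i \<in> I" for i
      using ab that by (auto simp: Q_def hull_inc subset_iff)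
    \<comment> \<open>A functional constant on the polytope selects every index, but
      \<open>I\<close> is not \<open>Good\<close>; this is the source of full dimension.\<close>
    then have "am a = I" by (auto simp: am_def)
    then show False using am_Good[OF \<open>a \<noteq> 0\<close>] Good by auto
  qed
  show "aff_dim (convex hull (q ` I)) = DIM('a)"
    using aff_dim_nonempty_interior[OF intQ] by (simp add: Q_def)
  show "polytope (convex hull (q ` I))" using polyQ by (simp add: Q_def)

  have frontier_am: "\<exists>y c. y \<noteq> 0 \<and> weights_on (am y) c \<and> x = qs c" if "x \<in> frontier Q" for x
  proof -
    have "x \<in> Q" using that compQ by (simp add: compact_imp_closed frontier_def closure_closed)
    have x: "x \<in> closure Q" "x \<notin> rel_interior Q"
      using that intQ by (auto simp: frontier_def interior_rel_interior_gen split: if_splits)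
    have clQ: "closure Q = Q" using compQ by (simp add: compact_imp_closed)
    obtain a where a: "a \<noteq> 0" "\<And>y. y \<in> Q \<Longrightarrow> a \<bullet> x \<le> a \<bullet> y"
      using supporting_hyperplane_relative_frontier[OF convQ x] unfolding clQ by metis
    obtain c where c: "weights_on I c" "x = qs c"
      using \<open>x \<in> Q\<close> hull_q[of I] by (auto simp: Q_def)
    obtain i where i: "i \<in> am (- a)" using ex_am a(1) by force
    then have "i \<in> I" by (auto simp: am_def)
    have "(- a) \<bullet> x = (- a) \<bullet> q i"
      using le_Q[OF i \<open>x \<in> Q\<close>] a(2)[of "q i"] \<open>i \<in> I\<close> by (auto simp: Q_def hull_inc)
    then have "c k = 0" if "k \<notin> am (- a)" for k
      using max_support[OF i c(1) _ _ that] c by auto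
    then have "weights_on (am (- a)) c"
      using weights_on_restrict[OF c(1) I, of "am (- a)"] by (simp add: am_def Int_def conj_commute)
    then show ?thesis using c a by (metis neg_equal_0_iff_equal)
  qed
  have am_frontier: "qs c \<in> frontier Q" if "y \<noteq> 0" "weights_on (am y) c" for y c
  proof -
    obtain i where i: "i \<in> am y" using ex_am \<open>y \<noteq> 0\<close> by blast
    have amI: "am y \<subseteq> I" by (auto simp: am_def)
    have "qs c \<in> Q"
      using hull_q[OF amI] that hull_mono[of "q ` am y" "q ` I"] amI by (auto simp: Q_def)
    moreover have "qs c \<notin> interior Q"
    proof
      assume "qs c \<in> interior Q"
      then obtain e where e: "e > 0" "ball (qs c) e \<subseteq> Q"
        by (auto simp: mem_interior)
      define z where "z = qs c + (e / 2 / norm y) *\<^sub>R y"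
      have "z \<in> Q"
        using e \<open>y \<noteq> 0\<close> by (intro subsetD[OF e(2)]) (auto simp: z_def dist_norm)
      have "y \<bullet> z = y \<bullet> qs c + (e / 2 / norm y) * (y \<bullet> y)"
        by (simp add: z_def inner_add_right)
      moreover have "(e / 2 / norm y) * (y \<bullet> y) > 0"
        using e \<open>y \<noteq> 0\<close> by (auto intro!: mult_pos_pos divide_pos_pos)
      ultimately show False
        using le_Q[OF i \<open>z \<in> Q\<close>] am_value[OF that(2) i] by simp
    qed
    ultimately show ?thesis
      by (simp add: frontier_def closure_subset[THEN subsetD])
  qed

  text \<open>The graph of the cellwise affine correspondence between the boundary of the
    polytope and the complex; it is compact and projects injectively to both sides.\<close>
  define G where "G = {(qs c, ps c) | y c. y \<noteq> 0 \<and> weights_on (am y) c}"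
  have G_alt: "G = (\<Union>J\<in>am ` (- {0}). convex hull ((\<lambda>i. (q i, p i)) ` J))"
  proof -
    have "convex hull ((\<lambda>i. (q i, p i)) ` am y) = {(qs c, ps c) | c. weights_on (am y) c}" for y
    proof -
      have "(\<Sum>i\<in>I. c i *\<^sub>R (q i, p i)) = (qs c, ps c)" for c
        by (simp add: qs_def ps_def prod_eq_iff fst_sum snd_sum)
      then show ?thesis
        by (subst convex_hull_image_weights[OF I]) (auto simp: am_def)
    qed
    then show ?thesis unfolding G_def by auto
  qed
  have "compact G"
    unfolding G_alt
  proof (rule compact_UN)
    have "am ` (- {0}) \<subseteq> Pow I" by (auto simp: am_def)
    then show "finite (am ` (- {0}))" using I finite_subset by blast
    show "compact (convex hull ((\<lambda>i. (q i, p i)) ` J))" if "J \<in> am ` (- {0})" for J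
      using that I by (intro finite_imp_compact_convex_hull) (auto simp: am_def)
  qed
  have fst_G: "fst ` G = frontier Q"
    using frontier_am am_frontier by (force simp: G_def image_iff)
  \<comment> \<open>A representation of a point of the face in direction \<open>y\<close> cannot use
    an index outside \<open>am y\<close>: its mean value would fall below the maximum.\<close>
  have same_am: "weights_on (am y) c'"
    if "y \<noteq> 0" "weights_on (am y) c" "qs c = qs c'" "weights_on J c'" "J \<subseteq> I" for y c c' J
  proof -
    obtain i where i: "i \<in> am y" using ex_am \<open>y \<noteq> 0\<close> by blast
    have "c' k = 0" if "k \<notin> am y" for k
      using max_support[OF i \<open>weights_on J c'\<close> \<open>J \<subseteq> I\<close> _ that] am_value[OF \<open>weights_on (am y) c\<close> i] \<open>qs c = qs c'\<close>
      by simp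
    then have "weights_on (J \<inter> am y) c'"
      using \<open>J \<subseteq> I\<close> I finite_subset by (intro weights_on_restrict that(4)) auto
    then show ?thesis
      by (rule weights_on_mono) (use I in \<open>auto simp: am_def\<close>)
  qed
  have "inj_on fst G"
  proof (rule inj_onI; clarsimp simp: G_def)
    fix y c y' c' assume *: "y \<noteq> 0" "weights_on (am y) c" "weights_on (am y') c'" "qs c = qs c'"
    have "weights_on (am y) c'"
      by (rule same_am[of _ c _ "am y'"]) (use * in \<open>auto simp: am_def\<close>)
    then show "ps c = ps c'"
      by (rule q_p[OF am_Good[OF *(1)] *(2) _ *(4)])
  qed
  then have hom1: "G homeomorphic frontier Q"
    using \<open>compact G\<close> fst_G by (intro homeomorphic_compact[where f = fst]) (auto intro: continuous_intros)
  have sub_U: "snd ` G \<subseteq> U"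
  proof clarsimp
    fix a b assume "(a, b) \<in> G"
    then obtain y c where y: "y \<noteq> 0" "weights_on (am y) c" "b = ps c"
      by (auto simp: G_def)
    have "am y \<subseteq> I" by (auto simp: am_def)
    then show "b \<in> U"
      unfolding U_def using am_Good[OF y(1)] y hull_p[of "am y"] by auto
  qed
  have inj_snd: "inj_on snd G"
  proof (rule inj_onI; clarsimp simp: G_def)
    fix y c y' c' assume *: "y \<noteq> 0" "weights_on (am y) c" "y' \<noteq> 0" "weights_on (am y') c'" "ps c = ps c'"
    show "qs c = qs c'"
      by (rule p_q[OF am_Good[OF *(1)] am_Good[OF *(3)] *(2,4,5)])
  qed
  have "frontier Q homeomorphic sphere (0::'a) 1"
  proof -
    have "rel_frontier Q homeomorphic rel_frontier (cball (0::'a) 1)"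
      using aff_dim_nonempty_interior[OF intQ] compQ convQ
      by (intro homeomorphic_rel_frontiers_convex_bounded_sets) (auto simp: aff_dim_cball compact_imp_bounded)
    then show ?thesis
      using intQ by (simp add: rel_frontier_nonempty_interior)
  qed
  then have "sphere (0::'a) 1 homeomorphic G"
    using hom1 homeomorphic_sym homeomorphic_trans by blast
  then obtain h k where hk: "homeomorphism (sphere (0::'a) 1) G h k"
    by (auto simp: homeomorphic_def)
  have hG: "h ` sphere 0 1 = G" using hk by (simp add: homeomorphism_image1)
  have surj: "(g \<circ> (snd \<circ> h)) ` sphere 0 1 = sphere 0 1"
  proof (rule sphere_injective_imp_surjective)
    have im: "(snd \<circ> h) ` sphere 0 1 = snd ` G" by (simp only: image_comp[symmetric] hG)
    show "continuous_on (sphere 0 1) (g \<circ> (snd \<circ> h))"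
      using hk im sub_U
      by (intro continuous_on_compose homeomorphism_cont1[OF hk] continuous_on_snd continuous_on_id
          continuous_on_subset[OF g(1)] continuous_intros) auto
    have "inj_on h (sphere 0 1)"
      using hk by (intro inj_on_inverseI[of _ k]) (auto simp: homeomorphism_def)
    then show "inj_on (g \<circ> (snd \<circ> h)) (sphere 0 1)"
      using inj_snd g(2) im sub_U hG by (intro comp_inj_on) (auto intro: inj_on_subset)
    show "(g \<circ> (snd \<circ> h)) ` sphere 0 1 \<subseteq> sphere 0 1"
    proof -
      have "(g \<circ> (snd \<circ> h)) ` sphere 0 1 = g ` (snd ` G)"
        by (simp only: image_comp[symmetric] im[unfolded image_comp[symmetric]])
      then show ?thesis using g(3) sub_U by blast
    qed
  qed
  \<comment> \<open>The projection of \<open>G\<close> is already mapped by \<open>g\<close> onto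
    the sphere, so a point of \<open>U\<close> outside it would share its \<open>g\<close>-value
    with a point inside.\<close>
  have snd_G: "snd ` G = U"
  proof -
    have surj': "g ` (snd ` G) = sphere 0 1"
      using surj hG by (metis image_comp)
    have "u \<in> snd ` G" if "u \<in> U" for u
    proof -
      have "g u \<in> g ` (snd ` G)" using surj' g(3) that by auto
      then obtain w where "w \<in> snd ` G" "g u = g w" by blast
      then show ?thesis using g(2) that sub_U by (metis inj_onD subsetD)
    qed
    then show ?thesis using sub_U by blast
  qed
  have "compact U"
    using \<open>compact G\<close> snd_G compact_continuous_image[OF continuous_on_snd[OF continuous_on_id]] by metis
  moreover have "g ` U = sphere 0 1"
    using surj hG snd_G by (metis image_comp)
  ultimately show "U homeomorphic sphere (0::'a) 1"
    using g by (intro homeomorphic_compact[of U g]) auto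

  \<comment> \<open>Uniform weights give a point of the cell of \<open>J\<close> that uses every
    index of \<open>J\<close>. It also lies in the cell of some \<open>am y\<close>, and
    \<open>p_imp_support\<close> then forces all of \<open>J\<close> into
    \<open>am y\<close>.\<close>
  have sub_occ: "\<exists>y. y \<noteq> 0 \<and> J \<subseteq> am y" if "J \<in> Good" for J
  proof -
    define c where "c = (\<lambda>k. if k \<in> J then 1 / real (card J) else 0)"
    have c: "weights_on J c" unfolding c_def by (rule weights_on_uniform) (use fin that in auto)
    have "ps c \<in> U" unfolding U_def using that c hull_p fin(2)[OF that] by auto
    then obtain y c' where y: "y \<noteq> 0" "weights_on (am y) c'" "ps c = ps c'"
      by (auto simp: G_def simp flip: snd_G)
    have "k \<in> am y" if "k \<in> J" for k
    proof (rule ccontr)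
      assume "k \<notin> am y"
      then have "c k = 0"
        using p_supp[OF am_Good[OF y(1)] \<open>J \<in> Good\<close> y(2) c y(3)[symmetric]] by blast
      then show False using that fin[OF \<open>J \<in> Good\<close>] by (simp add: c_def)
    qed
    then show ?thesis using y by blast
  qed
  \<comment> \<open>Inside \<open>am y\<close> the equality of the \<open>q\<close>-sums passes to
    the \<open>p\<close>-sums; there the cells meet properly, and this confines the support to
    \<open>J\<close>.\<close>
  have same_face: "weights_on J c'"
    if "J \<in> Good" "weights_on J c" "weights_on J' c'" "J' \<subseteq> I" "qs c = qs c'" for J c J' c'
  proof -
    obtain y where y: "y \<noteq> 0" "J \<subseteq> am y" using sub_occ[OF \<open>J \<in> Good\<close>] by blast
    have finam: "finite (am y)" using I by (auto simp: am_def)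
    have w: "weights_on (am y) c" using that(2) finam y(2) by (rule weights_on_mono)
    have w': "weights_on (am y) c'" by (rule same_am[OF y(1) w that(5,3,4)])
    have "ps c = ps c'"
      by (rule q_p[OF am_Good[OF y(1)] w w' that(5)])
    then have "c' k = 0" if "k \<notin> J" for k
      by (rule p_supp[OF \<open>J \<in> Good\<close> am_Good[OF y(1)] \<open>weights_on J c\<close> w' _ that])
    then have "weights_on (am y \<inter> J) c'"
      by (intro weights_on_restrict[OF w' finam])
    then show ?thesis using y(2) by (simp add: Int_absorb1)
  qed
  have face: "convex hull (q ` J) face_of Q" if "J \<in> Good" for J
    unfolding face_of_def
  proof (intro conjI ballI impI)
    show "convex hull (q ` J) \<subseteq> Q" unfolding Q_def by (intro hull_mono image_mono fin that)
    show "convex (convex hull (q ` J))" by simp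
    fix a b x assume ab: "a \<in> Q" "b \<in> Q" and x: "x \<in> convex hull (q ` J)" "x \<in> open_segment a b"
    obtain ca cb c where c: "weights_on I ca" "a = qs ca" "weights_on I cb" "b = qs cb"
      "weights_on J c" "x = qs c"
      using ab x hull_q[of I] hull_q[of J] fin(2)[OF \<open>J \<in> Good\<close>] by (auto simp: Q_def)
    obtain u where u: "0 < u" "u < 1" "x = (1 - u) *\<^sub>R a + u *\<^sub>R b"
      using x(2) by (auto simp: in_segment)
    define d where "d = (\<lambda>i. (1 - u) * ca i + u * cb i)"
    have d: "weights_on I d" unfolding d_def using u by (intro weights_on_combine c) auto
    have "qs c = qs d"
      using u c by (simp add: qs_def d_def scaleR_left_distrib sum.distrib scaleR_sum_right)
    then have dJ: "weights_on J d" using same_face[OF that c(5) d] by simp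
    have z: "ca i = 0 \<and> cb i = 0" if "i \<notin> J" for i
    proof -
      have "(1 - u) * ca i + u * cb i = 0"
        using weights_on_outside[OF dJ that] by (simp add: d_def)
      moreover have "(1 - u) * ca i \<ge> 0" "u * cb i \<ge> 0"
        using u weights_on_nonneg[OF c(1)] weights_on_nonneg[OF c(3)] by auto
      ultimately have "(1 - u) * ca i = 0" "u * cb i = 0" by linarith+
      then show ?thesis using u by simp
    qed
    have "weights_on J ca" "weights_on J cb"
      using weights_on_restrict[OF c(1) I, of J] weights_on_restrict[OF c(3) I, of J] z fin(2)[OF that]
      by (simp_all add: Int_absorb1)
    then show "a \<in> convex hull (q ` J)" "b \<in> convex hull (q ` J)"
      using hull_q[OF fin(2)[OF that]] c by auto
  qed
  have mono_q: "convex hull (q ` J) \<subseteq> convex hull (q ` J') \<longleftrightarrow> J \<subseteq> J'"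
    if gd: "J \<in> Good" "J' \<in> Good" for J J'
  proof
    assume sub: "convex hull (q ` J) \<subseteq> convex hull (q ` J')"
    define c where "c = (\<lambda>k. if k \<in> J then 1 / real (card J) else 0)"
    have c: "weights_on J c" unfolding c_def by (rule weights_on_uniform) (use fin gd in auto)
    then have "qs c \<in> convex hull (q ` J')" using sub hull_q[OF fin(2)[OF gd(1)]] by auto
    then obtain c' where c': "weights_on J' c'" "qs c = qs c'"
      using hull_q[OF fin(2)[OF gd(2)]] by auto
    have "weights_on J' c"
      by (rule same_face[OF gd(2) c'(1) c fin(2)[OF gd(1)]]) (simp add: c'(2))
    then show "J \<subseteq> J'"
      using weights_on_outside[of J' c] fin[OF gd(1)] by (force simp: c_def)
  qed (intro hull_mono image_mono)
  have mono_p: "convex hull (p ` J) \<subseteq> convex hull (p ` J') \<longleftrightarrow> J \<subseteq> J'"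
    if gd: "J \<in> Good" "J' \<in> Good" for J J'
  proof
    assume sub: "convex hull (p ` J) \<subseteq> convex hull (p ` J')"
    define c where "c = (\<lambda>k. if k \<in> J then 1 / real (card J) else 0)"
    have c: "weights_on J c" unfolding c_def by (rule weights_on_uniform) (use fin gd in auto)
    then have "ps c \<in> convex hull (p ` J')" using sub hull_p[OF fin(2)[OF gd(1)]] by auto
    then obtain c' where c': "weights_on J' c'" "ps c = ps c'"
      using hull_p[OF fin(2)[OF gd(2)]] by auto
    have "c k = 0" if "k \<notin> J'" for k
      by (rule p_supp[OF \<open>J' \<in> Good\<close> \<open>J \<in> Good\<close> c'(1) c c'(2)[symmetric] that])
    then show "J \<subseteq> J'"
      using fin[OF gd(1)] by (force simp: c_def)
  qed (intro hull_mono image_mono)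

  have all_faces: "(\<lambda>J. convex hull (q ` J)) ` Good = boundary_complex Q"
  proof
    show "(\<lambda>J. convex hull (q ` J)) ` Good \<subseteq> boundary_complex Q"
    proof clarify
      fix J assume J: "J \<in> Good"
      have "convex hull (q ` J) \<noteq> Q"
      proof
        assume eq: "convex hull (q ` J) = Q"
        obtain y where y: "y \<noteq> 0" "J \<subseteq> am y" using sub_occ[OF J] by blast
        have "Q \<subseteq> frontier Q"
        proof
          fix x assume "x \<in> Q"
          then obtain c where c: "weights_on J c" "x = qs c"
            using eq hull_q[OF fin(2)[OF J]] by auto
          have "weights_on (am y) c" by (rule weights_on_mono[OF c(1) _ y(2)]) (use I in \<open>auto simp: am_def\<close>)
          then show "x \<in> frontier Q" using am_frontier[OF y(1)] c by simp
        qed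
        then show False using intQ interior_subset[of Q] by (auto simp: frontier_def)
      qed
      then show "convex hull (q ` J) \<in> boundary_complex Q"
        using face[OF J] fin(3)[OF J] by (simp add: boundary_complex_def)
    qed
    show "boundary_complex Q \<subseteq> (\<lambda>J. convex hull (q ` J)) ` Good"
    proof
      fix F assume "F \<in> boundary_complex Q"
      then have F: "F face_of Q" "F \<noteq> {}" "F \<noteq> Q" by (auto simp: boundary_complex_def)
      then obtain a b where ab: "Q \<subseteq> {x. a \<bullet> x \<le> b}" "F = Q \<inter> {x. a \<bullet> x = b}"
        using exposed_face_of_polyhedron[OF polytope_imp_polyhedron[OF polyQ], of F]
        by (auto simp: exposed_face_of_def)
      have "a \<noteq> 0" using ab F by auto
      then obtain i where i: "i \<in> am a" using ex_am by blast
      then have "q i \<in> Q" by (auto simp: am_def Q_def hull_inc)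
      then have b: "b = a \<bullet> q i" using ab F le_Q[OF i] by force
      have amI: "am a \<subseteq> I" by (auto simp: am_def)
      have "F = convex hull (q ` am a)"
      proof
        show "F \<subseteq> convex hull (q ` am a)"
        proof
          fix x assume x: "x \<in> F"
          then obtain c where c: "weights_on I c" "x = qs c"
            using ab hull_q[of I] by (auto simp: Q_def)
          have "c k = 0" if "k \<notin> am a" for k
            by (rule max_support[OF i c(1) _ _ that]) (use c x ab b in auto)
          then have "weights_on (I \<inter> am a) c" by (intro weights_on_restrict[OF c(1) I])
          then show "x \<in> convex hull (q ` am a)"
            using hull_q[OF amI] c amI by (auto simp: Int_absorb1)
        qed
        show "convex hull (q ` am a) \<subseteq> F"
        proof
          fix x assume x: "x \<in> convex hull (q ` am a)"
          then obtain c where c: "weights_on (am a) c" "x = qs c" using hull_q[OF amI] by auto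
          have "x \<in> Q" using x hull_mono[of "q ` am a" "q ` I"] amI by (auto simp: Q_def)
          then show "x \<in> F" using ab b c am_value[OF c(1) i] by auto
        qed
      qed
      then show "F \<in> (\<lambda>J. convex hull (q ` J)) ` Good" using am_Good[OF \<open>a \<noteq> 0\<close>] by blast
    qed
  qed
  define cp where "cp J = convex hull (p ` J)" for J
  define cq where "cq J = convex hull (q ` J)" for J
  have inj_p: "inj_on cp Good" and inj_q: "inj_on cq Good"
    by (intro inj_onI; metis cp_def cq_def mono_p mono_q subset_refl subset_antisym)+
  have "bij_betw (cq \<circ> inv_into Good cp) (cp ` Good) (cq ` Good)"
    by (intro bij_betw_trans[of _ _ Good] bij_betw_inv_into inj_on_imp_bij_betw inj_p inj_q)
  moreover have "\<sigma> \<subseteq> \<tau> \<longleftrightarrow> (cq \<circ> inv_into Good cp) \<sigma> \<subseteq> (cq \<circ> inv_into Good cp) \<tau>"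
    if st: "\<sigma> \<in> cp ` Good" "\<tau> \<in> cp ` Good" for \<sigma> \<tau>
  proof -
    obtain J J' where "J \<in> Good" "\<sigma> = cp J" "J' \<in> Good" "\<tau> = cp J'" using st by blast
    then show ?thesis
      using mono_p[of J J'] mono_q[of J J'] inj_p by (simp add: cp_def[symmetric] cq_def[symmetric])
  qed
  ultimately have "isomorphic_complexes (cp ` Good) (cq ` Good)"
    unfolding isomorphic_complexes_def by blast
  moreover have "cq ` Good = boundary_complex Q"
    unfolding cq_def using all_faces .
  moreover have "cp ` Good = (\<lambda>J. convex hull (p ` J)) ` Good"
    by (simp add: cp_def)
  ultimately show "isomorphic_complexes ((\<lambda>J. convex hull (p ` J)) ` Good) (boundary_complex (convex hull (q ` I)))"
    by (simp add: Q_def)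
qed

subsection \<open>Hierarchical perturbations\<close>

definition maximizers :: "'i set \<Rightarrow> ('i \<Rightarrow> real) \<Rightarrow> 'i set" where
  "maximizers I f = {i\<in>I. \<forall>j\<in>I. f j \<le> f i}"

definition is_chain :: "'a set set \<Rightarrow> bool" where
  "is_chain C \<longleftrightarrow> (\<forall>s\<in>C. \<forall>t\<in>C. s \<subseteq> t \<or> t \<subseteq> s)"

lemma maximizers_nonempty:
  assumes "finite I" "I \<noteq> {}"
  shows "maximizers I f \<noteq> {}"
proof -
  have "Max (f ` I) \<in> f ` I"
    using assms by (intro Max_in) auto
  then obtain i where "i \<in> I" "f i = Max (f ` I)"
    by (metis imageE)
  then have "i \<in> maximizers I f"
    using assms by (auto simp: maximizers_def)
  then show ?thesis by blast
qed

text \<open>Cutting off the vertices of a simplicial polytope by deep cuts, then its edges by much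
  shallower cuts, and so on: the cut at \<open>t\<close> has depth \<open>\<theta> ^ card t\<close>, and \<open>f t w\<close> tells how far the
  vertex \<open>w\<close> lies beyond it.\<close>
lemma hierarchical_cuts:
  fixes f :: "'v set \<Rightarrow> 'v \<Rightarrow> real" and \<theta> a A :: real
  assumes K: "finite K" "\<And>t. t \<in> K \<Longrightarrow> finite t \<and> t \<noteq> {} \<and> card t \<le> N"
      "\<And>t r. \<lbrakk>t \<in> K; r \<subseteq> t; r \<noteq> {}\<rbrakk> \<Longrightarrow> r \<in> K"
    and f_in: "\<And>t w. \<lbrakk>t \<in> K; w \<in> t\<rbrakk> \<Longrightarrow> f t w = \<theta> ^ card t"
    and f_out: "\<And>t w. \<lbrakk>t \<in> K; w \<in> \<Union>K; w \<notin> t\<rbrakk> \<Longrightarrow> - A \<le> f t w \<and> f t w \<le> - a"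
    and a: "0 < a" "0 < \<theta>" "0 \<le> A" "(1 + A) * (2 * \<theta> / a) + \<theta> \<le> 1 / 4"
    and t': "t' \<in> K" and c: "\<And>w. w \<in> t' \<Longrightarrow> 0 \<le> c w" "sum c t' = 1"
  defines "D \<equiv> maximizers K (\<lambda>t. \<Sum>w\<in>t'. c w * f t w)"
  shows "is_chain D" and "\<And>t. t \<in> D \<Longrightarrow> t \<subseteq> t'"
    and "\<And>t w. \<lbrakk>t \<in> D; w \<in> t\<rbrakk> \<Longrightarrow> \<theta> ^ N / (2 * (1 + A)) \<le> c w"
proof -
  define F where "F t = (\<Sum>w\<in>t'. c w * f t w)" for t
  define out where "out t = sum c (t' - t)" for t
  have fin: "finite t'" using K(2) t' by blast
  have \<theta>1: "\<theta> \<le> 1 / 4" "2 * \<theta> / a \<le> 1 / 2" "(1 + A) * (\<theta> / a) \<le> 1 / 4"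
  proof -
    have p: "0 < 2 * \<theta> / a" using a by simp
    then have "0 \<le> A * (2 * \<theta> / a)" using a by simp
    moreover have e: "(1 + A) * (2 * \<theta> / a) = 2 * \<theta> / a + A * (2 * \<theta> / a)" by (rule distrib_right[of 1 A, unfolded mult_1])
    ultimately show "\<theta> \<le> 1 / 4" "2 * \<theta> / a \<le> 1 / 2" using p a by linarith+
    have "(1 + A) * (2 * \<theta> / a) = 2 * ((1 + A) * (\<theta> / a))" by simp
    then show "(1 + A) * (\<theta> / a) \<le> 1 / 4" using a by linarith
  qed
  have split: "F t = \<theta> ^ card t * (1 - out t) + (\<Sum>w\<in>t' - t. c w * f t w)" if "t \<in> K" for t
  proof -
    have eq: "t' = (t' \<inter> t) \<union> (t' - t)" by blast
    have "sum c t' = sum c (t' \<inter> t) + out t"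
      unfolding out_def by (subst eq, subst sum.union_disjoint) (use fin in auto)
    then have "sum c (t' \<inter> t) = 1 - out t" using c by simp
    moreover have "F t = (\<Sum>w\<in>t' \<inter> t. c w * f t w) + (\<Sum>w\<in>t' - t. c w * f t w)"
      unfolding F_def by (subst (1) eq, subst sum.union_disjoint) (use fin in auto)
    moreover have "(\<Sum>w\<in>t' \<inter> t. c w * f t w) = (\<Sum>w\<in>t' \<inter> t. c w * \<theta> ^ card t)"
      by (intro sum.cong) (use f_in that in auto)
    moreover have "(\<Sum>w\<in>t' \<inter> t. c w * \<theta> ^ card t) = sum c (t' \<inter> t) * \<theta> ^ card t"
      by (rule sum_distrib_right[symmetric])
    ultimately show ?thesis by (simp add: mult.commute)
  qed
  have out_nn: "0 \<le> out t" for t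
    unfolding out_def by (intro sum_nonneg) (use c in auto)
  have pow: "0 < \<theta> ^ n" "\<theta> ^ n \<le> 1" for n
    using a \<theta>1 by (auto intro: power_le_one)
  \<comment> \<open>Here and in \<open>lower\<close>, the value at \<open>t\<close> is controlled by
    its depth and the weight \<open>out t\<close> outside it alone. Weight outside costs at least
    \<open>a\<close> and at most \<open>1 + A\<close> per unit; the 1 accounts for the depth not
    gained there.\<close>
  have upper: "F t \<le> \<theta> ^ card t - a * out t" if "t \<in> K" for t
  proof -
    have "(\<Sum>w\<in>t' - t. c w * f t w) \<le> (\<Sum>w\<in>t' - t. c w * (- a))"
      by (intro sum_mono mult_left_mono) (use c f_out that t' in auto)
    also have "\<dots> = - a * out t" by (simp add: out_def sum_distrib_left mult.commute sum_negf)
    finally have "F t \<le> \<theta> ^ card t * (1 - out t) - a * out t" using split[OF that] by simp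
    moreover have "\<theta> ^ card t * (1 - out t) \<le> \<theta> ^ card t * 1"
      using pow out_nn by (intro mult_left_mono) (auto simp: less_imp_le)
    ultimately show ?thesis by simp
  qed
  have lower: "\<theta> ^ card t - (1 + A) * out t \<le> F t" if "t \<in> K" for t
  proof -
    have "(\<Sum>w\<in>t' - t. c w * (- A)) \<le> (\<Sum>w\<in>t' - t. c w * f t w)"
      by (intro sum_mono mult_left_mono) (use c f_out that t' in auto)
    moreover have "(\<Sum>w\<in>t' - t. c w * (- A)) = - A * out t"
      by (simp add: out_def sum_distrib_left mult.commute sum_negf)
    moreover have "\<theta> ^ card t * out t \<le> 1 * out t"
      using pow out_nn by (intro mult_right_mono) auto
    ultimately show ?thesis using split[OF that] by (simp add: algebra_simps)
  qed
  have D: "t \<in> K" "\<And>r. r \<in> K \<Longrightarrow> F r \<le> F t" if "t \<in> D" for t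
    using that by (auto simp: D_def F_def maximizers_def)
  have F_le: "F t \<le> \<theta> ^ card t" if "t \<in> K" for t
    using upper[OF that] mult_nonneg_nonneg[of a "out t"] a out_nn[of t] by linarith
  \<comment> \<open>The cut at \<open>t'\<close> has a positive value, hence so has a maximizer,
    which limits the weight it can leave out.\<close>
  have out_le: "out t \<le> \<theta> ^ card t / a" if "t \<in> D" for t
  proof -
    have "0 < F t'"
      using split[OF t'] pow[of "card t'"] by (simp add: out_def)
    then have "0 < F t" using D(2)[OF that t'] by linarith
    then have "a * out t \<le> \<theta> ^ card t" using upper[OF D(1)[OF that]] by linarith
    then show ?thesis using a by (simp add: field_simps)
  qed
  have step: "\<theta> ^ card t \<le> \<theta> * \<theta> ^ card p" if "card p < card t" for p t :: "'v set"
  proof -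
    have "\<theta> ^ card t \<le> \<theta> ^ Suc (card p)"
      using that a \<theta>1 by (intro power_decreasing) auto
    then show ?thesis by simp
  qed
  text \<open>Otherwise the cut at \<open>r \<inter> t \<inter> t'\<close>, being much deeper, would win over those at \<open>r\<close> and \<open>t\<close>.\<close>
  have key: "r \<subseteq> t \<inter> t' \<or> t \<subseteq> r \<inter> t'" if "r \<in> D" "t \<in> D" for r t
  proof (rule ccontr)
    assume *: "\<not> ?thesis"
    define p where "p = r \<inter> t \<inter> t'"
    have fr: "finite r" "finite t" using D(1) that K(2) by blast+
    have sub: "p \<subset> r" "p \<subset> t" using * by (auto simp: p_def)
    then have card: "card p < card r" "card p < card t"
      using fr psubset_card_mono by blast+
    have "out p = sum c ((t' - r) \<union> (t' - t))"
      unfolding out_def p_def by (rule arg_cong[where f = "sum c"]) blast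
    also have "\<dots> \<le> out r + out t"
      unfolding out_def using fin c by (subst sum_Un) (auto intro!: sum_nonneg)
    also have "\<dots> \<le> \<theta> ^ card r / a + \<theta> ^ card t / a"
      using out_le that by (simp add: add_mono)
    also have "\<dots> \<le> \<theta> * \<theta> ^ card p / a + \<theta> * \<theta> ^ card p / a"
      using step[OF card(1)] step[OF card(2)] a by (intro add_mono divide_right_mono) auto
    finally have outp: "out p \<le> 2 * \<theta> / a * \<theta> ^ card p" by (simp add: field_simps)
    have "2 * \<theta> / a * \<theta> ^ card p \<le> 1 / 2 * 1"
      using \<theta>1 pow a by (intro mult_mono) (auto intro: less_imp_le)
    then have "out p < 1" using outp by linarith
    then have "p \<noteq> {}" using c by (auto simp: out_def)
    then have "p \<in> K" using K(3) t' unfolding p_def by (metis inf_le2)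
    have "(1 + A) * out p \<le> (1 + A) * (2 * \<theta> / a * \<theta> ^ card p)"
      using outp a by (intro mult_left_mono) auto
    also have "\<dots> = (1 + A) * (2 * \<theta> / a) * \<theta> ^ card p" by simp
    also have "\<dots> \<le> (1 / 2 - \<theta>) * \<theta> ^ card p"
      using a pow[of "card p"] by (intro mult_right_mono) auto
    finally have "\<theta> ^ card p - (1 / 2 - \<theta>) * \<theta> ^ card p \<le> F p" using lower[OF \<open>p \<in> K\<close>] by linarith
    moreover have "F p \<le> F r" by (rule D(2)[OF that(1) \<open>p \<in> K\<close>])
    moreover have "F r \<le> \<theta> * \<theta> ^ card p"
      using F_le[OF D(1)[OF that(1)]] step[OF card(1)] by linarith
    ultimately have "\<theta> ^ card p * (1 / 2) \<le> 0" by (simp add: algebra_simps)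
    then show False using pow[of "card p"] by simp
  qed
  show "is_chain D" using key by (auto simp: is_chain_def)
  \<comment> \<open>The diagonal instance of \<open>key\<close> is not vacuous, because of the
    intersection with \<open>t'\<close> on its right-hand sides.\<close>
  show "t \<subseteq> t'" if "t \<in> D" for t using key[OF that that] by blast
  show "\<theta> ^ N / (2 * (1 + A)) \<le> c w" if "t \<in> D" "w \<in> t" for t w
  proof -
    have tK: "t \<in> K" "finite t" "card t \<le> N" "t \<subseteq> t'" using D(1) K(2) that key[OF that(1) that(1)] by blast+
    then have w: "w \<in> t'" "t' - (t - {w}) = insert w (t' - t)" using that by auto
    \<comment> \<open>The cut at \<open>t - {w}\<close> is much deeper and still does not beat
      \<open>t\<close>. So its additional loss is substantial, and as \<open>out t\<close> is small
      this can only be due to \<open>c w\<close>.\<close>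
    have outw: "out (t - {w}) = c w + out t"
      unfolding out_def w(2) using fin that by (subst sum.insert) auto
    show ?thesis
    proof (cases "t = {w}")
      \<comment> \<open>No cut belongs to the empty set, so singletons are treated directly: at
        least half of the weight lies on \<open>w\<close>.\<close>
      case True
      have "out t \<le> \<theta> / a" using out_le[OF that(1)] True by simp
      moreover have "out {} = 1" using c by (simp add: out_def)
      ultimately have "c w \<ge> 1 / 2" using outw True \<theta>1 by simp
      moreover have "\<theta> ^ N / (2 * (1 + A)) \<le> 1 / 2"
        using pow[of N] a by (simp add: field_simps)
      ultimately show ?thesis by linarith
    next
      case False
      define p where "p = t - {w}"
      have p: "p \<in> K" using False that tK K(3)[OF tK(1), of p] by (auto simp: p_def)
      have "card p < card t" unfolding p_def using that tK by (intro card_Diff1_less)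
      note st = step[OF this]
      have "(1 + A) * out t \<le> (1 + A) * (\<theta> * \<theta> ^ card p / a)"
        using st a by (intro mult_left_mono order.trans[OF out_le[OF that(1)]] divide_right_mono) auto
      also have "\<dots> = (1 + A) * (\<theta> / a) * \<theta> ^ card p" by simp
      also have "\<dots> \<le> 1 / 4 * \<theta> ^ card p" using \<theta>1 pow[of "card p"] by (intro mult_right_mono) auto
      finally have o: "(1 + A) * out t \<le> 1 / 4 * \<theta> ^ card p" .
      have "\<theta> ^ card p - (1 + A) * (c w + out t) \<le> \<theta> * \<theta> ^ card p"
        using lower[OF p] D(2)[OF that(1) p] F_le[OF tK(1)] st unfolding p_def outw[symmetric] by linarith
      moreover have "\<theta> * \<theta> ^ card p \<le> 1 / 4 * \<theta> ^ card p"
        using \<theta>1 pow[of "card p"] by (intro mult_right_mono) auto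
      ultimately have "\<theta> ^ card p / 2 \<le> (1 + A) * c w"
        using o by (simp add: algebra_simps)
      moreover have "\<theta> ^ N \<le> \<theta> ^ card p"
        using \<open>card p < card t\<close> tK a \<theta>1 by (intro power_decreasing) auto
      ultimately show ?thesis using a by (simp add: field_simps)
    qed
  qed
qed

text \<open>Raising the barycentres of the faces of a simplicial polytope, those of higher dimension by
  much more: the barycentre of \<open>s\<close> is scaled by \<open>1 + \<theta> ^ (N + 1 - card s)\<close>. Here \<open>v w\<close> is the
  value at the vertex \<open>w\<close> of a linear functional with maximum \<open>M\<close> on the polytope.\<close>
lemma hierarchical_stellar_raising:
  fixes v :: "'v \<Rightarrow> real" and \<theta> \<gamma> M :: real
  assumes K: "\<And>t. t \<in> K \<Longrightarrow> finite t \<and> t \<noteq> {} \<and> card t \<le> N"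
      "\<And>w. w \<in> \<Union>K \<Longrightarrow> {w} \<in> K"
    and nonface: "\<And>r. \<lbrakk>r \<subseteq> \<Union>K; finite r; r \<noteq> {}; r \<notin> K\<rbrakk> \<Longrightarrow> \<exists>w\<in>r. v w \<le> (1 - \<gamma>) * M"
    and M: "\<And>w. w \<in> \<Union>K \<Longrightarrow> v w \<le> M" "w0 \<in> \<Union>K" "v w0 = M" "0 < M"
    and \<theta>: "0 < \<theta>" "\<theta> * (2 * real N + 1) < 1" "real N * \<theta> < \<gamma>"
  defines "C \<equiv> maximizers K (\<lambda>s. (1 + \<theta> ^ (Suc N - card s)) * (sum v s / real (card s)))"
  shows "is_chain C" and "\<And>s w. \<lbrakk>s \<in> C; w \<in> s\<rbrakk> \<Longrightarrow> (1 - real N * \<theta>) * M \<le> v w"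
proof -
  define \<eta> where "\<eta> s = \<theta> ^ (Suc N - card s)" for s :: "'v set"
  define G where "G s = (1 + \<eta> s) * (sum v s / real (card s))" for s
  have \<theta>1: "\<theta> \<le> 1"
  proof -
    have "0 \<le> \<theta> * (2 * real N)" using \<theta> by simp
    then show ?thesis using \<theta>(2) by (simp add: algebra_simps)
  qed
  have \<eta>_pos: "0 < \<eta> s" for s using \<theta> by (simp add: \<eta>_def)
  \<comment> \<open>The exponent is at least 1 even for the largest simplices, owing to the
    \<open>Suc\<close>.\<close>
  have \<eta>_le: "\<eta> s \<le> \<theta>" if "s \<in> K" for s
  proof -
    have "Suc N - card s \<ge> 1" using K(1)[OF that] by auto
    then have "\<theta> ^ (Suc N - card s) \<le> \<theta> ^ 1" using \<theta> \<theta>1 by (intro power_decreasing) auto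
    then show ?thesis by (simp add: \<eta>_def)
  qed
  have C: "s \<in> K" "\<And>r. r \<in> K \<Longrightarrow> G r \<le> G s" if "s \<in> C" for s
    using that by (auto simp: C_def G_def \<eta>_def maximizers_def)
  have G_le: "G s \<le> (1 + \<eta> s) * M" if "s \<in> K" for s
  proof -
    have "sum v s \<le> real (card s) * M"
      using sum_bounded_above[of s v M] M(1) that by auto
    moreover have "0 < card s" using K(1)[OF that] by (simp add: card_gt_0_iff)
    ultimately have "sum v s / real (card s) \<le> M" by (simp add: field_simps)
    then show ?thesis unfolding G_def using \<eta>_pos[of s] by (intro mult_left_mono) auto
  qed
  \<comment> \<open>A maximizer is at least as high as the raised vertex \<open>w0\<close>, so the
    mean of \<open>v\<close> over \<open>s\<close> is at least \<open>(1 - \<eta> s) * M\<close>. As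
    no vertex exceeds \<open>M\<close>, a single one falls short by at most
    \<open>card s * \<eta> s * M\<close>.\<close>
  have near: "(1 - real N * \<eta> s) * M \<le> v w" if "s \<in> C" "w \<in> s" for s w
  proof -
    have s: "finite s" "0 < card s" "card s \<le> N"
      using K(1)[OF C(1)[OF that(1)]] by (auto simp: card_gt_0_iff)
    have "(1 + \<eta> {w0}) * M \<le> G s"
      using C(2)[OF that(1) K(2)[OF M(2)]] M(3) by (simp add: G_def)
    moreover have "0 < \<eta> {w0} * M" using \<eta>_pos M by simp
    ultimately have "M \<le> (1 + \<eta> s) * (sum v s / real (card s))" by (simp add: G_def algebra_simps)
    then have 1: "real (card s) * M \<le> (1 + \<eta> s) * sum v s" using s by (simp add: field_simps)
    have "(1 - \<eta> s) * (real (card s) * M) \<le> sum v s"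
    proof -
      have "(1 - \<eta> s) * (real (card s) * M) * (1 + \<eta> s) = real (card s) * M - (\<eta> s)\<^sup>2 * (real (card s) * M)"
        by (simp add: power2_eq_square algebra_simps)
      also have "\<dots> \<le> real (card s) * M" using M s by simp
      also have "\<dots> \<le> sum v s * (1 + \<eta> s)" using 1 by (simp add: mult.commute)
      finally show ?thesis by (rule mult_right_le_imp_le) (use \<eta>_pos[of s] in linarith)
    qed
    moreover have "sum v s = v w + sum v (s - {w})" using s that by (simp add: sum.remove)
    moreover have "sum v (s - {w}) \<le> real (card s - 1) * M"
    proof -
      have "sum v (s - {w}) \<le> real (card (s - {w})) * M"
        using sum_bounded_above[of "s - {w}" v M] M(1) C(1)[OF that(1)] by auto
      then show ?thesis using that s by simp
    qed
    moreover have "real (card s - 1) * M = real (card s) * M - M" using s by (simp add: algebra_simps of_nat_diff)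
    ultimately have "M - \<eta> s * real (card s) * M \<le> v w" by (simp add: algebra_simps)
    moreover have "\<eta> s * real (card s) * M \<le> \<eta> s * real N * M"
      using s M \<eta>_pos[of s] by (intro mult_right_mono mult_left_mono) auto
    ultimately show ?thesis by (simp add: algebra_simps)
  qed
  have near': "(1 - real N * x) * M \<le> v w" if "s \<in> C" "w \<in> s" "\<eta> s \<le> x" for s w x
  proof -
    have "real N * \<eta> s * M \<le> real N * x * M" using that M by (intro mult_right_mono mult_left_mono) auto
    then show ?thesis using near[OF that(1,2)] by (simp add: algebra_simps)
  qed
  show "(1 - real N * \<theta>) * M \<le> v w" if "s \<in> C" "w \<in> s" for s w
    using near'[OF that \<eta>_le] C(1)[OF that(1)] by blast
  have "s \<subseteq> s' \<or> s' \<subseteq> s" if "s \<in> C" "s' \<in> C" for s s'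
  proof (rule ccontr)
    assume *: "\<not> ?thesis"
    \<comment> \<open>Either the union is a nonface, and then one of its vertices is too low, or it
      is a simplex, raised so much more than \<open>s\<close> and \<open>s'\<close> that it beats
      them.\<close>
    define r where "r = s \<union> s'"
    have fin: "finite r" "r \<noteq> {}" "r \<subseteq> \<Union>K"
      using K(1)[OF C(1)[OF that(1)]] K(1)[OF C(1)[OF that(2)]] C(1) that by (auto simp: r_def)
    show False
    proof (cases "r \<in> K")
      case False
      then obtain w where w: "w \<in> r" "v w \<le> (1 - \<gamma>) * M" using nonface fin by blast
      have "(1 - real N * \<theta>) * M \<le> v w"
        using w(1) near'[OF that(1) _ \<eta>_le[OF C(1)[OF that(1)]], of w]
          near'[OF that(2) _ \<eta>_le[OF C(1)[OF that(2)]], of w] by (auto simp: r_def)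
      then have "(1 - real N * \<theta>) * M \<le> (1 - \<gamma>) * M" using w by linarith
      then show False using M \<theta> by simp
    next
      case True
      have small: "\<eta> u \<le> \<theta> * \<eta> r" if "u \<subset> r" for u
      proof -
        have "card u < card r" using that fin by (simp add: psubset_card_mono)
        moreover have "card r \<le> N" using K(1)[OF True] by blast
        ultimately have "Suc (Suc N - card r) \<le> Suc N - card u" by linarith
        then have "\<theta> ^ (Suc N - card u) \<le> \<theta> ^ Suc (Suc N - card r)"
          using \<theta> \<theta>1 by (intro power_decreasing) auto
        then show ?thesis by (simp add: \<eta>_def)
      qed
      have sub: "s \<subset> r" "s' \<subset> r" using * by (auto simp: r_def)
      define L where "L = (1 - real N * (\<theta> * \<eta> r)) * M"
      have "L \<le> v w" if "w \<in> r" for w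
        using that near'[OF \<open>s \<in> C\<close> _ small[OF sub(1)], of w] near'[OF \<open>s' \<in> C\<close> _ small[OF sub(2)], of w]
        by (auto simp: r_def L_def)
      then have "real (card r) * L \<le> sum v r" using sum_bounded_below[of r L v] by auto
      moreover have "0 < card r" using fin by (simp add: card_gt_0_iff)
      ultimately have "L \<le> sum v r / real (card r)" by (simp add: field_simps)
      then have "(1 + \<eta> r) * L \<le> G r" unfolding G_def using \<eta>_pos[of r] by (intro mult_left_mono) auto
      also have "\<dots> \<le> G s" by (rule C(2)[OF that(1) True])
      also have "\<dots> \<le> (1 + \<eta> s) * M" by (rule G_le[OF C(1)[OF that(1)]])
      also have "\<dots> \<le> (1 + \<theta> * \<eta> r) * M" using small[OF sub(1)] M by (intro mult_right_mono) auto
      finally have "((1 + \<eta> r) * (1 - real N * (\<theta> * \<eta> r))) * M \<le> (1 + \<theta> * \<eta> r) * M"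
        by (simp add: L_def mult.assoc)
      then have "(1 + \<eta> r) * (1 - real N * (\<theta> * \<eta> r)) \<le> 1 + \<theta> * \<eta> r"
        using M by simp
      then have "\<eta> r * 1 \<le> \<eta> r * (\<theta> + real N * \<theta> + real N * \<theta> * \<eta> r)"
        by (simp add: algebra_simps)
      \<comment> \<open>As \<open>\<eta> r \<le> 1\<close>, the right side is at most
        \<open>\<theta> * (2 * N + 1)\<close>; this is where that bound comes from.\<close>
      then have "1 \<le> \<theta> + real N * \<theta> + real N * \<theta> * \<eta> r"
        using \<eta>_pos[of r] by (simp only: mult_le_cancel_left_pos)
      moreover have "real N * \<theta> * \<eta> r \<le> real N * \<theta> * 1"
        using \<eta>_le[OF True] \<theta>1 \<theta> by (intro mult_left_mono) auto
      ultimately show False using \<theta>(2) by (simp add: algebra_simps)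
    qed
  qed
  then show "is_chain C" by (auto simp: is_chain_def)
qed

subsection \<open>Fans over boundary triangulations\<close>

lemma is_chain_subset: "is_chain C \<Longrightarrow> B \<subseteq> C \<Longrightarrow> is_chain B"
  by (auto simp: is_chain_def)

lemma chain_top:
  assumes "finite C" "C \<noteq> {}" "is_chain C" "\<And>s. s \<in> C \<Longrightarrow> finite s"
  obtains t where "t \<in> C" "\<And>s. s \<in> C \<Longrightarrow> s \<subseteq> t"
proof -
  obtain t where t: "t \<in> C" "\<And>s. s \<in> C \<Longrightarrow> card s \<le> card t"
    using maximizers_nonempty[OF assms(1,2), of "\<lambda>s. real (card s)"] by (auto simp: maximizers_def)
  have "s \<subseteq> t" if "s \<in> C" for s
    using assms(3,4) t that card_seteq[of s t] by (auto simp: is_chain_def)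
  then show ?thesis using t that by blast
qed

lemma chain_bottom:
  assumes "finite C" "C \<noteq> {}" "is_chain C" "\<And>s. s \<in> C \<Longrightarrow> finite s"
  obtains t where "t \<in> C" "\<And>s. s \<in> C \<Longrightarrow> t \<subseteq> s"
proof -
  obtain t where t: "t \<in> C" "\<And>s. s \<in> C \<Longrightarrow> card t \<le> card s"
    using maximizers_nonempty[OF assms(1,2), of "\<lambda>s. - real (card s)"] by (auto simp: maximizers_def)
  have "t \<subseteq> s" if "s \<in> C" for s
    using assms(3,4) t that card_seteq[of t s] by (auto simp: is_chain_def)
  then show ?thesis using t that by blast
qed

text \<open>The system is triangular: the largest set with nonzero coefficient has a vertex in none
  of the other such sets, so only one term contributes at that vertex. With suitable weights this
  covers both perturbed and true barycentres.\<close>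

lemma chain_combination_eq_0:
  fixes \<alpha> :: "'a::real_vector set \<Rightarrow> 'a \<Rightarrow> real"
  assumes C: "finite C" "is_chain C" "{} \<notin> C" and ind: "independent (\<Union>C)"
    and fin: "finite (\<Union>C)"
    and \<alpha>: "\<And>s m. \<lbrakk>s \<in> C; m \<in> s\<rbrakk> \<Longrightarrow> 0 < \<alpha> s m"
    and zero: "(\<Sum>s\<in>C. x s *\<^sub>R (\<Sum>m\<in>s. \<alpha> s m *\<^sub>R m)) = 0"
    and s: "s \<in> C"
  shows "x s = 0"
proof (rule ccontr)
  assume "x s \<noteq> 0"
  define S where "S = {s\<in>C. x s \<noteq> 0}"
  have S: "finite S" "is_chain S" "S \<noteq> {}" and finS: "\<And>s. s \<in> S \<Longrightarrow> finite s"
    using C \<open>x s \<noteq> 0\<close> s fin by (auto simp: S_def intro: is_chain_subset finite_subset[of _ "\<Union>C"])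
  obtain t where t: "t \<in> S" "\<And>s. s \<in> S \<Longrightarrow> s \<subseteq> t"
    using chain_top[OF S(1,3,2) finS] by blast
  obtain m where m: "m \<in> t" "\<And>s. s \<in> S \<Longrightarrow> s \<noteq> t \<Longrightarrow> m \<notin> s"
  proof (cases "S - {t} = {}")
    case True
    have "t \<noteq> {}" using t(1) C(3) by (auto simp: S_def)
    then show ?thesis using that True by blast
  next
    case False
    obtain u where u: "u \<in> S - {t}" "\<And>s. s \<in> S - {t} \<Longrightarrow> s \<subseteq> u"
      by (rule chain_top[of "S - {t}"]) (use S False finS in \<open>auto intro: is_chain_subset\<close>)
    then have "u \<subset> t" using t by blast
    then obtain m where "m \<in> t" "m \<notin> u" by blast
    then show ?thesis using that u by blast
  qed
  define g where "g m = (\<Sum>s\<in>C. if m \<in> s then x s * \<alpha> s m else 0)" for m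
  have "(\<Sum>s\<in>C. x s *\<^sub>R (\<Sum>m\<in>s. \<alpha> s m *\<^sub>R m))
      = (\<Sum>s\<in>C. \<Sum>m\<in>\<Union>C. (if m \<in> s then x s * \<alpha> s m else 0) *\<^sub>R m)"
  proof (rule sum.cong)
    fix s assume s: "s \<in> C"
    have "(\<Sum>m\<in>\<Union>C. (if m \<in> s then x s * \<alpha> s m else 0) *\<^sub>R m)
        = (\<Sum>m\<in>s. (if m \<in> s then x s * \<alpha> s m else 0) *\<^sub>R m)"
      by (rule sum.mono_neutral_right) (use fin s in auto)
    then show "x s *\<^sub>R (\<Sum>m\<in>s. \<alpha> s m *\<^sub>R m) = (\<Sum>m\<in>\<Union>C. (if m \<in> s then x s * \<alpha> s m else 0) *\<^sub>R m)"
      by (simp add: scaleR_sum_right)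
  qed simp
  also have "\<dots> = (\<Sum>m\<in>\<Union>C. g m *\<^sub>R m)"
    by (subst sum.swap) (simp add: g_def scaleR_sum_left)
  finally have "(\<Sum>m\<in>\<Union>C. g m *\<^sub>R m) = 0" using zero by simp
  moreover have "m \<in> \<Union>C" using m(1) t(1) by (auto simp: S_def)
  ultimately have "g m = 0" by (rule independentD[OF ind fin subset_refl])
  moreover have "g m = (\<Sum>s\<in>{t}. if m \<in> s then x s * \<alpha> s m else 0)"
    unfolding g_def by (rule sum.mono_neutral_right) (use C(1) t(1) m in \<open>auto simp: S_def\<close>)
  ultimately have "x t * \<alpha> t m = 0" using m(1) by simp
  moreover have "t \<in> C" "x t \<noteq> 0" using t(1) by (auto simp: S_def)
  ultimately show False using \<alpha>[of t m] m(1) by simp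
qed

text \<open>With \<open>g t w = b t \<bullet> w - \<kappa> w\<close> this yields the independence of
  the vertices of B along a chain, tested only on the vertices of that chain. Elimination starts at
  the smallest set \<open>u\<close> with nonzero coefficient: for \<open>w\<close> in
  \<open>u\<close> and \<open>w'\<close> in the next set but not in \<open>u\<close>, all other
  terms agree. Differences cannot see a coefficient that is left alone; \<open>sum0\<close> disposes
  of it.\<close>

lemma chain_triangular_eq_0:
  fixes x :: "'v set \<Rightarrow> real" and g :: "'v set \<Rightarrow> 'v \<Rightarrow> real"
  assumes D: "finite D" "is_chain D" "{} \<notin> D" "\<And>t. t \<in> D \<Longrightarrow> finite t"
    and g_in: "\<And>t w. \<lbrakk>t \<in> D; w \<in> t\<rbrakk> \<Longrightarrow> g t w = d t" "\<And>t. t \<in> D \<Longrightarrow> 0 < d t"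
    and g_out: "\<And>t w. \<lbrakk>t \<in> D; w \<in> \<Union>D; w \<notin> t\<rbrakk> \<Longrightarrow> g t w < 0"
    and const: "\<And>w. w \<in> \<Union>D \<Longrightarrow> (\<Sum>t\<in>D. x t * g t w) = E"
    and sum0: "sum x D = 0" and t: "t \<in> D"
  shows "x t = 0"
proof (rule ccontr)
  assume "x t \<noteq> 0"
  define S where "S = {t\<in>D. x t \<noteq> 0}"
  have S: "finite S" "is_chain S" "S \<noteq> {}" and finS: "\<And>s. s \<in> S \<Longrightarrow> finite s"
    using D \<open>x t \<noteq> 0\<close> t by (auto simp: S_def intro: is_chain_subset)
  have SD: "S \<subseteq> D" by (auto simp: S_def)
  obtain u where u: "u \<in> S" "\<And>s. s \<in> S \<Longrightarrow> u \<subseteq> s"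
    using chain_bottom[OF S(1,3,2) finS] by blast
  have "S - {u} \<noteq> {}"
  proof
    assume "S - {u} = {}"
    then have "S = {u}" using u by blast
    moreover have "sum x S = sum x D"
      by (rule sum.mono_neutral_left) (use D in \<open>auto simp: S_def\<close>)
    ultimately have "x u = 0" using sum0 by simp
    then show False using u(1) by (simp add: S_def)
  qed
  then obtain u' where u': "u' \<in> S - {u}" "\<And>s. s \<in> S - {u} \<Longrightarrow> u' \<subseteq> s"
    using chain_bottom[of "S - {u}"] S finS by (metis DiffD1 Diff_subset finite_Diff is_chain_subset)
  have "u \<subset> u'" using u u' by blast
  then obtain w' where w': "w' \<in> u'" "w' \<notin> u" by blast
  obtain w where w: "w \<in> u" using u SD D(3) by (metis ex_in_conv subsetD)
  have U: "w \<in> \<Union>D" "w' \<in> \<Union>D" "u \<in> D" using u u' w w' SD by auto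
  have "(\<Sum>t\<in>D. x t * (g t w - g t w')) = (\<Sum>t\<in>{u}. x t * (g t w - g t w'))"
  proof (rule sum.mono_neutral_right[OF D(1)])
    show "\<forall>t\<in>D - {u}. x t * (g t w - g t w') = 0"
    proof
      fix t assume t: "t \<in> D - {u}"
      show "x t * (g t w - g t w') = 0"
      proof (cases "x t = 0")
        case False
        then have "t \<in> S - {u}" using t by (auto simp: S_def)
        then have "w \<in> t" "w' \<in> t" using u(2)[of t] u'(2)[of t] w w' by auto
        then show ?thesis using g_in(1)[of t] t by simp
      qed simp
    qed
  qed (use U in auto)
  moreover have "(\<Sum>t\<in>D. x t * (g t w - g t w')) = 0"
    using const[OF U(1)] const[OF U(2)] by (simp add: right_diff_distrib sum_subtractf)
  ultimately have "x u * (g u w - g u w') = 0" by simp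
  moreover have "g u w - g u w' > 0"
    using g_in[OF U(3)] w g_out[OF U(3,2) w'(2)] by (smt (verit))
  ultimately show False using u by (simp add: S_def)
qed

text \<open>Complementary slackness: pairing with \<open>\<phi>\<close> shows that \<open>g\<close>
  has the least \<open>\<kappa>\<close>-value among nonnegative representations of the point, and
  likewise \<open>g'\<close> by \<open>\<phi>'\<close>. So the values agree, \<open>g'\<close> too
  lives where \<open>\<phi>\<close> touches \<open>\<kappa>\<close>, and independence applies.
  Geometrically, the cones of a regular fan meet in common faces.\<close>

lemma cone_representation_unique:
  fixes \<phi> \<phi>' :: "'a::real_inner"
  assumes V: "finite V" and le: "\<And>m. m \<in> V \<Longrightarrow> \<phi> \<bullet> m \<le> \<kappa> m" "\<And>m. m \<in> V \<Longrightarrow> \<phi>' \<bullet> m \<le> \<kappa> m"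
    and nn: "\<And>m. m \<in> V \<Longrightarrow> 0 \<le> g m" "\<And>m. m \<in> V \<Longrightarrow> 0 \<le> g' m"
    and supp: "\<And>m. \<lbrakk>m \<in> V; \<phi> \<bullet> m \<noteq> \<kappa> m\<rbrakk> \<Longrightarrow> g m = 0" "\<And>m. \<lbrakk>m \<in> V; \<phi>' \<bullet> m \<noteq> \<kappa> m\<rbrakk> \<Longrightarrow> g' m = 0"
    and ind: "independent {m\<in>V. \<phi> \<bullet> m = \<kappa> m}"
    and eq: "(\<Sum>m\<in>V. g m *\<^sub>R m) = (\<Sum>m\<in>V. g' m *\<^sub>R m)"
    and m: "m \<in> V"
  shows "g m = g' m"
proof -
  define val where "val g = (\<Sum>m\<in>V. g m * \<kappa> m)" for g
  have val: "f \<bullet> (\<Sum>m\<in>V. k m *\<^sub>R m) = val k" if "\<And>m. m \<in> V \<Longrightarrow> f \<bullet> m \<noteq> \<kappa> m \<Longrightarrow> k m = 0" for f k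
    unfolding val_def inner_sum_right inner_scaleR_right by (intro sum.cong) (use that in auto)
  have val_le: "f \<bullet> (\<Sum>m\<in>V. k m *\<^sub>R m) \<le> val k"
    if "\<And>m. m \<in> V \<Longrightarrow> f \<bullet> m \<le> \<kappa> m" "\<And>m. m \<in> V \<Longrightarrow> 0 \<le> k m" for f k
    unfolding val_def inner_sum_right inner_scaleR_right by (intro sum_mono mult_left_mono that)
  have "val g \<le> val g'" using val[of \<phi> g, OF supp(1)] val_le[of \<phi> g', OF le(1) nn(2)] eq by simp
  moreover have "val g' \<le> val g" using val[of \<phi>' g', OF supp(2)] val_le[of \<phi>' g, OF le(2) nn(1)] eq by simp
  ultimately have val_eq: "val g = val g'" by simp
  have "(\<Sum>m\<in>V. g' m * (\<kappa> m - \<phi> \<bullet> m)) = val g' - \<phi> \<bullet> (\<Sum>m\<in>V. g' m *\<^sub>R m)"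
    by (simp add: val_def inner_sum_right right_diff_distrib sum_subtractf)
  also have "\<dots> = 0" using val[of \<phi> g, OF supp(1)] eq val_eq by simp
  finally have "\<forall>m\<in>V. g' m * (\<kappa> m - \<phi> \<bullet> m) = 0"
    by (subst (asm) sum_nonneg_eq_0_iff) (use V nn le in auto)
  then have supp': "g' m = 0" if "m \<in> V" "\<phi> \<bullet> m \<noteq> \<kappa> m" for m
    using that by auto
  let ?T = "{m\<in>V. \<phi> \<bullet> m = \<kappa> m}"
  show ?thesis
  proof (cases "m \<in> ?T")
    case True
    have "(\<Sum>m\<in>?T. (g m - g' m) *\<^sub>R m) = (\<Sum>m\<in>V. (g m - g' m) *\<^sub>R m)"
      by (rule sum.mono_neutral_left) (use V supp supp' in auto)
    also have "\<dots> = 0" using eq by (simp add: scaleR_left_diff_distrib sum_subtractf)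
    finally have "(\<Sum>m\<in>?T. (g m - g' m) *\<^sub>R m) = 0" .
    moreover have "finite ?T" using V by simp
    ultimately have "g m - g' m = 0"
      using independentD[OF ind _ subset_refl _ True, where u = "\<lambda>m. g m - g' m"] by blast
    then show ?thesis by simp
  qed (use supp supp' m in auto)
qed

text \<open>This is what is kept of a central coherent triangulation. \<open>K\<close> holds the
  vertex sets of the nonempty boundary simplices; the \<open>\<phi> t\<close> are the linear pieces
  of a strictly convex function on the fan with value \<open>\<kappa>\<close> at the vertices;
  \<open>\<psi> t\<close> cuts out a face of \<open>P\<close> containing \<open>t\<close>.\<close>

locale central_fan =
  fixes P :: "(real ^ 'n) set" and K :: "(real ^ 'n) set set"
    and \<kappa> :: "real ^ 'n \<Rightarrow> real" and \<phi> \<psi> :: "(real ^ 'n) set \<Rightarrow> real ^ 'n"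
  assumes finite_K: "finite K" and K_nonempty: "K \<noteq> {}" and empty_notin_K: "{} \<notin> K"
    and K_subset: "\<lbrakk>t \<in> K; r \<subseteq> t; r \<noteq> {}\<rbrakk> \<Longrightarrow> r \<in> K"
    and K_independent: "t \<in> K \<Longrightarrow> independent t"
    and K_in_P: "\<Union>K \<subseteq> P"
    and cones_cover: "\<exists>t\<in>K. \<exists>c. (\<forall>w\<in>t. 0 \<le> c w) \<and> y = (\<Sum>w\<in>t. c w *\<^sub>R w)"
    and \<phi>_in: "\<lbrakk>t \<in> K; w \<in> t\<rbrakk> \<Longrightarrow> \<phi> t \<bullet> w = \<kappa> w"
    and \<phi>_out: "\<lbrakk>t \<in> K; w \<in> \<Union>K; w \<notin> t\<rbrakk> \<Longrightarrow> \<phi> t \<bullet> w < \<kappa> w"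
    and \<psi>_polar: "t \<in> K \<Longrightarrow> \<psi> t \<in> polar_dual P"
    and \<psi>_in: "\<lbrakk>t \<in> K; w \<in> t\<rbrakk> \<Longrightarrow> \<psi> t \<bullet> w = 1"
begin

lemma finite_member: "t \<in> K \<Longrightarrow> finite t"
  using K_independent independent_bound by blast

lemma finite_vertices: "finite (\<Union>K)"
  using finite_K finite_member by blast

lemma singleton_in_K: "w \<in> \<Union>K \<Longrightarrow> {w} \<in> K"
  using K_subset by blast

lemma card_le_vertices: "t \<in> K \<Longrightarrow> card t \<le> card (\<Union>K)"
  using finite_vertices by (intro card_mono) auto

lemma \<phi>_le: "t \<in> K \<Longrightarrow> w \<in> \<Union>K \<Longrightarrow> \<phi> t \<bullet> w \<le> \<kappa> w"
  using \<phi>_in[of t w] \<phi>_out[of t w] by fastforce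

lemma \<phi>_eq_iff: "t \<in> K \<Longrightarrow> w \<in> \<Union>K \<Longrightarrow> \<phi> t \<bullet> w = \<kappa> w \<longleftrightarrow> w \<in> t"
  using \<phi>_in[of t w] \<phi>_out[of t w] by fastforce

lemma \<psi>_le: "t \<in> K \<Longrightarrow> w \<in> \<Union>K \<Longrightarrow> \<psi> t \<bullet> w \<le> 1"
  using \<psi>_polar K_in_P by (force simp: polar_dual_def)

text \<open>The points \<open>b t\<close> are the normals of the cuts and span B. For
  \<open>y\<close> in the cone over \<open>t'\<close>, the \<open>\<kappa>\<close>-part of
  \<open>b t \<bullet> y\<close> is the same for all \<open>t\<close>; the rest is, up to scale, the
  weighted mean of \<open>hierarchical_cuts\<close>. It matters that \<open>k\<close> does not
  depend on \<open>y\<close>.\<close>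

lemma perturbed_cuts:
  obtains k :: real and d :: "(real ^ 'n) set \<Rightarrow> real" and b :: "(real ^ 'n) set \<Rightarrow> real ^ 'n"
  where "0 < k" "\<And>t. t \<in> K \<Longrightarrow> 0 < d t"
    "\<And>t w. \<lbrakk>t \<in> K; w \<in> t\<rbrakk> \<Longrightarrow> b t \<bullet> w = \<kappa> w + d t"
    "\<And>t w. \<lbrakk>t \<in> K; w \<in> \<Union>K; w \<notin> t\<rbrakk> \<Longrightarrow> b t \<bullet> w < \<kappa> w"
    "\<And>t' c. \<lbrakk>t' \<in> K; \<And>w. w \<in> t' \<Longrightarrow> 0 \<le> c w; 0 < sum c t'\<rbrakk> \<Longrightarrow>
       is_chain (maximizers K (\<lambda>t. b t \<bullet> (\<Sum>w\<in>t'. c w *\<^sub>R w)))"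
    "\<And>t' c t. \<lbrakk>t' \<in> K; \<And>w. w \<in> t' \<Longrightarrow> 0 \<le> c w; 0 < sum c t';
        t \<in> maximizers K (\<lambda>t. b t \<bullet> (\<Sum>w\<in>t'. c w *\<^sub>R w))\<rbrakk> \<Longrightarrow> t \<subseteq> t'"
    "\<And>t' c t w. \<lbrakk>t' \<in> K; \<And>w. w \<in> t' \<Longrightarrow> 0 \<le> c w; 0 < sum c t';
        t \<in> maximizers K (\<lambda>t. b t \<bullet> (\<Sum>w\<in>t'. c w *\<^sub>R w)); w \<in> t\<rbrakk> \<Longrightarrow> k * sum c t' \<le> c w"
proof -
  define V where "V = \<Union>K"
  \<comment> \<open>The 1 keeps the set nonempty. Half of the minimum is reserved for the term with
    \<open>\<psi>\<close>, which is at most \<open>\<theta>\<close>, hence at most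
    \<open>a\<close>.\<close>
  define gaps where "gaps = insert 1 ((\<lambda>(t, w). \<kappa> w - \<phi> t \<bullet> w) ` {(t, w) \<in> K \<times> V. w \<notin> t})"
  define a where "a = Min gaps / 2"
  define A where "A = (\<Sum>(t, w)\<in>K \<times> V. \<bar>\<phi> t \<bullet> w - \<kappa> w\<bar> + \<bar>\<psi> t \<bullet> w\<bar>)"
  \<comment> \<open>The last two bounds contribute one eighth each to the \<open>1 / 4\<close> in
    the hypothesis of \<open>hierarchical_cuts\<close>.\<close>
  define \<theta> where "\<theta> = Min {a, 1 / 8, a / (16 * (1 + A))}"
  define b where "b t = \<phi> t + \<theta> ^ card t *\<^sub>R \<psi> t" for t
  define f where "f t w = b t \<bullet> w - \<kappa> w" for t w
  have fin: "finite V" "finite gaps"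
    using finite_vertices finite_K by (auto simp: V_def gaps_def intro: finite_subset[of _ "K \<times> \<Union>K"])
  have "0 < Min gaps"
    using fin \<phi>_out by (subst Min_gr_iff) (auto simp: gaps_def V_def)
  then have a: "0 < a" by (simp add: a_def)
  have gap: "\<phi> t \<bullet> w - \<kappa> w \<le> - 2 * a" if "t \<in> K" "w \<in> V" "w \<notin> t" for t w
  proof -
    have "\<kappa> w - \<phi> t \<bullet> w \<in> gaps" using that by (force simp: gaps_def)
    then have "Min gaps \<le> \<kappa> w - \<phi> t \<bullet> w" using fin by simp
    then show ?thesis by (simp add: a_def)
  qed
  have A0: "0 \<le> A" unfolding A_def by (intro sum_nonneg) auto
  have A: "\<bar>\<phi> t \<bullet> w - \<kappa> w\<bar> + \<bar>\<psi> t \<bullet> w\<bar> \<le> A" if "t \<in> K" "w \<in> V" for t w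
    unfolding A_def
    using member_le_sum[of "(t, w)" "K \<times> V" "\<lambda>(t, w). \<bar>\<phi> t \<bullet> w - \<kappa> w\<bar> + \<bar>\<psi> t \<bullet> w\<bar>"] that fin finite_K
    by auto
  have \<theta>: "0 < \<theta>" "\<theta> \<le> a" "\<theta> \<le> 1 / 8" "\<theta> \<le> a / (16 * (1 + A))"
  proof -
    show "0 < \<theta>" using a A0 by (simp add: \<theta>_def)
    show "\<theta> \<le> a" "\<theta> \<le> 1 / 8" "\<theta> \<le> a / (16 * (1 + A))"
      unfolding \<theta>_def by (rule Min_le; simp)+
  qed
  have \<theta>': "(1 + A) * (2 * \<theta> / a) + \<theta> \<le> 1 / 4"
  proof -
    have *: "B * (2 * (a / (16 * B)) / a) = 1 / 8" if "B \<noteq> 0" for B :: real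
      using a that by (simp add: field_simps)
    have "(1 + A) * (2 * \<theta> / a) \<le> (1 + A) * (2 * (a / (16 * (1 + A))) / a)"
      using \<theta> a A0 by (intro mult_left_mono divide_right_mono) auto
    also have "\<dots> = 1 / 8" by (rule *) (use A0 in simp)
    finally show ?thesis using \<theta>(3) by linarith
  qed
  have pow: "0 < \<theta> ^ card t" "\<theta> ^ card t \<le> \<theta>" if "t \<in> K" for t
  proof -
    have "1 \<le> card t" using that finite_member[OF that] empty_notin_K by (metis One_nat_def Suc_leI card_gt_0_iff)
    then have "\<theta> ^ card t \<le> \<theta> ^ 1" using \<theta> by (intro power_decreasing) auto
    then show "\<theta> ^ card t \<le> \<theta>" by simp
  qed (use \<theta> in simp)
  have f_in: "f t w = \<theta> ^ card t" if "t \<in> K" "w \<in> t" for t w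
    using \<phi>_in[OF that] \<psi>_in[OF that] by (simp add: f_def b_def inner_add_left)
  have f_out: "- A \<le> f t w \<and> f t w \<le> - a" if "t \<in> K" "w \<in> \<Union>K" "w \<notin> t" for t w
  proof -
    have f: "f t w = (\<phi> t \<bullet> w - \<kappa> w) + \<theta> ^ card t * (\<psi> t \<bullet> w)"
      by (simp add: f_def b_def inner_add_left)
    have "\<theta> ^ card t * (\<psi> t \<bullet> w) \<le> \<theta> ^ card t * 1"
      using pow[OF that(1)] \<psi>_le that by (intro mult_left_mono) auto
    moreover have "w \<in> V" using that by (simp add: V_def)
    ultimately have "f t w \<le> - a"
      using f gap[OF that(1) \<open>w \<in> V\<close> that(3)] pow(2)[OF that(1)] \<theta>(2) by linarith
    moreover have "\<bar>\<theta> ^ card t * (\<psi> t \<bullet> w)\<bar> \<le> \<bar>\<psi> t \<bullet> w\<bar>"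
    proof -
      have "\<theta> ^ card t * \<bar>\<psi> t \<bullet> w\<bar> \<le> 1 * \<bar>\<psi> t \<bullet> w\<bar>"
        using pow[OF that(1)] \<theta> by (intro mult_right_mono) auto
      then show ?thesis using pow[OF that(1)] by (simp add: abs_mult)
    qed
    then have "- A \<le> f t w" using f A[OF that(1) \<open>w \<in> V\<close>] by linarith
    ultimately show ?thesis by blast
  qed
  define k where "k = \<theta> ^ card V / (2 * (1 + A))"
  have K: "finite t \<and> t \<noteq> {} \<and> card t \<le> card V" if "t \<in> K" for t
    using that finite_member[OF that] empty_notin_K card_le_vertices[OF that] unfolding V_def by blast
  have max_eq: "maximizers K (\<lambda>t. b t \<bullet> (\<Sum>w\<in>t'. c w *\<^sub>R w))
      = maximizers K (\<lambda>t. \<Sum>w\<in>t'. (c w / sum c t') * f t w)" if "0 < sum c t'" for c t'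
  proof -
    have "b t \<bullet> (\<Sum>w\<in>t'. c w *\<^sub>R w) = (\<Sum>w\<in>t'. c w * \<kappa> w) + sum c t' * (\<Sum>w\<in>t'. (c w / sum c t') * f t w)" for t
    proof -
      have "b t \<bullet> (\<Sum>w\<in>t'. c w *\<^sub>R w) = (\<Sum>w\<in>t'. c w * \<kappa> w + c w * f t w)"
        by (simp add: inner_sum_right f_def right_diff_distrib)
      also have "\<dots> = (\<Sum>w\<in>t'. c w * \<kappa> w) + (\<Sum>w\<in>t'. sum c t' * ((c w / sum c t') * f t w))"
        using that by (simp add: sum.distrib)
      finally show ?thesis by (simp add: sum_distrib_left)
    qed
    then show ?thesis using that by (simp add: maximizers_def)
  qed
  note cuts = hierarchical_cuts[where K = K and f = f and N = "card V" and a = a and A = A and \<theta> = \<theta>,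
      OF finite_K _ _ _ _ a \<theta>(1) A0 \<theta>']
  show ?thesis
  proof (rule that[of k "\<lambda>t. \<theta> ^ card t" b])
    show "0 < k" using \<theta> A0 by (simp add: k_def)
    show "0 < \<theta> ^ card t" if "t \<in> K" for t using pow[OF that] by simp
    show "b t \<bullet> w = \<kappa> w + \<theta> ^ card t" if "t \<in> K" "w \<in> t" for t w
      using f_in[OF that] by (simp add: f_def)
    show "b t \<bullet> w < \<kappa> w" if "t \<in> K" "w \<in> \<Union>K" "w \<notin> t" for t w
      using f_out[OF that] a by (simp add: f_def)
  next
    fix t' and c :: "real ^ 'n \<Rightarrow> real"
    assume *: "t' \<in> K" "\<And>w. w \<in> t' \<Longrightarrow> 0 \<le> c w" "0 < sum c t'"
    have c: "\<And>w. w \<in> t' \<Longrightarrow> 0 \<le> c w / sum c t'" "(\<Sum>w\<in>t'. c w / sum c t') = 1"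
      using * by (auto simp flip: sum_divide_distrib)
    show "is_chain (maximizers K (\<lambda>t. b t \<bullet> (\<Sum>w\<in>t'. c w *\<^sub>R w)))"
      unfolding max_eq[OF *(3)] by (rule cuts(1)) (fact K K_subset f_in f_out * c)+
    show "t \<subseteq> t'" if "t \<in> maximizers K (\<lambda>t. b t \<bullet> (\<Sum>w\<in>t'. c w *\<^sub>R w))" for t
      by (rule cuts(2)[OF _ _ _ _ _ _ _ that[unfolded max_eq[OF *(3)]]]) (fact K K_subset f_in f_out * c)+
    show "k * sum c t' \<le> c w" if "t \<in> maximizers K (\<lambda>t. b t \<bullet> (\<Sum>w\<in>t'. c w *\<^sub>R w))" "w \<in> t" for t w
    proof -
      have "k \<le> c w / sum c t'"
        unfolding k_def
        by (rule cuts(3)[OF _ _ _ _ _ _ _ that[unfolded max_eq[OF *(3)]]]) (fact K K_subset f_in f_out * c)+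
      then show ?thesis using *(3) by (simp add: pos_le_divide_eq)
    qed
  qed
qed

end

definition combination :: "('a::real_vector \<Rightarrow> real) \<Rightarrow> 'a set \<Rightarrow> 'a" where
  "combination c s = (\<Sum>m\<in>s. c m *\<^sub>R m)"

lemma inner_combination: "y \<bullet> combination c s = (\<Sum>m\<in>s. c m * (y \<bullet> m))"
  by (simp add: combination_def inner_sum_right)

definition centroid :: "'a::real_vector set \<Rightarrow> 'a" where
  "centroid s = combination (\<lambda>_. 1 / real (card s)) s"

context central_fan
begin

text \<open>Two scalings are superposed. Dividing each vertex \<open>m\<close> by
  \<open>1 + e * \<kappa> m\<close> makes the triangulated boundary strictly convex:
  \<open>\<psi> t + e *\<^sub>R \<phi> t\<close> is 1 on the scaled vertices of \<open>t\<close> and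
  less on the others. The hierarchical raising then subdivides it barycentrically. Both are so small
  that a selected simplex nearly maximizes \<open>y\<close> at each of its original
  vertices.\<close>

lemma perturbed_barycenters:
  assumes "0 < \<epsilon>" "\<epsilon> \<le> 1"
  obtains \<alpha> :: "(real ^ 'n) set \<Rightarrow> real ^ 'n \<Rightarrow> real"
  where "\<And>s m. \<lbrakk>s \<in> K; m \<in> s\<rbrakk> \<Longrightarrow> 0 < \<alpha> s m"
    "\<And>y. y \<noteq> 0 \<Longrightarrow> is_chain (maximizers K (\<lambda>s. y \<bullet> combination (\<alpha> s) s))"
    "\<And>y s m m'. \<lbrakk>y \<noteq> 0; s \<in> maximizers K (\<lambda>s. y \<bullet> combination (\<alpha> s) s); m \<in> s; m' \<in> \<Union>K\<rbrakk>
       \<Longrightarrow> (1 - \<epsilon>) * (y \<bullet> m') \<le> y \<bullet> m"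
proof -
  define V where "V = \<Union>K"
  define N where "N = card V"
  \<comment> \<open>Three relative errors of size \<open>\<delta>\<close> occur, two in scaling
    \<open>m\<close> and \<open>m'\<close> and one in the raising, and \<open>(1 - 3 * \<delta>) *
    (1 + \<delta>) \<le> (1 - \<delta>) * (1 - \<delta>)\<close>.\<close>
  define \<delta> where "\<delta> = \<epsilon> / 3"
  define B where "B = 1 + (\<Sum>m\<in>V. \<bar>\<kappa> m\<bar>)"
  define e where "e = \<delta> / B"
  define r where "r m = 1 + e * \<kappa> m" for m
  define pt where "pt m = (1 / r m) *\<^sub>R m" for m
  have finV: "finite V" using finite_vertices by (simp add: V_def)
  have \<delta>: "0 < \<delta>" "\<delta> < 1" using assms by (auto simp: \<delta>_def)
  have "0 \<le> (\<Sum>m\<in>V. \<bar>\<kappa> m\<bar>)" by (intro sum_nonneg) auto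
  then have B: "1 \<le> B" by (simp add: B_def)
  then have e: "0 < e" using \<delta> by (simp add: e_def)
  have r: "1 - \<delta> \<le> r m" "r m \<le> 1 + \<delta>" "0 < r m" if "m \<in> V" for m
  proof -
    have "\<bar>\<kappa> m\<bar> \<le> B"
      unfolding B_def using member_le_sum[of m V "\<lambda>m. \<bar>\<kappa> m\<bar>"] that finV by auto
    then have "e * \<bar>\<kappa> m\<bar> \<le> e * B" using e by simp
    also have "e * B = \<delta>" using B by (simp add: e_def)
    finally have "\<bar>e * \<kappa> m\<bar> \<le> \<delta>" using e by (simp add: abs_mult)
    then show "1 - \<delta> \<le> r m" "r m \<le> 1 + \<delta>" "0 < r m" using \<delta> by (auto simp: r_def)
  qed
  define \<Phi> where "\<Phi> t = \<psi> t + e *\<^sub>R \<phi> t" for t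
  have \<Phi>_in: "\<Phi> t \<bullet> pt m = 1" if "t \<in> K" "m \<in> t" for t m
  proof -
    have "m \<in> V" using that by (auto simp: V_def)
    then show ?thesis
      using \<phi>_in[OF that] \<psi>_in[OF that] r(3)[of m] by (simp add: \<Phi>_def pt_def inner_add_left r_def)
  qed
  have \<Phi>_out: "\<Phi> t \<bullet> pt m < 1" if "t \<in> K" "m \<in> V" "m \<notin> t" for t m
  proof -
    have "e * (\<phi> t \<bullet> m) < e * \<kappa> m" using \<phi>_out[of t m] that e by (simp add: V_def)
    moreover have "\<psi> t \<bullet> m \<le> 1" using \<psi>_le that by (simp add: V_def)
    ultimately have "\<Phi> t \<bullet> m < r m" by (simp add: \<Phi>_def r_def inner_add_left)
    then show ?thesis using r(3)[OF that(2)] by (simp add: pt_def)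
  qed
  have \<Phi>_le: "\<Phi> t \<bullet> pt m \<le> 1" if "t \<in> K" "m \<in> V" for t m
    using \<Phi>_in[of t m] \<Phi>_out[of t m] that by fastforce
  define top where "top y = Max ((\<lambda>m. y \<bullet> pt m) ` V)" for y
  have "V \<noteq> {}" using K_nonempty empty_notin_K by (auto simp: V_def)
  then have top: "y \<bullet> pt m \<le> top y" "\<exists>m\<in>V. y \<bullet> pt m = top y" if "m \<in> V" for y m
  proof -
    show "y \<bullet> pt m \<le> top y" using finV that by (simp add: top_def)
    have "top y \<in> (\<lambda>m. y \<bullet> pt m) ` V"
      unfolding top_def using finV that by (intro Max_in) auto
    then show "\<exists>m\<in>V. y \<bullet> pt m = top y" by force
  qed
  have cover: "\<exists>t\<in>K. \<exists>c. (\<forall>w\<in>t. 0 \<le> c w) \<and> x = (\<Sum>w\<in>t. c w *\<^sub>R pt w)" for x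
  proof -
    obtain t c where t: "t \<in> K" "\<forall>w\<in>t. 0 \<le> c w" "x = (\<Sum>w\<in>t. c w *\<^sub>R w)"
      using cones_cover[of x] by blast
    have rt: "0 < r w" if "w \<in> t" for w using r(3)[of w] that t(1) by (auto simp: V_def)
    have "x = (\<Sum>w\<in>t. (c w * r w) *\<^sub>R pt w)"
      unfolding t(3) by (intro sum.cong) (use rt in \<open>force simp: pt_def\<close>)+
    moreover have "\<forall>w\<in>t. 0 \<le> c w * r w" using t(2) rt by (simp add: less_imp_le)
    ultimately show ?thesis using t(1) by (intro bexI[of _ t] exI[of _ "\<lambda>w. c w * r w"]) auto
  qed
  \<comment> \<open>The direction \<open>y\<close> itself lies in a cone of the fan, so
    \<open>y \<bullet> y\<close> would be a sum of nonpositive terms if no vertex had a positive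
    value.\<close>
  have top_pos: "0 < top y" if "y \<noteq> 0" for y
  proof -
    obtain t c where t: "t \<in> K" "\<forall>w\<in>t. 0 \<le> c w" "y = (\<Sum>w\<in>t. c w *\<^sub>R pt w)"
      using cover[of y] by blast
    have "y \<bullet> y = (\<Sum>w\<in>t. c w * (y \<bullet> pt w))"
      by (subst (2) t(3)) (simp add: inner_sum_right)
    moreover have "0 < y \<bullet> y" using that by simp
    ultimately have "\<not> (\<Sum>w\<in>t. c w * (y \<bullet> pt w)) \<le> 0" by linarith
    then obtain w where w: "w \<in> t" "0 < c w * (y \<bullet> pt w)"
      using sum_nonpos[of t "\<lambda>w. c w * (y \<bullet> pt w)"] by (meson not_less)
    then have "0 < y \<bullet> pt w" using t(2) by (force simp: zero_less_mult_iff)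
    then show ?thesis using top(1)[of w y] w(1) t(1) by (force simp: V_def)
  qed
  text \<open>The midpoint of a nonface lies strictly inside the polytope spanned by the points \<open>pt m\<close>.\<close>
  have nonface: "\<exists>g>0. \<forall>y. 0 < top y \<longrightarrow> (\<exists>w\<in>u. y \<bullet> pt w \<le> (1 - g) * top y)"
    if u: "u \<subseteq> V" "u \<noteq> {}" "u \<notin> K" for u
  proof -
    have finu: "finite u" using u finV finite_subset by blast
    define x where "x = (\<Sum>w\<in>u. (1 / real (card u)) *\<^sub>R pt w)"
    obtain t c where t: "t \<in> K" "\<forall>w\<in>t. 0 \<le> c w" "x = (\<Sum>w\<in>t. c w *\<^sub>R pt w)"
      using cover[of x] by blast
    have cu: "0 < real (card u)" using u finu by (simp add: card_gt_0_iff)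
    have "\<Phi> t \<bullet> x = sum c t"
      unfolding t(3) using \<Phi>_in[OF t(1)] by (simp add: inner_sum_right)
    moreover have "\<Phi> t \<bullet> x < 1"
    proof -
      obtain w where w: "w \<in> u" "w \<notin> t" using u K_subset[OF t(1)] by blast
      have "\<Phi> t \<bullet> x = (\<Sum>w\<in>u. \<Phi> t \<bullet> pt w) / real (card u)"
        by (simp add: x_def inner_sum_right sum_divide_distrib)
      moreover have "(\<Sum>w\<in>u. \<Phi> t \<bullet> pt w) < (\<Sum>w\<in>u. 1)"
        by (rule sum_strict_mono_ex1[OF finu]) (use \<Phi>_le[OF t(1)] \<Phi>_out[OF t(1)] w u in auto)
      ultimately show ?thesis using cu by simp
    qed
    ultimately have c1: "sum c t < 1" by simp
    have "\<exists>w\<in>u. y \<bullet> pt w \<le> (1 - (1 - sum c t)) * top y" if "0 < top y" for y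
    proof (rule ccontr)
      assume "\<not> ?thesis"
      then have "(\<Sum>w\<in>u. sum c t * top y) < (\<Sum>w\<in>u. y \<bullet> pt w)"
        by (intro sum_strict_mono finu u) auto
      moreover have "(\<Sum>w\<in>u. y \<bullet> pt w) = real (card u) * (y \<bullet> x)"
        using cu by (simp add: x_def inner_sum_right flip: sum_divide_distrib)
      moreover have "y \<bullet> x \<le> sum c t * top y"
      proof -
        have "y \<bullet> x = (\<Sum>w\<in>t. c w * (y \<bullet> pt w))"
          unfolding t(3) by (simp add: inner_sum_right)
        also have "\<dots> \<le> (\<Sum>w\<in>t. c w * top y)"
          by (intro sum_mono mult_left_mono top) (use t in \<open>auto simp: V_def\<close>)
        finally show ?thesis by (simp add: sum_distrib_right)
      qed
      ultimately show False using cu by (simp add: mult_left_le)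
    qed
    then show ?thesis using c1 by (intro exI[of _ "1 - sum c t"]) auto
  qed
  define nf where "nf = {u. u \<subseteq> V \<and> u \<noteq> {} \<and> u \<notin> K}"
  have "\<exists>g. \<forall>u\<in>nf. 0 < g u \<and> (\<forall>y. 0 < top y \<longrightarrow> (\<exists>w\<in>u. y \<bullet> pt w \<le> (1 - g u) * top y))"
    by (rule bchoice) (use nonface in \<open>auto simp: nf_def\<close>)
  then obtain g where g: "\<And>u. u \<in> nf \<Longrightarrow> 0 < g u"
      "\<And>u y. \<lbrakk>u \<in> nf; 0 < top y\<rbrakk> \<Longrightarrow> \<exists>w\<in>u. y \<bullet> pt w \<le> (1 - g u) * top y" by blast
  define \<gamma> where "\<gamma> = Min (insert 1 (g ` nf))"
  have finnf: "finite nf" using finV by (auto simp: nf_def intro: finite_subset[of _ "Pow V"])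
  have \<gamma>: "0 < \<gamma>" "\<And>u. u \<in> nf \<Longrightarrow> \<gamma> \<le> g u"
    using finnf g(1) by (auto simp: \<gamma>_def)
  \<comment> \<open>This meets the conditions of the raising and also keeps its error
    \<open>N * \<theta>\<close> within \<open>\<delta>\<close>.\<close>
  define \<theta> where "\<theta> = min \<gamma> (min \<delta> 1) / (2 * (2 * real N + 1))"
  have \<theta>: "0 < \<theta>" "\<theta> * (2 * real N + 1) < 1" "real N * \<theta> < \<gamma>" "real N * \<theta> \<le> \<delta>"
  proof -
    define \<mu> where "\<mu> = min \<gamma> (min \<delta> 1)"
    have \<mu>: "0 < \<mu>" "\<mu> \<le> \<gamma>" "\<mu> \<le> \<delta>" "\<mu> \<le> 1" using \<gamma>(1) \<delta> by (auto simp: \<mu>_def)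
    have eq: "\<theta> * (2 * real N + 1) = \<mu> / 2" by (simp add: \<theta>_def \<mu>_def field_simps)
    show "0 < \<theta>" using \<mu> by (simp add: \<theta>_def \<mu>_def[symmetric])
    then have "real N * \<theta> \<le> \<theta> * (2 * real N + 1)" by (simp add: algebra_simps)
    then show "\<theta> * (2 * real N + 1) < 1" "real N * \<theta> < \<gamma>" "real N * \<theta> \<le> \<delta>" using eq \<mu> by linarith+
  qed
  define \<alpha> where "\<alpha> s m = (1 + \<theta> ^ (Suc N - card s)) / real (card s) * (1 / r m)"
    for s :: "(real ^ 'n) set" and m
  have val: "y \<bullet> combination (\<alpha> s) s = (1 + \<theta> ^ (Suc N - card s)) * ((\<Sum>m\<in>s. y \<bullet> pt m) / real (card s))" for y s
  proof -
    have "y \<bullet> combination (\<alpha> s) s = (\<Sum>m\<in>s. (1 + \<theta> ^ (Suc N - card s)) / real (card s) * (y \<bullet> pt m))"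
      unfolding inner_combination by (intro sum.cong) (auto simp: \<alpha>_def pt_def)
    also have "\<dots> = (1 + \<theta> ^ (Suc N - card s)) / real (card s) * (\<Sum>m\<in>s. y \<bullet> pt m)"
      by (rule sum_distrib_left[symmetric])
    finally show ?thesis by simp
  qed
  have KN: "finite t \<and> t \<noteq> {} \<and> card t \<le> N" if "t \<in> K" for t
    using that finite_member[OF that] empty_notin_K card_le_vertices[OF that] unfolding N_def V_def by blast
  have nonface_max: "\<exists>w\<in>u. y \<bullet> pt w \<le> (1 - \<gamma>) * top y"
    if "y \<noteq> 0" "u \<subseteq> \<Union>K" "finite u" "u \<noteq> {}" "u \<notin> K" for y u
  proof -
    have u: "u \<in> nf" using that by (simp add: nf_def V_def)
    obtain w where "w \<in> u" "y \<bullet> pt w \<le> (1 - g u) * top y" using g(2)[OF u top_pos[OF \<open>y \<noteq> 0\<close>]] by blast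
    moreover have "(1 - g u) * top y \<le> (1 - \<gamma>) * top y"
      using \<gamma>(2)[OF u] top_pos[OF that(1)] by (intro mult_right_mono) auto
    ultimately show ?thesis by force
  qed
  obtain w0 where w0: "w0 \<in> V" using \<open>V \<noteq> {}\<close> by blast
  show ?thesis
  proof (rule that[of \<alpha>])
    show "0 < \<alpha> s m" if "s \<in> K" "m \<in> s" for s m
    proof -
      have "0 < card s" using KN[OF that(1)] by (simp add: card_gt_0_iff)
      moreover have "0 < r m" using r(3)[of m] that by (auto simp: V_def)
      moreover have "0 < \<theta> ^ (Suc N - card s)" using \<theta>(1) by simp
      ultimately show ?thesis by (simp add: \<alpha>_def)
    qed
  next
    fix y :: "real ^ 'n" assume y: "y \<noteq> 0"
    obtain wm where wm: "wm \<in> V" "y \<bullet> pt wm = top y" using top(2)[OF w0] by blast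
    have le_top: "\<And>w. w \<in> \<Union>K \<Longrightarrow> y \<bullet> pt w \<le> top y" using top(1) by (simp add: V_def)
    note nf = nonface_max[OF y] and w = wm(1)[unfolded V_def] wm(2) top_pos[OF y]
    note raising = hierarchical_stellar_raising[where K = K and N = N and v = "\<lambda>m. y \<bullet> pt m"
        and M = "top y" and \<gamma> = \<gamma> and \<theta> = \<theta>, OF _ _ _ _ w \<theta>(1,2,3), folded val]
    show "is_chain (maximizers K (\<lambda>s. y \<bullet> combination (\<alpha> s) s))"
      by (rule raising(1)) (fact KN singleton_in_K nf le_top)+
    fix s m m' assume s: "s \<in> maximizers K (\<lambda>s. y \<bullet> combination (\<alpha> s) s)" and m: "m \<in> s" "m' \<in> \<Union>K"
    have V: "m \<in> V" "m' \<in> V" using s m by (auto simp: maximizers_def V_def)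
    note tp = top_pos[OF y]
    have "(1 - \<delta>) * top y \<le> (1 - real N * \<theta>) * top y" using \<theta>(4) tp by (intro mult_right_mono) auto
    also have "\<dots> \<le> y \<bullet> pt m" by (rule raising(2)[OF _ _ _ _ s m(1)]) (fact KN singleton_in_K nf le_top)+
    finally have 1: "(1 - \<delta>) * top y \<le> y \<bullet> pt m" .
    have "(1 - \<delta>) * ((1 - \<delta>) * top y) \<le> r m * ((1 - \<delta>) * top y)"
      using r(1)[OF V(1)] \<delta> tp by (intro mult_right_mono) auto
    also have "\<dots> \<le> r m * (y \<bullet> pt m)" using 1 r(3)[OF V(1)] by (intro mult_left_mono) auto
    also have "\<dots> = y \<bullet> m" using r(3)[OF V(1)] by (simp add: pt_def)
    finally have 2: "(1 - \<delta>) * ((1 - \<delta>) * top y) \<le> y \<bullet> m" .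
    have "y \<bullet> m' = r m' * (y \<bullet> pt m')" using r(3)[OF V(2)] by (simp add: pt_def)
    also have "\<dots> \<le> r m' * top y" using r(3)[OF V(2)] top(1)[OF V(2)] by (intro mult_left_mono) auto
    also have "\<dots> \<le> (1 + \<delta>) * top y" using r(2)[OF V(2)] tp by (intro mult_right_mono) auto
    finally have "(1 - \<epsilon>) * (y \<bullet> m') \<le> (1 - \<epsilon>) * ((1 + \<delta>) * top y)"
      using assms by (intro mult_left_mono) auto
    also have "\<dots> \<le> (1 - \<delta>) * ((1 - \<delta>) * top y)"
    proof -
      have "(1 - \<epsilon>) * (1 + \<delta>) \<le> (1 - \<delta>) * (1 - \<delta>)"
        by (simp add: \<delta>_def field_simps)
      then have "((1 - \<epsilon>) * (1 + \<delta>)) * top y \<le> ((1 - \<delta>) * (1 - \<delta>)) * top y"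
        using tp by (intro mult_right_mono) auto
      then show ?thesis by (simp only: mult.assoc)
    qed
    finally show "(1 - \<epsilon>) * (y \<bullet> m') \<le> y \<bullet> m" using 2 by linarith
  qed
qed

lemma chain_union_in_K:
  assumes "C \<subseteq> K" "is_chain C" "C \<noteq> {}"
  shows "\<Union>C \<in> K"
proof -
  obtain t where "t \<in> C" "\<And>s. s \<in> C \<Longrightarrow> s \<subseteq> t"
    by (rule chain_top[of C]) (use assms finite_K finite_member finite_subset in blast)+
  then have "\<Union>C = t" by blast
  then show ?thesis using \<open>t \<in> C\<close> assms by blast
qed

lemma chain_combination_K:
  assumes "C \<subseteq> K" "is_chain C" "\<And>s m. \<lbrakk>s \<in> C; m \<in> s\<rbrakk> \<Longrightarrow> 0 < \<alpha> s m"
    and zero: "(\<Sum>s\<in>C. x s *\<^sub>R combination (\<alpha> s) s) = 0" and "s \<in> C"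
  shows "x s = 0"
proof -
  have U: "\<Union>C \<in> K" using assms by (intro chain_union_in_K) auto
  show ?thesis
  proof (rule chain_combination_eq_0[where C = C and \<alpha> = \<alpha>])
    show "finite C" using assms(1) finite_K finite_subset by blast
    show "{} \<notin> C" using assms(1) empty_notin_K by blast
    show "independent (\<Union>C)" "finite (\<Union>C)" using K_independent[OF U] finite_member[OF U] by auto
  qed (use assms in \<open>auto simp: combination_def\<close>)
qed

text \<open>The coordinates \<open>co l m\<close> at the vertices are unique because the fan is
  regular, and they recover the chain: sets carrying weight are superlevel sets of
  \<open>co\<close>. Hence the sets used by \<open>l\<close> and \<open>l'\<close> together form one
  chain, along which the centroids are linearly independent.\<close>

lemma barycentric_unique:
  assumes C: "C \<subseteq> K" "is_chain C" "weights_on C l"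
    and C': "C' \<subseteq> K" "is_chain C'" "weights_on C' l'"
    and eq: "(\<Sum>s\<in>K. l s *\<^sub>R centroid s) = (\<Sum>s\<in>K. l' s *\<^sub>R centroid s)"
  shows "l s = l' s"
proof -
  define V where "V = \<Union>K"
  have finV: "finite V" using finite_vertices by (simp add: V_def)
  define co where "co l m = (\<Sum>s\<in>K. if m \<in> s then l s / real (card s) else 0)"
    for l :: "(real ^ 'n) set \<Rightarrow> real" and m
  have card_pos: "0 < real (card s)" if "s \<in> K" for s
    using that finite_member empty_notin_K by (metis card_gt_0_iff of_nat_0_less_iff)
  have pt: "(\<Sum>s\<in>K. l s *\<^sub>R centroid s) = (\<Sum>m\<in>V. co l m *\<^sub>R m)" for l
  proof -
    have "l s *\<^sub>R centroid s = (\<Sum>m\<in>V. (if m \<in> s then l s / real (card s) else 0) *\<^sub>R m)" if "s \<in> K" for s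
    proof -
      have "(\<Sum>m\<in>V. (if m \<in> s then l s / real (card s) else 0) *\<^sub>R m)
          = (\<Sum>m\<in>s. (if m \<in> s then l s / real (card s) else 0) *\<^sub>R m)"
        by (rule sum.mono_neutral_right) (use finV that in \<open>auto simp: V_def\<close>)
      then show ?thesis by (simp add: centroid_def combination_def scaleR_sum_right)
    qed
    then have "(\<Sum>s\<in>K. l s *\<^sub>R centroid s)
        = (\<Sum>s\<in>K. \<Sum>m\<in>V. (if m \<in> s then l s / real (card s) else 0) *\<^sub>R m)"
      by (intro sum.cong) auto
    also have "\<dots> = (\<Sum>m\<in>V. co l m *\<^sub>R m)"
      by (subst sum.swap) (simp add: co_def scaleR_sum_left)
    finally show ?thesis .
  qed
  have co_nn: "0 \<le> co l m" if "weights_on C l" for l C m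
    unfolding co_def by (intro sum_nonneg) (use weights_on_nonneg[OF that] in auto)
  have ne: "C \<noteq> {}" if "weights_on C l" for C :: "(real ^ 'n) set set" and l
    using that by (auto simp: weights_on_def)
  have co_out: "co l m = 0" if "weights_on C l" "m \<notin> \<Union>C" for l C m
    unfolding co_def using that weights_on_outside[OF that(1)] by (intro sum.neutral) auto
  have U: "\<Union>C \<in> K" "\<Union>C' \<in> K"
    using chain_union_in_K[OF C(1,2) ne[OF C(3)]] chain_union_in_K[OF C'(1,2) ne[OF C'(3)]] by auto
  have co_eq: "co l m = co l' m" if "m \<in> V" for m
  proof (rule cone_representation_unique[where V = V and \<phi> = "\<phi> (\<Union>C)" and \<phi>' = "\<phi> (\<Union>C')" and \<kappa> = \<kappa>])
    show "(\<Sum>m\<in>V. co l m *\<^sub>R m) = (\<Sum>m\<in>V. co l' m *\<^sub>R m)" using eq pt by simp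
    have "{m\<in>V. \<phi> (\<Union>C) \<bullet> m = \<kappa> m} = \<Union>C" using \<phi>_eq_iff[OF U(1)] C(1) unfolding V_def by blast
    then show "independent {m\<in>V. \<phi> (\<Union>C) \<bullet> m = \<kappa> m}" using K_independent[OF U(1)] by simp
    show "co l m = 0" if "m \<in> V" "\<phi> (\<Union>C) \<bullet> m \<noteq> \<kappa> m" for m
      by (rule co_out[OF C(3)]) (use that \<phi>_in[OF U(1)] in blast)
    show "co l' m = 0" if "m \<in> V" "\<phi> (\<Union>C') \<bullet> m \<noteq> \<kappa> m" for m
      by (rule co_out[OF C'(3)]) (use that \<phi>_in[OF U(2)] in blast)
  qed (use that finV \<phi>_le[OF U(1)] \<phi>_le[OF U(2)] co_nn[OF C(3)] co_nn[OF C'(3)] in \<open>simp_all add: V_def\<close>)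
  \<comment> \<open>A set of the chain containing \<open>m'\<close> is not inside \<open>s\<close>,
    hence contains \<open>s\<close> and with it \<open>m\<close>; the set \<open>s\<close> itself
    adds the strict excess.\<close>
  have co_less: "co l m' < co l m"
    if "C \<subseteq> K" "is_chain C" "weights_on C l" "l s \<noteq> 0" "m \<in> s" "m' \<notin> s" for C l s m m'
  proof -
    have s: "s \<in> C" using that(4) weights_on_outside[OF that(3)] by blast
    have "co l m' + (\<Sum>u\<in>K. if u = s then l s / real (card s) else 0)
        = (\<Sum>u\<in>K. (if m' \<in> u then l u / real (card u) else 0) + (if u = s then l s / real (card s) else 0))"
      by (simp add: co_def sum.distrib)
    also have "\<dots> \<le> co l m"
      unfolding co_def
    proof (rule sum_mono)
      fix u assume "u \<in> K"
      have "m \<in> u" if "m' \<in> u" "u \<in> C"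
        using \<open>is_chain C\<close> s that \<open>m \<in> s\<close> \<open>m' \<notin> s\<close> unfolding is_chain_def by blast
      moreover have "l u = 0" if "u \<notin> C" using weights_on_outside[OF \<open>weights_on C l\<close> that] .
      moreover have "0 \<le> l u" using weights_on_nonneg[OF \<open>weights_on C l\<close>] .
      ultimately show "(if m' \<in> u then l u / real (card u) else 0) + (if u = s then l s / real (card s) else 0)
          \<le> (if m \<in> u then l u / real (card u) else 0)"
        using that(5,6) by (cases "u \<in> C") auto
    qed
    finally have "co l m' + l s / real (card s) \<le> co l m" using s that(1) finite_K by auto
    moreover have "0 < l s" using weights_on_nonneg[OF that(3), of s] that(4) by simp
    moreover have "0 < real (card s)" using card_pos s that(1) by blast
    ultimately show ?thesis using divide_pos_pos[of "l s" "real (card s)"] by linarith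
  qed
  define E where "E = {s. l s \<noteq> 0 \<or> l' s \<noteq> 0}"
  have EK: "E \<subseteq> C \<union> C'"
    using weights_on_outside[OF C(3)] weights_on_outside[OF C'(3)] by (auto simp: E_def)
  have cross: "s \<subseteq> u \<or> u \<subseteq> s" if "l s \<noteq> 0" "l' u \<noteq> 0" for s u
  proof (rule ccontr)
    assume "\<not> ?thesis"
    then obtain m m' where m: "m \<in> s" "m \<notin> u" "m' \<in> u" "m' \<notin> s" by blast
    have "s \<in> K" "u \<in> K"
      using that weights_on_outside[OF C(3)] weights_on_outside[OF C'(3)] C(1) C'(1) by blast+
    then have "m \<in> V" "m' \<in> V" using m by (auto simp: V_def)
    then show False
      using co_less[OF C that(1) m(1,4)] co_less[OF C' that(2) m(3,2)] co_eq by force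
  qed
  have "is_chain E"
  proof -
    have same: "s \<subseteq> u \<or> u \<subseteq> s" if "is_chain C" "weights_on C l" "l s \<noteq> 0" "l u \<noteq> 0" for C l s u
      using that(1,3,4) weights_on_outside[OF that(2), of s] weights_on_outside[OF that(2), of u]
      by (auto simp: is_chain_def)
    show ?thesis
      unfolding is_chain_def
    proof (intro ballI)
      fix s u assume "s \<in> E" "u \<in> E"
      then show "s \<subseteq> u \<or> u \<subseteq> s"
        using same[OF C(2,3), of s u] same[OF C'(2,3), of s u] cross[of s u] cross[of u s]
        by (auto simp: E_def)
    qed
  qed
  have "(\<Sum>s\<in>E. (l s - l' s) *\<^sub>R centroid s) = (\<Sum>s\<in>K. (l s - l' s) *\<^sub>R centroid s)"
    by (rule sum.mono_neutral_left) (use finite_K EK C(1) C'(1) in \<open>auto simp: E_def\<close>)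
  also have "\<dots> = 0" using eq by (simp add: scaleR_left_diff_distrib sum_subtractf)
  finally have zero: "(\<Sum>s\<in>E. (l s - l' s) *\<^sub>R centroid s) = 0" .
  show ?thesis
  proof (cases "s \<in> E")
    case True
    have "l s - l' s = 0"
    proof (rule chain_combination_K[OF _ \<open>is_chain E\<close> _ zero[unfolded centroid_def] True])
      show "E \<subseteq> K" using EK C(1) C'(1) by blast
      show "0 < 1 / real (card s)" if "s \<in> E" for s
        using card_pos[of s] that EK C(1) C'(1) by auto
    qed
    then show ?thesis by simp
  qed (simp add: E_def)
qed

end

subsection \<open>Central coherent triangulations\<close>

lemma convex_hull_supporting_hyperplane:
  fixes q :: "'i \<Rightarrow> 'a::real_inner"
  assumes I: "finite I" and le: "\<And>i. i \<in> I \<Longrightarrow> a \<bullet> q i \<le> b"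
  shows "convex hull (q ` I) \<inter> {x. a \<bullet> x = b} = convex hull (q ` {i\<in>I. a \<bullet> q i = b})"
proof
  let ?J = "{i\<in>I. a \<bullet> q i = b}"
  have "convex hull (q ` ?J) \<subseteq> {x. a \<bullet> x = b}"
    by (rule hull_minimal) (auto simp: convex_hyperplane)
  then show "convex hull (q ` ?J) \<subseteq> convex hull (q ` I) \<inter> {x. a \<bullet> x = b}"
    using hull_mono[of "q ` ?J" "q ` I"] by auto
  show "convex hull (q ` I) \<inter> {x. a \<bullet> x = b} \<subseteq> convex hull (q ` ?J)"
  proof clarify
    fix x assume "x \<in> convex hull (q ` I)" and b: "b = a \<bullet> x"
    then obtain c where c: "weights_on I c" "x = (\<Sum>i\<in>I. c i *\<^sub>R q i)"
      using convex_hull_image_weights[OF I subset_refl, of q] by auto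
    have "(\<Sum>i\<in>I. c i * (a \<bullet> q i)) = b" by (simp add: b c(2) inner_sum_right)
    then have "c i = 0" if "i \<in> I" "a \<bullet> q i \<noteq> b" for i
      using weighted_mean_eq_max[of I I c "\<lambda>i. a \<bullet> q i" b i] I c(1) le that by simp
    then have "weights_on (I \<inter> ?J) c"
      using weights_on_outside[OF c(1)] by (intro weights_on_restrict[OF c(1) I]) auto
    then have "weights_on ?J c" by (simp add: Int_absorb1)
    then show "x \<in> convex hull (q ` {i\<in>I. a \<bullet> q i = a \<bullet> x})"
      using convex_hull_image_weights[OF I, of ?J q] c(2) b by auto
  qed
qed

text \<open>Separating \<open>S\<close> from the interior of \<open>P\<close> puts all of
  \<open>S\<close> on one supporting hyperplane. It misses the interior point 0, so it can be
  normalised to level 1.\<close>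

lemma ex_supporting_functional:
  fixes P :: "'a::euclidean_space set"
  assumes P: "convex P" "0 \<in> interior P" and S: "convex S" "S \<noteq> {}" "S \<subseteq> frontier P"
  shows "\<exists>f. (\<forall>x\<in>P. f \<bullet> x \<le> 1) \<and> (\<forall>x\<in>S. f \<bullet> x = 1)"
proof -
  have "interior P \<inter> S = {}" using S(3) by (auto simp: frontier_def)
  then obtain a b where ab: "a \<noteq> 0" "\<forall>x\<in>interior P. a \<bullet> x \<le> b" "\<forall>x\<in>S. b \<le> a \<bullet> x"
    using separating_hyperplane_sets[OF convex_interior[OF P(1)] S(1)] P(2) S(2) by blast
  have "closure (interior P) \<subseteq> {x. a \<bullet> x \<le> b}"
    using ab(2) by (intro closure_minimal closed_halfspace_le) auto
  then have le: "a \<bullet> x \<le> b" if "x \<in> closure P" for x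
    using convex_closure_interior[OF P(1)] P(2) that by blast
  have "0 < b"
  proof -
    obtain e where e: "e > 0" "cball 0 e \<subseteq> P" using P(2) by (auto simp: mem_interior_cball)
    have "(e / norm a) *\<^sub>R a \<in> P" using e ab(1) by (intro subsetD[OF e(2)]) auto
    then have "a \<bullet> ((e / norm a) *\<^sub>R a) \<le> b" using le closure_subset by blast
    moreover have "0 < a \<bullet> ((e / norm a) *\<^sub>R a)" using e ab(1) by auto
    ultimately show ?thesis by linarith
  qed
  moreover have "a \<bullet> x = b" if "x \<in> S" for x
    using ab(3) le[of x] that S(3) by (force simp: frontier_def)
  ultimately show ?thesis
    using le closure_subset by (intro exI[of _ "(1 / b) *\<^sub>R a"]) (auto simp: field_simps)
qed

lemma ex_small_factor:
  fixes B gap :: "'i \<Rightarrow> real"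
  assumes "finite S" "\<And>m. m \<in> S \<Longrightarrow> 0 < gap m"
  obtains e where "0 < e" "\<And>m. m \<in> S \<Longrightarrow> e * B m < gap m"
proof -
  have "eventually (\<lambda>e. e * B m < gap m) (at_right 0)" if "m \<in> S" for m
  proof -
    have "((\<lambda>e. e * B m) \<longlongrightarrow> 0 * B m) (at_right 0)" by (intro tendsto_intros)
    then show ?thesis using assms(2)[OF that] by (intro order_tendstoD(2)) auto
  qed
  then have "eventually (\<lambda>e. 0 < e \<and> (\<forall>m\<in>S. e * B m < gap m)) (at_right 0)"
    using assms(1) by (intro eventually_conj eventually_ball_finite eventually_at_right_less) auto
  then obtain e where "0 < e" "\<forall>m\<in>S. e * B m < gap m"
    using eventually_happens[of _ "at_right (0::real)"] by auto
  then show ?thesis using that by blast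
qed

locale central_triangulation =
  fixes P :: "(real ^ 'n) set" and h :: "real ^ 'n \<Rightarrow> int"
  assumes finite_points: "finite (P \<inter> lattice_points)"
    and P_hull: "P = convex hull (P \<inter> lattice_points)"
    and interior_0: "0 \<in> interior P"
    and generic: "generic_heights P h" and central: "central_heights P h"
begin

definition L :: "(real ^ 'n) set" where
  "L = P \<inter> lattice_points"

definition H :: "real ^ 'n \<Rightarrow> real" where
  "H m = of_int (h m)"

text \<open>Such an affine function is an upper supporting hyperplane of the lifted polytope, so
  upper faces can be handled through the finite sets of lattice points at which it is
  attained.\<close>

definition dominates :: "real ^ 'n \<Rightarrow> real \<Rightarrow> bool" where
  "dominates u c \<longleftrightarrow> (\<forall>m\<in>L. H m \<le> u \<bullet> m + c)"

definition contact :: "real ^ 'n \<Rightarrow> real \<Rightarrow> (real ^ 'n) set" where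
  "contact u c = {m\<in>L. H m = u \<bullet> m + c}"

lemma finite_L: "finite L" and P_eq: "P = convex hull L"
  using finite_points P_hull by (simp_all add: L_def)

lemma convex_P: "convex P"
  by (subst P_eq) (rule convex_convex_hull)

lemma zero_in_L: "0 \<in> L"
  using interior_0 interior_subset[of P] by (auto simp: L_def lattice_points_def)

lemma finite_contact: "finite (contact u c)" and contact_subset: "contact u c \<subseteq> L"
  using finite_L by (auto simp: contact_def)

lemma lifted_polytope_face:
  assumes "dominates u c"
  shows "{(x, t)\<in>lifted_polytope P h. t = u \<bullet> x + c} = convex hull (lift_point h ` contact u c)"
    and "\<forall>(x, t)\<in>lifted_polytope P h. t \<le> u \<bullet> x + c"
proof -
  have inner: "(- u, 1) \<bullet> lift_point h m \<le> c \<longleftrightarrow> H m \<le> u \<bullet> m + c"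
      "(- u, 1) \<bullet> lift_point h m = c \<longleftrightarrow> H m = u \<bullet> m + c" for m
    by (auto simp: lift_point_def H_def inner_Pair)
  have "{(x, t)\<in>lifted_polytope P h. t = u \<bullet> x + c}
      = convex hull (lift_point h ` L) \<inter> {z. (- u, 1) \<bullet> z = c}"
    by (auto simp: lifted_polytope_def L_def inner_Pair)
  also have "\<dots> = convex hull (lift_point h ` contact u c)"
    using assms unfolding contact_def inner(2)[symmetric]
    by (intro convex_hull_supporting_hyperplane finite_L) (simp add: dominates_def inner)
  finally show "{(x, t)\<in>lifted_polytope P h. t = u \<bullet> x + c} = convex hull (lift_point h ` contact u c)" .
  have "convex hull (lift_point h ` L) \<subseteq> {z. (- u, 1) \<bullet> z \<le> c}"
    using assms inner(1) by (intro hull_minimal) (auto simp: dominates_def convex_halfspace_le)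
  then show "\<forall>(x, t)\<in>lifted_polytope P h. t \<le> u \<bullet> x + c"
    by (fastforce simp: lifted_polytope_def L_def inner_Pair)
qed

lemma upper_face_iff:
  "F upper_face_of lifted_polytope P h \<longleftrightarrow>
     (\<exists>u c. dominates u c \<and> contact u c \<noteq> {} \<and> F = convex hull (lift_point h ` contact u c))"
proof
  assume "F upper_face_of lifted_polytope P h"
  then obtain u c where F: "F \<noteq> {}" "\<forall>(x, t)\<in>lifted_polytope P h. t \<le> u \<bullet> x + c"
    "F = {(x, t)\<in>lifted_polytope P h. t = u \<bullet> x + c}"
    by (auto simp: upper_face_of_def)
  have "lift_point h m \<in> lifted_polytope P h" if "m \<in> L" for m
    using that by (auto simp: lifted_polytope_def L_def intro: hull_inc)
  then have d: "dominates u c" using F(2) by (fastforce simp: dominates_def lift_point_def H_def)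
  then show "\<exists>u c. dominates u c \<and> contact u c \<noteq> {} \<and> F = convex hull (lift_point h ` contact u c)"
    using lifted_polytope_face(1)[OF d] F(1,3) by (intro exI[of _ u] exI[of _ c]) auto
next
  assume "\<exists>u c. dominates u c \<and> contact u c \<noteq> {} \<and> F = convex hull (lift_point h ` contact u c)"
  then obtain u c where F: "dominates u c" "contact u c \<noteq> {}" "F = convex hull (lift_point h ` contact u c)"
    by blast
  then show "F upper_face_of lifted_polytope P h"
    unfolding upper_face_of_def
    using lifted_polytope_face[OF F(1)] by (intro conjI exI[of _ u] exI[of _ c]) simp_all
qed

lemma coherent_triangulation_eq:
  "coherent_triangulation P h = {convex hull (contact u c) | u c. dominates u c \<and> contact u c \<noteq> {}}"
proof -
  have "fst ` (convex hull (lift_point h ` S)) = convex hull S" for S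
    by (simp add: convex_hull_linear_image linear_fst image_image lift_point_def)
  then show ?thesis
    unfolding coherent_triangulation_def upper_face_iff by blast
qed

text \<open>Genericity makes every lifted contact point a vertex of a simplex. This descends to the
  points themselves because the height is affine on a contact set, so that an affine dependence
  would lift.\<close>

lemma contact_affine_independent:
  assumes "dominates u c"
  shows "\<not> affine_dependent (contact u c)"
proof (cases "contact u c = {}")
  case False
  define F where "F = convex hull (lift_point h ` contact u c)"
  have "F upper_face_of lifted_polytope P h"
    using assms False by (auto simp: upper_face_iff F_def)
  then obtain k where k: "k simplex F" and ext: "\<And>m. \<lbrakk>m \<in> L; lift_point h m \<in> F\<rbrakk> \<Longrightarrow> lift_point h m extreme_point_of F"
    using generic by (auto simp: generic_heights_def L_def)
  obtain C where C: "\<not> affine_dependent C" "F = convex hull C"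
    using k by (auto simp: simplex_def)
  have "lift_point h ` contact u c \<subseteq> C"
  proof (rule image_subsetI)
    fix m assume m: "m \<in> contact u c"
    then have "lift_point h m \<in> F" by (auto simp: F_def hull_inc)
    then have "lift_point h m extreme_point_of F" using ext m by (auto simp: contact_def)
    then show "lift_point h m \<in> C" using C extreme_point_of_convex_hull by blast
  qed
  then have ind: "\<not> affine_dependent (lift_point h ` contact u c)"
    using C(1) affine_independent_subset by blast
  show ?thesis
  proof
    assume "affine_dependent (contact u c)"
    then obtain U v where U: "sum U (contact u c) = 0" "v \<in> contact u c" "U v \<noteq> 0"
        "(\<Sum>m\<in>contact u c. U m *\<^sub>R m) = 0"
      using affine_dependent_explicit_finite[OF finite_contact] by blast
    have inj: "inj_on (lift_point h) (contact u c)" by (auto simp: inj_on_def lift_point_def)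
    have "(\<Sum>m\<in>contact u c. U m * H m) = (\<Sum>m\<in>contact u c. u \<bullet> (U m *\<^sub>R m) + c * U m)"
      by (intro sum.cong) (auto simp: contact_def algebra_simps)
    also have "\<dots> = u \<bullet> (\<Sum>m\<in>contact u c. U m *\<^sub>R m) + c * sum U (contact u c)"
      by (simp only: sum.distrib inner_sum_right sum_distrib_left)
    also have "\<dots> = 0" using U by simp
    finally have "(\<Sum>m\<in>contact u c. U m *\<^sub>R lift_point h m) = 0"
      using U(4) by (simp add: lift_point_def H_def prod_eq_iff fst_sum snd_sum)
    then have "(\<Sum>z\<in>lift_point h ` contact u c. U (fst z) *\<^sub>R z) = 0"
      by (subst sum.reindex[OF inj]) (simp add: lift_point_def)
    moreover have "(\<Sum>z\<in>lift_point h ` contact u c. U (fst z)) = 0"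
      using U(1) by (subst sum.reindex[OF inj]) (simp add: lift_point_def)
    moreover have "lift_point h v \<in> lift_point h ` contact u c" "U (fst (lift_point h v)) \<noteq> 0"
      using U(2,3) by (auto simp: lift_point_def)
    ultimately have "affine_dependent (lift_point h ` contact u c)"
      unfolding affine_dependent_explicit_finite[OF finite_imageI[OF finite_contact]]
      by (intro exI[of _ "\<lambda>z. U (fst z)"]) blast
    then show False using ind by blast
  qed
qed simp

text \<open>The lifted polytope is separated from the open vertical ray above its highest point
  over \<open>x\<close>; the separating hyperplane is not vertical because \<open>x\<close> is an interior point.\<close>
lemma interior_covered:
  assumes x: "x \<in> interior P"
  obtains u c where "dominates u c" "x \<in> convex hull (contact u c)"
proof -
  define Q where "Q = lifted_polytope P h"
  have Q: "Q = convex hull (lift_point h ` L)" by (simp add: Q_def lifted_polytope_def L_def)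
  have compQ: "compact Q" and convQ: "convex Q"
    unfolding Q using finite_L by (auto intro: finite_imp_compact_convex_hull)
  have fstQ: "fst ` Q = P"
    by (subst P_eq) (simp add: Q convex_hull_linear_image linear_fst image_image lift_point_def)
  have "x \<in> fst ` Q" using fstQ x interior_subset by blast
  then have ne: "Q \<inter> {z. fst z = x} \<noteq> {}" by auto
  have "closed {z :: (real ^ 'n) \<times> real. fst z = x}"
    by (intro closed_Collect_eq continuous_intros)
  then have "compact (Q \<inter> {z. fst z = x})" using compQ by (simp add: compact_Int_closed)
  then obtain z where z: "z \<in> Q \<inter> {z. fst z = x}" "\<forall>w\<in>Q \<inter> {z. fst z = x}. snd w \<le> snd z"
    using continuous_attains_sup[OF _ ne, of snd] continuous_on_snd[OF continuous_on_id] by blast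
  define t where "t = snd z"
  have t: "(x, t) \<in> Q" "\<And>s. (x, s) \<in> Q \<Longrightarrow> s \<le> t"
  proof -
    show "(x, t) \<in> Q" using z(1) by (auto simp: t_def)
    show "s \<le> t" if "(x, s) \<in> Q" for s using bspec[OF z(2), of "(x, s)"] that by (simp add: t_def)
  qed
  have "convex ({x} \<times> {t<..})" by (intro convex_Times) auto
  moreover have "Q \<inter> ({x} \<times> {t<..}) = {}" using t(2) by force
  moreover have "{x} \<times> {t<..} \<noteq> {}" by auto
  ultimately obtain a b where ab: "a \<noteq> 0" "\<forall>w\<in>Q. a \<bullet> w \<le> b" "\<forall>w\<in>{x} \<times> {t<..}. b \<le> a \<bullet> w"
    using separating_hyperplane_sets[OF convQ] t(1) by blast
  obtain a1 \<beta> where a: "a = (a1, \<beta>)" by (cases a)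
  have ray: "b \<le> a1 \<bullet> x + \<beta> * s" if "t < s" for s using ab(3) that by (auto simp: a inner_Pair)
  have below: "a1 \<bullet> y + \<beta> * s \<le> b" if "(y, s) \<in> Q" for y s using ab(2) that by (force simp: a inner_Pair)
  have b: "b = a1 \<bullet> x + \<beta> * t"
  proof (rule antisym)
    have "((\<lambda>s. a1 \<bullet> x + \<beta> * s) \<longlongrightarrow> a1 \<bullet> x + \<beta> * t) (at_right t)" by (intro tendsto_intros)
    moreover have "\<forall>\<^sub>F s in at_right t. b \<le> a1 \<bullet> x + \<beta> * s"
      using eventually_at_right_less[of t] by eventually_elim (rule ray)
    ultimately show "b \<le> a1 \<bullet> x + \<beta> * t" by (rule tendsto_lowerbound) simp
  qed (rule below[OF t(1)])
  have "0 \<le> \<beta>" using ray[of "t + 1"] b by (simp add: algebra_simps)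
  moreover have "\<beta> \<noteq> 0"
  proof
    assume "\<beta> = 0"
    then have "a1 \<noteq> 0" using ab(1) a by (auto simp: zero_prod_def)
    obtain e where e: "e > 0" "cball x e \<subseteq> P" using x by (auto simp: mem_interior_cball)
    have "x + (e / norm a1) *\<^sub>R a1 \<in> P"
      using e \<open>a1 \<noteq> 0\<close> by (intro subsetD[OF e(2)]) (auto simp: dist_norm)
    then obtain s where "(x + (e / norm a1) *\<^sub>R a1, s) \<in> Q" using fstQ by force
    then have "a1 \<bullet> (x + (e / norm a1) *\<^sub>R a1) \<le> a1 \<bullet> x" using below b \<open>\<beta> = 0\<close> by fastforce
    moreover have "0 < a1 \<bullet> ((e / norm a1) *\<^sub>R a1)" using e \<open>a1 \<noteq> 0\<close> by auto
    ultimately show False by (simp add: inner_add_right)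
  qed
  ultimately have \<beta>: "0 < \<beta>" by simp
  define u where "u = (- 1 / \<beta>) *\<^sub>R a1"
  define c where "c = b / \<beta>"
  have "dominates u c"
    unfolding dominates_def
  proof
    fix m assume "m \<in> L"
    then have "lift_point h m \<in> Q" unfolding Q by (simp add: hull_inc)
    then have "a1 \<bullet> m + \<beta> * H m \<le> b" using below by (simp add: lift_point_def H_def)
    then show "H m \<le> u \<bullet> m + c" using \<beta> by (simp add: u_def c_def field_simps)
  qed
  moreover have "t = u \<bullet> x + c" using b \<beta> by (simp add: u_def c_def field_simps)
  then have "(x, t) \<in> convex hull (lift_point h ` contact u c)"
    using lifted_polytope_face(1)[OF \<open>dominates u c\<close>] t(1) by (auto simp: Q_def)
  then have "x \<in> fst ` (convex hull (lift_point h ` contact u c))" by force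
  then have "x \<in> convex hull (contact u c)"
    by (simp add: convex_hull_linear_image linear_fst image_image lift_point_def)
  ultimately show ?thesis using that by blast
qed

text \<open>A maximal simplex around the given one has 0 as a vertex, which forces its constant to
  be \<open>H 0\<close>. Containment of hulls leaves open whether \<open>m\<close> is in the larger
  contact set. But the function \<open>u'\<close> interpolates heights which \<open>u\<close>
  dominates, so at \<open>m\<close> it cannot exceed \<open>H m\<close>.\<close>

lemma contact_extends_central:
  assumes d: "dominates u c" and ne: "contact u c \<noteq> {}"
  obtains u' where "dominates u' (H 0)" "contact u c \<subseteq> contact u' (H 0)"
proof -
  define T where "T = coherent_triangulation P h"
  have "T \<subseteq> (\<lambda>S. convex hull S) ` Pow L"
    unfolding T_def coherent_triangulation_eq using contact_subset by blast
  then have "finite T" using finite_L by (meson finite_Pow_iff finite_imageI finite_subset)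
  moreover have "convex hull (contact u c) \<in> T"
    using assms unfolding T_def coherent_triangulation_eq by blast
  ultimately obtain \<tau> where \<tau>: "\<tau> \<in> T" "convex hull (contact u c) \<subseteq> \<tau>" "\<forall>\<sigma>\<in>T. \<tau> \<subseteq> \<sigma> \<longrightarrow> \<sigma> = \<tau>"
    using finite_has_maximal2[of T "convex hull (contact u c)"] by metis
  then have "0 extreme_point_of \<tau>" using central by (auto simp: central_heights_def T_def)
  moreover obtain u' c' where u': "dominates u' c'" "\<tau> = convex hull (contact u' c')"
    using \<tau>(1) by (auto simp: T_def coherent_triangulation_eq)
  ultimately have "0 \<in> contact u' c'" using extreme_point_of_convex_hull by blast
  then have c': "c' = H 0" by (simp add: contact_def)
  have "m \<in> contact u' c'" if m: "m \<in> contact u c" for m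
  proof -
    have "m \<in> convex hull (id ` contact u' c')" using \<tau>(2) u'(2) m hull_subset by fastforce
    then obtain g where g: "weights_on (contact u' c') g" "m = (\<Sum>w\<in>contact u' c'. g w *\<^sub>R w)"
      using convex_hull_image_weights[OF finite_contact subset_refl, of id u' c'] by auto
    have affine: "(\<Sum>w\<in>contact u' c'. g w * (y \<bullet> w + k)) = y \<bullet> m + k" for y k
    proof -
      have "(\<Sum>w\<in>contact u' c'. g w * (y \<bullet> w + k)) = y \<bullet> m + sum g (contact u' c') * k"
        unfolding g(2) by (simp add: inner_sum_right distrib_left sum.distrib sum_distrib_right)
      then show ?thesis using g(1) by (simp add: weights_on_def)
    qed
    have "u' \<bullet> m + c' = (\<Sum>w\<in>contact u' c'. g w * H w)"
      unfolding affine[symmetric] by (intro sum.cong) (auto simp: contact_def)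
    also have "\<dots> \<le> (\<Sum>w\<in>contact u' c'. g w * (u \<bullet> w + c))"
      using d contact_subset weights_on_nonneg[OF g(1)]
      by (intro sum_mono mult_left_mono) (auto simp: dominates_def)
    also have "\<dots> = H m" unfolding affine using m by (simp add: contact_def)
    finally have "u' \<bullet> m + c' \<le> H m" .
    moreover have "m \<in> L" using m by (simp add: contact_def)
    ultimately show ?thesis using u'(1) by (force simp: contact_def dominates_def)
  qed
  then show ?thesis using that u'(1) c' by blast
qed

lemma interior_covered_central:
  assumes "x \<in> interior P"
  obtains u where "dominates u (H 0)" "x \<in> convex hull (contact u (H 0))"
proof -
  obtain u c where u: "dominates u c" "x \<in> convex hull (contact u c)" by (rule interior_covered[OF assms])
  then have "contact u c \<noteq> {}" by auto
  then obtain u' where "dominates u' (H 0)" "contact u c \<subseteq> contact u' (H 0)"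
    using contact_extends_central[OF u(1)] by blast
  then show ?thesis using that u(2) hull_mono by blast
qed

lemma zero_in_contact: "0 \<in> contact u (H 0)"
  using zero_in_L by (simp add: contact_def)

lemma contact_independent:
  assumes "dominates u (H 0)"
  shows "independent (contact u (H 0) - {0})"
  using contact_affine_independent[OF assms] affine_dependent_iff_dependent2[OF zero_in_contact] by simp

text \<open>If \<open>p\<close> were an interior point in the base of the cone over a simplex, then a slightly larger
  multiple of \<open>p\<close> would lie in another simplex of the triangulation, against the uniqueness of
  representations in the cones.\<close>
lemma contact_base_in_frontier:
  assumes d: "dominates u (H 0)"
  shows "convex hull (contact u (H 0) - {0}) \<subseteq> frontier P"
proof
  let ?M = "contact u (H 0) - {0}" and ?V = "L - {0}"
  have MV: "?M \<subseteq> ?V" using contact_subset by blast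
  have finV: "finite ?V" using finite_L by simp
  fix p assume p: "p \<in> convex hull ?M"
  then have "p \<in> P" using hull_mono[of ?M L] contact_subset P_eq by blast
  obtain g where g: "weights_on ?M g" "p = (\<Sum>m\<in>?V. g m *\<^sub>R m)"
    using p convex_hull_image_weights[OF finV MV, of id] by auto
  have "p \<notin> interior P"
  proof
    assume "p \<in> interior P"
    then obtain e where e: "e > 0" "ball p e \<subseteq> P" by (auto simp: mem_interior)
    \<comment> \<open>The point moves by less than \<open>e / 2\<close>; the 1 in the denominator
      covers \<open>p = 0\<close>.\<close>
    define k where "k = 1 + e / (2 * (1 + norm p))"
    have k: "1 < k" using e norm_ge_zero[of p] by (simp add: k_def add_pos_nonneg)
    have "norm p * e < e * (2 * (1 + norm p))"
      using e(1) by (auto simp: algebra_simps intro!: add_nonneg_pos)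
    then have "e * norm p / (2 * (1 + norm p)) < e"
      using norm_ge_zero[of p] by (subst pos_divide_less_eq) (auto simp: mult.commute intro!: add_pos_nonneg)
    moreover have "p - k *\<^sub>R p = - ((e / (2 * (1 + norm p))) *\<^sub>R p)"
      by (simp add: k_def scaleR_left_distrib)
    ultimately have "k *\<^sub>R p \<in> ball p e" using e(1) by (simp add: dist_norm)
    moreover have "ball p e \<subseteq> interior P" using e(2) by (simp add: interior_maximal)
    ultimately have "k *\<^sub>R p \<in> interior P" by blast
    then obtain u' where u': "dominates u' (H 0)" "k *\<^sub>R p \<in> convex hull (contact u' (H 0))"
      by (rule interior_covered_central)
    then obtain g' where g': "weights_on (contact u' (H 0)) g'" "k *\<^sub>R p = (\<Sum>m\<in>L. g' m *\<^sub>R m)"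
      using convex_hull_image_weights[OF finite_L contact_subset, of id] by auto
    have eq: "(\<Sum>m\<in>?V. (k * g m) *\<^sub>R m) = (\<Sum>m\<in>?V. g' m *\<^sub>R m)"
    proof -
      have "(\<Sum>m\<in>L. g' m *\<^sub>R m) = (\<Sum>m\<in>?V. g' m *\<^sub>R m)"
        by (rule sum.mono_neutral_right) (use finite_L in auto)
      then show ?thesis using g(2) g'(2) by (simp flip: scaleR_scaleR scaleR_sum_right)
    qed
    have ineq: "- w \<bullet> m \<le> H 0 - H m" if "dominates w (H 0)" "m \<in> ?V" for w m
      using that by (auto simp: dominates_def)
    have contact_iff: "m \<in> contact w (H 0) \<longleftrightarrow> - w \<bullet> m = H 0 - H m" if "m \<in> ?V" for w m
      using that by (auto simp: contact_def)
    have T: "{m\<in>?V. - u \<bullet> m = H 0 - H m} = ?M"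
      using contact_iff MV by blast
    have eqs: "k * g m = g' m" if "m \<in> ?V" for m
    proof (rule cone_representation_unique[where V = ?V and g = "\<lambda>m. k * g m" and g' = g'
            and \<phi> = "- u" and \<phi>' = "- u'" and \<kappa> = "\<lambda>m. H 0 - H m", OF finV _ _ _ _ _ _ _ eq that])
        show "0 \<le> k * g m" "0 \<le> g' m" for m
          using k weights_on_nonneg[OF g(1)] weights_on_nonneg[OF g'(1)] by auto
        show "k * g m = 0" if "m \<in> ?V" "- u \<bullet> m \<noteq> H 0 - H m" for m
          using contact_iff[OF that(1)] that(2) weights_on_outside[OF g(1), of m] by simp
        show "g' m = 0" if "m \<in> ?V" "- u' \<bullet> m \<noteq> H 0 - H m" for m
          using contact_iff[OF that(1)] that(2) weights_on_outside[OF g'(1), of m] by simp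
        show "independent {m \<in> ?V. - u \<bullet> m = H 0 - H m}" unfolding T by (rule contact_independent[OF d])
    qed (fact ineq[OF d] ineq[OF u'(1)])+
    \<comment> \<open>The total weight would be \<open>k > 1\<close> when computed from the base of
      the cone, but at most 1 in the other simplex.\<close>
    have "sum g' ?V = (\<Sum>m\<in>?V. k * g m)" by (intro sum.cong refl eqs[symmetric])
    also have "\<dots> = k * sum g ?V" by (rule sum_distrib_left[symmetric])
    also have "\<dots> = k" using weights_on_sum[OF g(1) finV MV] by simp
    finally have "k = sum g' ?V" ..
    also have "\<dots> \<le> sum g' L"
      using finite_L weights_on_nonneg[OF g'(1)] by (intro sum_mono2) auto
    also have "\<dots> = 1" by (rule weights_on_sum[OF g'(1) finite_L contact_subset])
    finally show False using k by simp
  qed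
  then show "p \<in> frontier P" using \<open>p \<in> P\<close> closure_subset by (auto simp: frontier_def)
qed

text \<open>Independence provides a linear functional that is 0 on \<open>r\<close> and 1 on the
  other nonzero vertices. Tilting by a small multiple of it detaches exactly the latter, keeps the
  value at 0, and touches no new point.\<close>

lemma contact_restrict:
  assumes d: "dominates u (H 0)" and r: "r \<subseteq> contact u (H 0) - {0}"
  obtains u' where "dominates u' (H 0)" "contact u' (H 0) = insert 0 r"
proof -
  let ?M = "contact u (H 0) - {0}"
  obtain f :: "real ^ 'n \<Rightarrow> real" where f: "linear f" "\<forall>m\<in>?M. f m = (if m \<in> r then 0 else 1)"
    using linear_independent_extend[OF contact_independent[OF d], of "\<lambda>m. if m \<in> r then 0 else 1"] by blast
  define y where "y = adjoint f 1"
  have y: "y \<bullet> m = f m" for m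
    using adjoint_works[OF f(1), of m 1] by (simp add: y_def inner_commute)
  define S where "S = L - contact u (H 0)"
  have "finite S" using finite_L by (simp add: S_def)
  moreover have "0 < u \<bullet> m + H 0 - H m" if "m \<in> S" for m
    using that d by (auto simp: S_def contact_def dominates_def less_le)
  ultimately obtain e where e: "0 < e" "\<And>m. m \<in> S \<Longrightarrow> e * (- (y \<bullet> m)) < u \<bullet> m + H 0 - H m"
    using ex_small_factor[of S "\<lambda>m. u \<bullet> m + H 0 - H m" "\<lambda>m. - (y \<bullet> m)"] by blast
  define u' where "u' = u + e *\<^sub>R y"
  have in_S: "H m < u' \<bullet> m + H 0" if "m \<in> S" for m
    using e(2)[OF that] by (simp add: u'_def inner_add_left)
  have in_M: "u' \<bullet> m + H 0 = H m + (if m \<in> r then 0 else e)" if "m \<in> ?M" for m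
    using that f(2) y by (auto simp: u'_def inner_add_left contact_def)
  have cases: "m \<in> S \<or> m \<in> ?M \<or> m = 0" if "m \<in> L" for m
    using that by (auto simp: S_def)
  have "dominates u' (H 0)"
    unfolding dominates_def
  proof
    fix m assume "m \<in> L"
    then show "H m \<le> u' \<bullet> m + H 0" using cases[of m] in_S[of m] in_M[of m] e(1) by (auto simp: less_imp_le)
  qed
  moreover have "contact u' (H 0) = insert 0 r"
  proof
    show "contact u' (H 0) \<subseteq> insert 0 r"
      using cases in_S in_M e(1) by (fastforce simp: contact_def split: if_splits)
    show "insert 0 r \<subseteq> contact u' (H 0)"
      using r in_M contact_subset zero_in_contact by (force simp: contact_def)
  qed
  ultimately show ?thesis using that by blast
qed

definition vertex_sets :: "(real ^ 'n) set set" where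
  "vertex_sets = {t. t \<noteq> {} \<and> convex hull t \<subseteq> frontier P \<and> (\<exists>u c. dominates u c \<and> t = contact u c)}"

lemma frontier_functional:
  assumes "t \<noteq> {}" "convex hull t \<subseteq> frontier P"
  shows "\<exists>f. (\<forall>x\<in>P. f \<bullet> x \<le> 1) \<and> (\<forall>x\<in>t. f \<bullet> x = 1)"
proof -
  have "convex hull t \<noteq> {}" using assms(1) by simp
  then obtain f where "\<forall>x\<in>P. f \<bullet> x \<le> 1" "\<forall>x\<in>convex hull t. f \<bullet> x = 1"
    using ex_supporting_functional[OF convex_P interior_0 convex_convex_hull _ assms(2)] by blast
  then show ?thesis by (intro exI[of _ f]) (auto simp: hull_inc)
qed

text \<open>The simplex on \<open>insert 0 r\<close> must still lose the vertex 0. The defect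
  \<open>1 - f \<bullet> m\<close> of a supporting functional is nonnegative on \<open>P\<close>,
  zero on \<open>r\<close> and 1 at 0; adding it releases 0 alone.\<close>

lemma contact_base_in_vertex_sets:
  assumes d: "dominates u (H 0)" and r: "r \<subseteq> contact u (H 0) - {0}" "r \<noteq> {}"
  shows "r \<in> vertex_sets"
proof -
  have fr: "convex hull r \<subseteq> frontier P"
    using contact_base_in_frontier[OF d] hull_mono[OF r(1)] by blast
  obtain f where f: "\<And>x. x \<in> P \<Longrightarrow> f \<bullet> x \<le> 1" "\<And>x. x \<in> r \<Longrightarrow> f \<bullet> x = 1"
    using frontier_functional[OF r(2) fr] by blast
  obtain u' where u': "dominates u' (H 0)" "contact u' (H 0) = insert 0 r"
    by (rule contact_restrict[OF d r(1)])
  have shift: "(u' - f) \<bullet> m + (H 0 + 1) = (u' \<bullet> m + H 0) + (1 - f \<bullet> m)" for m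
    by (simp add: inner_diff_left)
  have fL: "f \<bullet> m \<le> 1" if "m \<in> L" for m using f(1) that by (simp add: L_def)
  have "dominates (u' - f) (H 0 + 1)"
    using u'(1) fL unfolding dominates_def shift by (fastforce intro: add_increasing2)
  moreover have "contact (u' - f) (H 0 + 1) = r"
  proof
    show "contact (u' - f) (H 0 + 1) \<subseteq> r"
    proof
      fix m assume m: "m \<in> contact (u' - f) (H 0 + 1)"
      then have "m \<in> L" "H m = (u' \<bullet> m + H 0) + (1 - f \<bullet> m)" unfolding contact_def shift by auto
      then have "H m = u' \<bullet> m + H 0" "f \<bullet> m = 1" using u'(1) fL[of m] by (auto simp: dominates_def)
      then have "m \<in> insert 0 r" "m \<noteq> 0" using \<open>m \<in> L\<close> u'(2) by (auto simp: contact_def)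
      then show "m \<in> r" by simp
    qed
    show "r \<subseteq> contact (u' - f) (H 0 + 1)"
    proof
      fix m assume "m \<in> r"
      then have "m \<in> contact u' (H 0)" "f \<bullet> m = 1" using u'(2) f(2) by auto
      then show "m \<in> contact (u' - f) (H 0 + 1)" unfolding contact_def shift by simp
    qed
  qed
  ultimately show ?thesis using r(2) fr unfolding vertex_sets_def by blast
qed

lemma vertex_set_extends:
  assumes "t \<in> vertex_sets"
  obtains u where "dominates u (H 0)" "contact u (H 0) = insert 0 t" "0 \<notin> t"
proof -
  obtain v c where v: "dominates v c" "t = contact v c" "t \<noteq> {}" "convex hull t \<subseteq> frontier P"
    using assms by (auto simp: vertex_sets_def)
  have "0 \<notin> t"
    using v(4) hull_subset[of t convex] interior_0 by (auto simp: frontier_def)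
  moreover obtain u where "dominates u (H 0)" "t \<subseteq> contact u (H 0)"
    using contact_extends_central[OF v(1)] v(2,3) by blast
  ultimately show ?thesis using that contact_restrict[of u t] by blast
qed

lemma boundary_triangulation_eq: "boundary_triangulation P h = (\<lambda>t. convex hull t) ` vertex_sets"
  unfolding boundary_triangulation_def coherent_triangulation_eq vertex_sets_def by blast

text \<open>For nonzero lattice points, domination by \<open>u\<close> with constant
  \<open>H 0\<close> reads \<open>- u \<bullet> m \<le> H 0 - H m\<close>; hence the sign of
  \<open>\<phi>\<close> and the choice of \<open>\<kappa>\<close>. To cover a vector, scale it into
  the interior of \<open>P\<close> and drop the vertex 0 from the simplex found there, which does
  not change the sum.\<close>

lemma central_fan:
  obtains \<phi> \<psi> where "central_fan P vertex_sets (\<lambda>m. H 0 - H m) \<phi> \<psi>"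
proof -
  have "\<forall>t\<in>vertex_sets. \<exists>u. dominates u (H 0) \<and> contact u (H 0) = insert 0 t \<and> 0 \<notin> t"
    using vertex_set_extends by metis
  then obtain U where U: "\<And>t. t \<in> vertex_sets \<Longrightarrow> dominates (U t) (H 0)"
      "\<And>t. t \<in> vertex_sets \<Longrightarrow> contact (U t) (H 0) = insert 0 t" "\<And>t. t \<in> vertex_sets \<Longrightarrow> 0 \<notin> t"
    by metis
  have "\<forall>t\<in>vertex_sets. \<exists>f. (\<forall>x\<in>P. f \<bullet> x \<le> 1) \<and> (\<forall>x\<in>t. f \<bullet> x = 1)"
  proof
    fix t assume "t \<in> vertex_sets"
    then have "t \<noteq> {}" "convex hull t \<subseteq> frontier P" by (auto simp: vertex_sets_def)
    then show "\<exists>f. (\<forall>x\<in>P. f \<bullet> x \<le> 1) \<and> (\<forall>x\<in>t. f \<bullet> x = 1)" by (rule frontier_functional)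
  qed
  then obtain \<psi> where \<psi>: "\<And>t x. \<lbrakk>t \<in> vertex_sets; x \<in> P\<rbrakk> \<Longrightarrow> \<psi> t \<bullet> x \<le> 1"
      "\<And>t x. \<lbrakk>t \<in> vertex_sets; x \<in> t\<rbrakk> \<Longrightarrow> \<psi> t \<bullet> x = 1"
    by metis
  have sub: "t \<subseteq> contact (U t) (H 0) - {0}" if "t \<in> vertex_sets" for t using U[OF that] by auto
  have subL: "\<Union>vertex_sets \<subseteq> L" unfolding vertex_sets_def using contact_subset by blast
  have cover: "\<exists>t\<in>vertex_sets. \<exists>c. (\<forall>w\<in>t. 0 \<le> c w) \<and> y = (\<Sum>w\<in>t. c w *\<^sub>R w)" if "y \<noteq> 0" for y
  proof -
    obtain e where e: "e > 0" "ball 0 e \<subseteq> interior P"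
      using interior_0 open_interior open_contains_ball by blast
    define k where "k = e / 2 / norm y"
    have k: "0 < k" using e that by (simp add: k_def)
    have "k *\<^sub>R y \<in> interior P" using e that by (intro subsetD[OF e(2)]) (auto simp: k_def)
    then obtain u where u: "dominates u (H 0)" "k *\<^sub>R y \<in> convex hull (contact u (H 0))"
      by (rule interior_covered_central)
    let ?E = "contact u (H 0)"
    obtain g where g: "weights_on ?E g" "k *\<^sub>R y = (\<Sum>m\<in>?E. g m *\<^sub>R m)"
      using u(2) convex_hull_image_weights[OF finite_contact subset_refl, of id u "H 0"] by auto
    have "(\<Sum>m\<in>?E. g m *\<^sub>R m) = (\<Sum>m\<in>?E - {0}. g m *\<^sub>R m)"
      by (rule sum.mono_neutral_right) (auto simp: finite_contact)
    then have ky: "k *\<^sub>R y = (\<Sum>m\<in>?E - {0}. g m *\<^sub>R m)" using g(2) by simp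
    have "y = (1 / k) *\<^sub>R (k *\<^sub>R y)" using k by simp
    also have "\<dots> = (\<Sum>m\<in>?E - {0}. (g m / k) *\<^sub>R m)" unfolding ky by (simp add: scaleR_sum_right)
    finally have y: "y = (\<Sum>m\<in>?E - {0}. (g m / k) *\<^sub>R m)" .
    have "?E - {0} \<noteq> {}" using y that by (metis sum.empty)
    then have "?E - {0} \<in> vertex_sets" by (intro contact_base_in_vertex_sets[OF u(1)]) auto
    moreover have "\<forall>m\<in>?E - {0}. 0 \<le> g m / k" using weights_on_nonneg[OF g(1)] k by simp
    ultimately show ?thesis using y by (intro bexI[of _ "?E - {0}"] exI[of _ "\<lambda>m. g m / k"] conjI)
  qed
  have ne: "vertex_sets \<noteq> {}"
    using cover[of "SOME i. i \<in> Basis"] nonzero_Basis[OF SOME_Basis] by blast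
  show ?thesis
  proof (rule that[of "\<lambda>t. - U t" \<psi>], unfold_locales)
    show "finite vertex_sets"
      using subL finite_L by (intro finite_subset[of vertex_sets "Pow L"]) auto
    show "vertex_sets \<noteq> {}" by (rule ne)
    show "{} \<notin> vertex_sets" by (simp add: vertex_sets_def)
    show "r \<in> vertex_sets" if "t \<in> vertex_sets" "r \<subseteq> t" "r \<noteq> {}" for t r
      using contact_base_in_vertex_sets[OF U(1)[OF that(1)] _ that(3)] sub[OF that(1)] that(2) by blast
    show "independent t" if "t \<in> vertex_sets" for t
      using contact_independent[OF U(1)[OF that]] sub[OF that] independent_mono by blast
    show "\<Union>vertex_sets \<subseteq> P" using subL by (auto simp: L_def)
    show "\<exists>t\<in>vertex_sets. \<exists>c. (\<forall>w\<in>t. 0 \<le> c w) \<and> y = (\<Sum>w\<in>t. c w *\<^sub>R w)" for y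
    proof (cases "y = 0")
      case True
      then show ?thesis using ne by (auto intro!: exI[of _ "\<lambda>_. 0"])
    qed (rule cover)
    show "- U t \<bullet> w = H 0 - H w" if "t \<in> vertex_sets" "w \<in> t" for t w
      using sub[OF that(1)] that(2) by (auto simp: contact_def)
    show "- U t \<bullet> w < H 0 - H w" if "t \<in> vertex_sets" "w \<in> \<Union>vertex_sets" "w \<notin> t" for t w
    proof -
      have "w \<in> L" "w \<noteq> 0" using that(2) subL U(3) by auto
      then have "w \<notin> contact (U t) (H 0)" using U(2)[OF that(1)] that(3) by simp
      then show ?thesis using U(1)[OF that(1)] \<open>w \<in> L\<close> by (force simp: contact_def dominates_def)
    qed
    show "\<psi> t \<in> polar_dual P" if "t \<in> vertex_sets" for t
      using \<psi>(1)[OF that] by (simp add: polar_dual_def)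
    show "\<psi> t \<bullet> w = 1" if "t \<in> vertex_sets" "w \<in> t" for t w by (rule \<psi>(2)[OF that])
  qed
qed

end

subsection \<open>Pairs of dual fans\<close>

lemma sum_marginals:
  fixes f :: "'s \<Rightarrow> 'a::real_vector" and k :: "'t \<Rightarrow> 'b::real_vector" and c :: "'s \<times> 't \<Rightarrow> real"
  shows "(\<Sum>i\<in>A \<times> B. c i *\<^sub>R f (fst i)) = (\<Sum>s\<in>A. (\<Sum>t\<in>B. c (s, t)) *\<^sub>R f s)"
    and "(\<Sum>i\<in>A \<times> B. c i *\<^sub>R k (snd i)) = (\<Sum>t\<in>B. (\<Sum>s\<in>A. c (s, t)) *\<^sub>R k t)"
proof -
  have "(\<Sum>i\<in>A \<times> B. c i *\<^sub>R f (fst i)) = (\<Sum>s\<in>A. \<Sum>t\<in>B. c (s, t) *\<^sub>R f s)"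
    by (simp add: sum.cartesian_product split_def)
  then show "(\<Sum>i\<in>A \<times> B. c i *\<^sub>R f (fst i)) = (\<Sum>s\<in>A. (\<Sum>t\<in>B. c (s, t)) *\<^sub>R f s)"
    by (simp add: scaleR_sum_left)
  have "(\<Sum>i\<in>A \<times> B. c i *\<^sub>R k (snd i)) = (\<Sum>s\<in>A. \<Sum>t\<in>B. c (s, t) *\<^sub>R k t)"
    by (simp add: sum.cartesian_product split_def)
  also have "\<dots> = (\<Sum>t\<in>B. \<Sum>s\<in>A. c (s, t) *\<^sub>R k t)" by (rule sum.swap)
  finally show "(\<Sum>i\<in>A \<times> B. c i *\<^sub>R k (snd i)) = (\<Sum>t\<in>B. (\<Sum>s\<in>A. c (s, t)) *\<^sub>R k t)"
    by (simp add: scaleR_sum_left)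
qed

text \<open>On a product cell only the marginals matter, since the vertices of A + B and those of
  \<Sigma> both split into a part depending on \<open>s\<close> and a part depending on
  \<open>t\<close>.\<close>

lemma weights_on_marginals:
  assumes fin: "finite A" "finite B" and sub: "C \<subseteq> A" "D \<subseteq> B" and c: "weights_on (C \<times> D) c"
  shows "weights_on C (\<lambda>s. \<Sum>t\<in>B. c (s, t))" and "weights_on D (\<lambda>t. \<Sum>s\<in>A. c (s, t))"
proof -
  have total: "sum c (A \<times> B) = 1"
    by (rule weights_on_sum[OF c]) (use fin sub in auto)
  have out: "c (s, t) = 0" if "s \<notin> C \<or> t \<notin> D" for s t
    using weights_on_outside[OF c] that by auto
  have "(\<Sum>s\<in>C. \<Sum>t\<in>B. c (s, t)) = (\<Sum>s\<in>A. \<Sum>t\<in>B. c (s, t))"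
    by (rule sum.mono_neutral_left) (use fin sub out in auto)
  also have "\<dots> = 1" using total by (simp add: sum.cartesian_product)
  finally show "weights_on C (\<lambda>s. \<Sum>t\<in>B. c (s, t))"
    using out weights_on_nonneg[OF c] by (auto simp: weights_on_def intro!: sum_nonneg sum.neutral)
  have "(\<Sum>t\<in>D. \<Sum>s\<in>A. c (s, t)) = (\<Sum>t\<in>B. \<Sum>s\<in>A. c (s, t))"
    by (rule sum.mono_neutral_left) (use fin sub out in auto)
  also have "\<dots> = (\<Sum>s\<in>A. \<Sum>t\<in>B. c (s, t))" by (rule sum.swap)
  also have "\<dots> = 1" using total by (simp add: sum.cartesian_product)
  finally show "weights_on D (\<lambda>t. \<Sum>s\<in>A. c (s, t))"
    using out weights_on_nonneg[OF c] by (auto simp: weights_on_def intro!: sum_nonneg sum.neutral)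
qed

lemma maximizers_sum:
  assumes "finite A" "A \<noteq> {}" "finite B" "B \<noteq> {}"
  shows "{i \<in> A \<times> B. \<forall>j \<in> A \<times> B. f (fst j) + g (snd j) \<le> f (fst i) + (g (snd i) :: real)}
    = maximizers A f \<times> maximizers B g"
proof (intro equalityI subsetI)
  fix i assume "i \<in> {i \<in> A \<times> B. \<forall>j \<in> A \<times> B. f (fst j) + g (snd j) \<le> f (fst i) + g (snd i)}"
  then obtain s t where i: "i = (s, t)" "s \<in> A" "t \<in> B"
    and le: "\<And>s' t'. \<lbrakk>s' \<in> A; t' \<in> B\<rbrakk> \<Longrightarrow> f s' + g t' \<le> f s + g t" by auto
  have "f s' \<le> f s" if "s' \<in> A" for s' using le[OF that i(3)] by simp
  moreover have "g t' \<le> g t" if "t' \<in> B" for t' using le[OF i(2) that] by simp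
  ultimately show "i \<in> maximizers A f \<times> maximizers B g" using i by (simp add: maximizers_def)
qed (auto simp: maximizers_def intro: add_mono)

text \<open>The relation \<open>m \<bullet> n = 1\<close> is monotone, so \<open>(m, n) \<mapsto> m + n\<close> embeds it, and even the
  direction of \<open>m + n\<close> determines \<open>(m, n)\<close>.\<close>
lemma Sigma_space_direction_inj:
  fixes Dv :: "(real ^ 'n) set"
  assumes mn: "(m, n) \<in> Sigma_space Dv" and mn': "(m', n') \<in> Sigma_space Dv"
    and eq: "m + n = k *\<^sub>R (m' + n')" and k: "0 < k"
  shows "m = m' \<and> n = n'"
proof -
  have pair: "m \<bullet> n = 1" "m' \<bullet> n' = 1" "m \<bullet> n' \<le> 1" "m' \<bullet> n \<le> 1"
    using mn mn' by (auto simp: Sigma_space_def polar_dual_def)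
  have v: "n - k *\<^sub>R n' = k *\<^sub>R m' - m" using eq by (simp add: algebra_simps)
  have "(n - k *\<^sub>R n') \<bullet> (n - k *\<^sub>R n') = (k *\<^sub>R m' - m) \<bullet> (n - k *\<^sub>R n')" by (simp add: v)
  also have "\<dots> = k * (m' \<bullet> n) + k * (m \<bullet> n') - k * k - 1"
    using pair by (simp add: inner_diff_left inner_diff_right algebra_simps)
  \<comment> \<open>Polarity bounds the mixed pairings by 1. What remains is minus a square, and a
    squared norm can be below it only if both vanish.\<close>
  also have "\<dots> \<le> k * 1 + k * 1 - k * k - 1"
    using k pair by (intro diff_right_mono add_mono mult_left_mono) auto
  also have "\<dots> = - ((k - 1) * (k - 1))" by (simp add: algebra_simps)
  finally have le: "(n - k *\<^sub>R n') \<bullet> (n - k *\<^sub>R n') \<le> - ((k - 1) * (k - 1))" .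
  moreover have "0 \<le> (n - k *\<^sub>R n') \<bullet> (n - k *\<^sub>R n')" by simp
  moreover have "0 \<le> (k - 1) * (k - 1)" by simp
  ultimately have "(n - k *\<^sub>R n') \<bullet> (n - k *\<^sub>R n') = 0" "(k - 1) * (k - 1) = 0" by linarith+
  then have "k = 1" "n = k *\<^sub>R n'" by simp_all
  then show ?thesis using eq by simp
qed

definition direction :: "(real ^ 'n) \<times> (real ^ 'n) \<Rightarrow> real ^ 'n" where
  "direction x = (fst x + snd x) /\<^sub>R norm (fst x + snd x)"

lemma Sigma_space_sum_nonzero: "x \<in> Sigma_space Dv \<Longrightarrow> fst x + snd x \<noteq> 0"
proof
  assume "x \<in> Sigma_space Dv" "fst x + snd x = 0"
  then have "fst x \<bullet> snd x = 1" "snd x = - fst x"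
    by (auto simp: Sigma_space_def eq_neg_iff_add_eq_0 add.commute)
  then show False using inner_ge_zero[of "fst x"] by simp
qed

lemma direction_Sigma_space:
  "continuous_on (Sigma_space Dv) direction" "inj_on direction (Sigma_space Dv)"
  "direction ` Sigma_space Dv \<subseteq> sphere 0 1"
proof -
  show "continuous_on (Sigma_space Dv) direction"
    unfolding direction_def using Sigma_space_sum_nonzero by (intro continuous_intros) auto
  show "direction ` Sigma_space Dv \<subseteq> sphere 0 1"
    using Sigma_space_sum_nonzero by (fastforce simp: direction_def)
  show "inj_on direction (Sigma_space Dv)"
  proof (rule inj_onI)
    fix x x' assume x: "x \<in> Sigma_space Dv" "x' \<in> Sigma_space Dv" "direction x = direction x'"
    define r r' where "r = norm (fst x + snd x)" and "r' = norm (fst x' + snd x')"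
    have r: "0 < r" "0 < r'" using Sigma_space_sum_nonzero[OF x(1)] Sigma_space_sum_nonzero[OF x(2)] by (auto simp: r_def r'_def)
    have "r *\<^sub>R direction x = fst x + snd x" using r by (simp add: direction_def r_def)
    moreover have "direction x = inverse r' *\<^sub>R (fst x' + snd x')" unfolding x(3) by (simp add: direction_def r'_def)
    ultimately have "fst x + snd x = (r * inverse r') *\<^sub>R (fst x' + snd x')" by simp
    then have "fst x = fst x' \<and> snd x = snd x'"
      using Sigma_space_direction_inj[of "fst x" "snd x" Dv "fst x'" "snd x'" "r * inverse r'"] x(1,2) r by simp
    then show "x = x'" by (simp add: prod_eq_iff)
  qed
qed

section \<open>Centroids and the barycentric subdivision in terms of vertex sets\<close>

lemma inner_centroid: "x \<bullet> centroid s = (\<Sum>m\<in>s. x \<bullet> m) / real (card s)"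
  by (simp add: centroid_def inner_combination flip: sum_divide_distrib)

lemma inner_centroid_eq_1:
  "finite s \<Longrightarrow> s \<noteq> {} \<Longrightarrow> (\<And>m. m \<in> s \<Longrightarrow> x \<bullet> m = 1) \<Longrightarrow> x \<bullet> centroid s = 1"
  by (simp add: inner_centroid)

lemma inner_centroid_eq_1D:
  assumes "finite s" "\<And>m. m \<in> s \<Longrightarrow> x \<bullet> m \<le> 1" "x \<bullet> centroid s = 1" "m \<in> s"
  shows "x \<bullet> m = 1"
proof -
  have "0 < card s" using assms by (auto simp: card_gt_0_iff)
  then have "(\<Sum>m\<in>s. x \<bullet> m) = real (card s)" using assms(3) by (simp add: inner_centroid field_simps)
  then have "(\<Sum>m\<in>s. 1 - x \<bullet> m) = 0" by (simp add: sum_subtractf)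
  then have "\<forall>m\<in>s. 1 - x \<bullet> m = 0"
    using assms(1,2) by (subst (asm) sum_nonneg_eq_0_iff) auto
  then show ?thesis using assms(4) by force
qed

lemma centroid_in_hull: "finite s \<Longrightarrow> s \<noteq> {} \<Longrightarrow> centroid s \<in> convex hull s"
  unfolding centroid_def combination_def by (intro convex_sum) (auto simp: hull_inc)

context central_fan
begin

text \<open>In the fan a vertex has only its trivial representation. This translates chains of
  hulls, as in \<open>bsd\<close>, into chains of vertex sets.\<close>

lemma hull_subset_iff:
  assumes "s \<in> K" "t \<in> K"
  shows "convex hull s \<subseteq> convex hull t \<longleftrightarrow> s \<subseteq> t"
proof
  assume sub: "convex hull s \<subseteq> convex hull t"
  show "s \<subseteq> t"
  proof
    fix w assume w: "w \<in> s"
    have wV: "w \<in> \<Union>K" "t \<subseteq> \<Union>K" using w assms by auto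
    have "w \<in> convex hull (id ` t)" using sub hull_inc[OF w] by auto
    then obtain g where g: "weights_on t g" "w = (\<Sum>m\<in>\<Union>K. g m *\<^sub>R m)"
      using convex_hull_image_weights[OF finite_vertices wV(2), of id] by auto
    note sg = singleton_in_K[OF wV(1)]
    have "g w = (if w = w then 1 else 0)"
    proof (rule cone_representation_unique[where V = "\<Union>K" and \<phi> = "\<phi> t" and \<phi>' = "\<phi> {w}" and \<kappa> = \<kappa>
          and g = g and g' = "\<lambda>m. if m = w then 1 else 0"])
      have "(if m = w then 1 else 0) *\<^sub>R m = (if m = w then w else 0)" for m by simp
      then show "(\<Sum>m\<in>\<Union>K. g m *\<^sub>R m) = (\<Sum>m\<in>\<Union>K. (if m = w then 1 else 0) *\<^sub>R m)"
        using wV(1) finite_vertices by (simp add: g(2)[symmetric])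
      have "{m \<in> \<Union>K. \<phi> t \<bullet> m = \<kappa> m} = t" using \<phi>_eq_iff[OF assms(2)] wV(2) by blast
      then show "independent {m \<in> \<Union>K. \<phi> t \<bullet> m = \<kappa> m}" using K_independent[OF assms(2)] by simp
      show "g m = 0" if "m \<in> \<Union>K" "\<phi> t \<bullet> m \<noteq> \<kappa> m" for m
        using that \<phi>_eq_iff[OF assms(2)] weights_on_outside[OF g(1)] by blast
      show "(if m = w then 1 else 0) = (0::real)" if "m \<in> \<Union>K" "\<phi> {w} \<bullet> m \<noteq> \<kappa> m" for m
        using that \<phi>_in[OF sg, of w] by auto
    qed (use finite_vertices \<phi>_le[OF assms(2)] \<phi>_le[OF sg] weights_on_nonneg[OF g(1)] wV in auto)
    then show "w \<in> t" using weights_on_outside[OF g(1)] by force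
  qed
qed (rule hull_mono)

lemma barycenter_hull:
  assumes "s \<in> K"
  shows "barycenter (convex hull s) = centroid s"
proof -
  have "\<not> affine_dependent s" using K_independent[OF assms] affine_dependent_imp_dependent by blast
  then have "{v. v extreme_point_of (convex hull s)} = s"
    by (simp add: extreme_point_of_convex_hull_affine_independent)
  then show ?thesis
    by (simp add: barycenter_def centroid_def combination_def scaleR_sum_right divide_inverse)
qed

lemma bsd_hulls:
  "bsd ((\<lambda>s. convex hull s) ` K) = {convex hull (centroid ` C) | C. C \<subseteq> K \<and> C \<noteq> {} \<and> is_chain C}"
proof -
  have ne: "(\<lambda>s. convex hull s) ` K - {{}} = (\<lambda>s. convex hull s) ` K"
    using empty_notin_K by force
  have img: "barycenter ` ((\<lambda>s. convex hull s) ` C) = centroid ` C" if "C \<subseteq> K" for C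
    using that barycenter_hull by (force simp: image_image intro!: image_cong)
  have chain: "(\<forall>\<sigma>\<in>(\<lambda>s. convex hull s) ` C. \<forall>\<tau>\<in>(\<lambda>s. convex hull s) ` C. \<sigma> \<subseteq> \<tau> \<or> \<tau> \<subseteq> \<sigma>) \<longleftrightarrow> is_chain C"
    if "C \<subseteq> K" for C
    using that hull_subset_iff unfolding is_chain_def by (simp add: subset_iff)
  show ?thesis
  proof (intro equalityI subsetI)
    fix X assume "X \<in> bsd ((\<lambda>s. convex hull s) ` K)"
    then obtain C' where C': "X = convex hull (barycenter ` C')" "C' \<subseteq> (\<lambda>s. convex hull s) ` K" "C' \<noteq> {}"
        "\<forall>\<sigma>\<in>C'. \<forall>\<tau>\<in>C'. \<sigma> \<subseteq> \<tau> \<or> \<tau> \<subseteq> \<sigma>"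
      unfolding bsd_def ne by blast
    then obtain C where "C \<subseteq> K" "C' = (\<lambda>s. convex hull s) ` C" by (meson subset_imageE)
    then show "X \<in> {convex hull (centroid ` C) | C. C \<subseteq> K \<and> C \<noteq> {} \<and> is_chain C}"
      using C' img[of C] chain[of C] by auto
  next
    fix X assume "X \<in> {convex hull (centroid ` C) | C. C \<subseteq> K \<and> C \<noteq> {} \<and> is_chain C}"
    then obtain C where C: "X = convex hull (centroid ` C)" "C \<subseteq> K" "C \<noteq> {}" "is_chain C" by blast
    then show "X \<in> bsd ((\<lambda>s. convex hull s) ` K)"
      unfolding bsd_def ne
      using img[of C] chain[of C] by (intro CollectI exI[of _ "(\<lambda>s. convex hull s) ` C"]) auto
  qed
qed

end

section \<open>Polarity between the two fans\<close>

lemma polar_dual_eq: "polar_dual P = (\<Inter>n\<in>P. {m. n \<bullet> m \<le> 1})"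
  by (auto simp: polar_dual_def inner_commute)

lemma convex_polar_dual: "convex (polar_dual P)"
  unfolding polar_dual_eq by (intro convex_INT convex_halfspace_le)

lemma closed_polar_dual: "closed (polar_dual P)"
  unfolding polar_dual_eq by (intro closed_INT ballI closed_halfspace_le)

lemma ex_uniform_gap:
  fixes f :: "'i \<Rightarrow> real"
  assumes "finite A" "\<And>i. i \<in> A \<Longrightarrow> f i \<le> 1"
  shows "\<exists>c>0. \<forall>i\<in>A. f i \<noteq> 1 \<longrightarrow> c \<le> 1 - f i"
proof -
  define G where "G = insert 1 ((\<lambda>i. 1 - f i) ` {i\<in>A. f i \<noteq> 1})"
  have "finite G" using assms(1) by (simp add: G_def)
  moreover have "0 < x" if "x \<in> G" for x using that assms(2) by (auto simp: G_def less_le)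
  ultimately have "0 < Min G" "\<And>x. x \<in> G \<Longrightarrow> Min G \<le> x" by (auto simp: G_def)
  then show ?thesis by (intro exI[of _ "Min G"]) (auto simp: G_def)
qed

locale dual_fans = S: central_fan "polar_dual Dv" KS \<kappa>S \<phi>S \<psi>S + T: central_fan Dv KT \<kappa>T \<phi>T \<psi>T
  for Dv :: "(real ^ 'n) set" and KS \<kappa>S \<phi>S \<psi>S KT \<kappa>T \<phi>T \<psi>T +
  assumes convex_Dv: "convex Dv"
begin

definition compatible :: "(real ^ 'n) set set \<Rightarrow> (real ^ 'n) set set \<Rightarrow> bool" where
  "compatible C D \<longleftrightarrow> (\<forall>s\<in>C. \<forall>t\<in>D. \<forall>m\<in>s. \<forall>w\<in>t. m \<bullet> w = 1)"

definition cells :: "((real ^ 'n) set \<times> (real ^ 'n) set) set set" where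
  "cells = {C \<times> D | C D. C \<subseteq> KS \<and> C \<noteq> {} \<and> is_chain C \<and> D \<subseteq> KT \<and> D \<noteq> {} \<and> is_chain D \<and> compatible C D}"

lemma pairing_le: "m \<in> \<Union>KS \<Longrightarrow> w \<in> \<Union>KT \<Longrightarrow> m \<bullet> w \<le> 1"
  using S.K_in_P T.K_in_P unfolding polar_dual_def by blast

text \<open>The functional \<open>\<psi>T t\<close> lies in the polar polytope; expand it in a cone
  of the other fan. Its coefficients sum to at most 1, yet on \<open>t\<close> they must produce 1
  from pairings at most 1, so each vertex with nonzero coefficient pairs to 1 with all of
  \<open>t\<close>. Such a vertex serves as the standard of comparison for A.\<close>

lemma ex_dual_vertex:
  assumes t: "t \<in> KT"
  obtains m where "m \<in> \<Union>KS" "\<And>w. w \<in> t \<Longrightarrow> m \<bullet> w = 1"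
proof -
  obtain u g where u: "u \<in> KS" "\<forall>m\<in>u. 0 \<le> g m" "\<psi>T t = (\<Sum>m\<in>u. g m *\<^sub>R m)"
    using S.cones_cover[of "\<psi>T t"] by blast
  have "\<psi>S u \<bullet> \<psi>T t = (\<Sum>m\<in>u. g m)"
    unfolding u(3) using S.\<psi>_in[OF u(1)] by (simp add: inner_sum_right)
  moreover have "\<psi>S u \<bullet> \<psi>T t \<le> 1"
    using S.\<psi>_polar[OF u(1)] T.\<psi>_polar[OF t] by (simp add: polar_dual_def)
  ultimately have le: "sum g u \<le> 1" by simp
  have finu: "finite u" by (rule S.finite_member[OF u(1)])
  have one: "(\<Sum>m\<in>u. g m * (m \<bullet> w)) = 1" if "w \<in> t" for w
    using T.\<psi>_in[OF t that] unfolding u(3) by (simp add: inner_sum_left)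
  have vert: "m \<bullet> w \<le> 1" if "m \<in> u" "w \<in> t" for m w
    using pairing_le[of m w] that u(1) t by blast
  have zero: "g m * (1 - m \<bullet> w) = 0" if "w \<in> t" "m \<in> u" for m w
  proof -
    have nn: "0 \<le> g m * (1 - m \<bullet> w)" if "m \<in> u" for m using u(2) vert \<open>w \<in> t\<close> that by simp
    have "(\<Sum>m\<in>u. g m * (1 - m \<bullet> w)) = sum g u - 1"
      using one[OF \<open>w \<in> t\<close>] by (simp add: right_diff_distrib sum_subtractf)
    then have "(\<Sum>m\<in>u. g m * (1 - m \<bullet> w)) = 0" using le sum_nonneg[of u "\<lambda>m. g m * (1 - m \<bullet> w)"] nn by simp
    then show ?thesis using sum_nonneg_eq_0_iff[OF finu, of "\<lambda>m. g m * (1 - m \<bullet> w)"] nn that by simp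
  qed
  have "t \<noteq> {}" using t T.empty_notin_K by blast
  then obtain w0 where w0: "w0 \<in> t" by blast
  have "\<exists>m\<in>u. g m \<noteq> 0"
  proof (rule ccontr)
    assume "\<not> ?thesis"
    then have "(\<Sum>m\<in>u. g m * (m \<bullet> w0)) = 0" by (intro sum.neutral) auto
    then show False using one[OF w0] by simp
  qed
  then obtain m where "m \<in> u" "g m \<noteq> 0" by blast
  then show ?thesis using zero u(1) by (intro that[of m]) force+
qed

text \<open>If all pairings were 1, a cone containing \<open>- m\<close> would give
  \<open>- m\<close> a nonnegative pairing, although it pairs to \<open>- 1\<close>.\<close>

lemma not_all_cells: "KS \<times> KT \<notin> cells"
proof
  assume "KS \<times> KT \<in> cells"
  then have "compatible KS KT"
    using S.K_nonempty T.K_nonempty by (auto simp: cells_def times_eq_iff)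
  then have one: "m \<bullet> w = 1" if "m \<in> \<Union>KS" "w \<in> \<Union>KT" for m w
    using that unfolding compatible_def by blast
  obtain t where t: "t \<in> KT" using T.K_nonempty by blast
  then obtain w where w: "w \<in> t" using T.empty_notin_K by (metis ex_in_conv)
  obtain m where m: "m \<in> \<Union>KS" using ex_dual_vertex[OF t] by blast
  obtain u g where u: "u \<in> KS" "\<forall>m\<in>u. 0 \<le> g m" "- m = (\<Sum>m\<in>u. g m *\<^sub>R m)"
    using S.cones_cover[of "- m"] by blast
  have one_u: "m' \<bullet> w = 1" if "m' \<in> u" for m'
    by (rule one) (use that u(1) w t in blast)+
  have "(- m) \<bullet> w = (\<Sum>m\<in>u. g m * (m \<bullet> w))" unfolding u(3) by (simp add: inner_sum_left)
  also have "\<dots> \<ge> 0" using u(2) one_u by (intro sum_nonneg) simp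
  finally show False using one[of m w] m w t by auto
qed

lemma cell_hull:
  "convex hull ((\<lambda>i. (centroid (fst i), centroid (snd i))) ` (C \<times> D))
    = (convex hull (centroid ` C)) \<times> (convex hull (centroid ` D))"
proof -
  have "(\<lambda>i. (centroid (fst i), centroid (snd i))) ` (C \<times> D) = (centroid ` C) \<times> (centroid ` D)"
    by (auto simp: image_iff)
  then show ?thesis by (simp add: convex_hull_Times)
qed

text \<open>A mean of numbers at most 1 equals 1 only if all of them do. Used on either side in
  turn, this passes from centroids to vertices.\<close>

lemma product_in_Sigma_space_iff:
  assumes C: "C \<subseteq> KS" and D: "D \<subseteq> KT"
  shows "(convex hull (centroid ` C)) \<times> (convex hull (centroid ` D)) \<subseteq> Sigma_space Dv \<longleftrightarrow> compatible C D"
    (is "?X \<times> ?Y \<subseteq> _ \<longleftrightarrow> _")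
proof
  have finC: "finite s" "s \<noteq> {}" "s \<subseteq> \<Union>KS" if "s \<in> C" for s
    using that C S.finite_member S.empty_notin_K by blast+
  have finD: "finite t" "t \<noteq> {}" "t \<subseteq> \<Union>KT" if "t \<in> D" for t
    using that D T.finite_member T.empty_notin_K by blast+
  {
    assume sub: "?X \<times> ?Y \<subseteq> Sigma_space Dv"
    show "compatible C D"
      unfolding compatible_def
    proof (intro ballI)
      fix s t m w assume s: "s \<in> C" and t: "t \<in> D" and m: "m \<in> s" and w: "w \<in> t"
      have "(centroid s, centroid t) \<in> ?X \<times> ?Y" using s t by (simp add: hull_inc)
      then have eq: "centroid s \<bullet> centroid t = 1" using sub by (auto simp: Sigma_space_def)
      have le: "m' \<bullet> centroid t \<le> 1" if "m' \<in> s" for m'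
      proof -
        have "(\<Sum>w\<in>t. m' \<bullet> w) \<le> (\<Sum>w\<in>t. 1)"
          by (intro sum_mono pairing_le) (use that s t finC(3) finD(3) in blast)+
        moreover have "0 < card t" using finD t by (simp add: card_gt_0_iff)
        ultimately show ?thesis by (simp add: inner_centroid)
      qed
      have "m \<bullet> centroid t = 1"
        using inner_centroid_eq_1D[of s "centroid t" m] finC[OF s] le eq m by (simp add: inner_commute)
      then show "m \<bullet> w = 1"
        using inner_centroid_eq_1D[of t m w] finD[OF t] finC[OF s] pairing_le m w by blast
    qed
  }
  {
    assume comp: "compatible C D"
    have X: "?X \<subseteq> {x. x \<bullet> w = 1}" if "t \<in> D" "w \<in> t" for t w
    proof (rule hull_minimal)
      show "centroid ` C \<subseteq> {x. x \<bullet> w = 1}"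
      proof (rule image_subsetI)
        fix s assume s: "s \<in> C"
        have "w \<bullet> m = 1" if "m \<in> s" for m
          using comp s that \<open>t \<in> D\<close> \<open>w \<in> t\<close> unfolding compatible_def by (metis inner_commute)
        then have "w \<bullet> centroid s = 1" by (rule inner_centroid_eq_1[OF finC(1,2)[OF s]])
        then show "centroid s \<in> {x. x \<bullet> w = 1}" by (simp add: inner_commute)
      qed
      show "convex {x. x \<bullet> w = 1}" using convex_hyperplane[of w 1] by (simp add: inner_commute)
    qed
    have XY: "m \<bullet> n = 1" if "m \<in> ?X" "n \<in> ?Y" for m n
    proof -
      have "?Y \<subseteq> {x. m \<bullet> x = 1}"
      proof (rule hull_minimal)
        show "centroid ` D \<subseteq> {x. m \<bullet> x = 1}"
        proof (rule image_subsetI)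
          fix t assume t: "t \<in> D"
          have "m \<bullet> w = 1" if "w \<in> t" for w using X[OF t that] \<open>m \<in> ?X\<close> by blast
          then have "m \<bullet> centroid t = 1" by (rule inner_centroid_eq_1[OF finD(1,2)[OF t]])
          then show "centroid t \<in> {x. m \<bullet> x = 1}" by simp
        qed
      qed (rule convex_hyperplane)
      then show ?thesis using that(2) by blast
    qed
    have "?X \<subseteq> polar_dual Dv"
    proof (rule hull_minimal)
      have "convex hull s \<subseteq> polar_dual Dv" if "s \<in> C" for s
        by (rule hull_minimal) (use finC(3)[OF that] S.K_in_P convex_polar_dual in auto)
      then show "centroid ` C \<subseteq> polar_dual Dv" using centroid_in_hull finC(1,2) by blast
    qed (rule convex_polar_dual)
    moreover have "?Y \<subseteq> Dv"
    proof (rule hull_minimal)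
      have "convex hull t \<subseteq> Dv" if "t \<in> D" for t
        by (rule hull_minimal) (use finD(3)[OF that] T.K_in_P convex_Dv in auto)
      then show "centroid ` D \<subseteq> Dv" using centroid_in_hull finD(1,2) by blast
    qed (rule convex_Dv)
    ultimately show "?X \<times> ?Y \<subseteq> Sigma_space Dv" using XY by (auto simp: Sigma_space_def)
  }
qed

text \<open>Compatibility of the faces in a direction \<open>y\<close>: the vertices \<open>w\<close> of the second one have
  coordinates at least \<open>k\<close> (relative to the sum) in the fan representation of \<open>y\<close>, so a vertex \<open>m\<close>
  of the first one with \<open>m \<bullet> w \<noteq> 1\<close> would lose \<open>k * gap\<close>, more than the tolerance \<open>\<epsilon>\<close>.\<close>
theorem realization:
  defines "p \<equiv> \<lambda>i :: (real ^ 'n) set \<times> (real ^ 'n) set. (centroid (fst i), centroid (snd i))"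
  shows "\<exists>Q :: (real ^ 'n) set. polytope Q \<and> aff_dim Q = int CARD('n) \<and>
      isomorphic_complexes ((\<lambda>J. convex hull (p ` J)) ` cells) (boundary_complex Q)"
    and "(\<Union>J\<in>cells. convex hull (p ` J)) homeomorphic sphere (0 :: real ^ 'n) 1"
proof -
  obtain k :: real and d :: "(real ^ 'n) set \<Rightarrow> real" and b :: "(real ^ 'n) set \<Rightarrow> real ^ 'n"
    where b: "0 < k" "\<And>t. t \<in> KT \<Longrightarrow> 0 < d t"
    "\<And>t w. \<lbrakk>t \<in> KT; w \<in> t\<rbrakk> \<Longrightarrow> b t \<bullet> w = \<kappa>T w + d t"
    "\<And>t w. \<lbrakk>t \<in> KT; w \<in> \<Union>KT; w \<notin> t\<rbrakk> \<Longrightarrow> b t \<bullet> w < \<kappa>T w"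
    and b_chain: "\<And>t' c. \<lbrakk>t' \<in> KT; \<And>w. w \<in> t' \<Longrightarrow> 0 \<le> c w; 0 < sum c t'\<rbrakk> \<Longrightarrow>
       is_chain (maximizers KT (\<lambda>t. b t \<bullet> (\<Sum>w\<in>t'. c w *\<^sub>R w)))"
    and b_sub: "\<And>t' c t. \<lbrakk>t' \<in> KT; \<And>w. w \<in> t' \<Longrightarrow> 0 \<le> c w; 0 < sum c t';
        t \<in> maximizers KT (\<lambda>t. b t \<bullet> (\<Sum>w\<in>t'. c w *\<^sub>R w))\<rbrakk> \<Longrightarrow> t \<subseteq> t'"
    and b_large: "\<And>t' c t w. \<lbrakk>t' \<in> KT; \<And>w. w \<in> t' \<Longrightarrow> 0 \<le> c w; 0 < sum c t';
        t \<in> maximizers KT (\<lambda>t. b t \<bullet> (\<Sum>w\<in>t'. c w *\<^sub>R w)); w \<in> t\<rbrakk> \<Longrightarrow> k * sum c t' \<le> c w"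
    by (fact T.perturbed_cuts)
  obtain gap where gap: "0 < gap" "\<And>m w. \<lbrakk>m \<in> \<Union>KS; w \<in> \<Union>KT; m \<bullet> w \<noteq> 1\<rbrakk> \<Longrightarrow> gap \<le> 1 - m \<bullet> w"
  proof -
    have "finite (\<Union>KS \<times> \<Union>KT)" using S.finite_vertices T.finite_vertices by simp
    moreover have "fst i \<bullet> snd i \<le> 1" if "i \<in> \<Union>KS \<times> \<Union>KT" for i
      using pairing_le[of "fst i" "snd i"] that by (simp add: mem_Times_iff)
    ultimately obtain c where "0 < c" "\<forall>i\<in>\<Union>KS \<times> \<Union>KT. fst i \<bullet> snd i \<noteq> 1 \<longrightarrow> c \<le> 1 - fst i \<bullet> snd i"
      using ex_uniform_gap[of "\<Union>KS \<times> \<Union>KT" "\<lambda>i. fst i \<bullet> snd i"] by blast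
    then show ?thesis by (intro that[of c]) force+
  qed
  \<comment> \<open>The half makes the comparison with \<open>k * gap\<close> strict, and the bound
    1 is required by \<open>S.perturbed_barycenters\<close>.\<close>
  define \<epsilon> where "\<epsilon> = min 1 (k * gap / 2)"
  have \<epsilon>: "0 < \<epsilon>" "\<epsilon> \<le> 1" "\<epsilon> < k * gap" using b(1) gap(1) by (auto simp: \<epsilon>_def min_def)
  obtain \<alpha> :: "(real ^ 'n) set \<Rightarrow> real ^ 'n \<Rightarrow> real" where \<alpha>: "\<And>s m. \<lbrakk>s \<in> KS; m \<in> s\<rbrakk> \<Longrightarrow> 0 < \<alpha> s m"
    and a_chain: "\<And>y. y \<noteq> 0 \<Longrightarrow> is_chain (maximizers KS (\<lambda>s. y \<bullet> combination (\<alpha> s) s))"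
    and a_near: "\<And>y s m m'. \<lbrakk>y \<noteq> 0; s \<in> maximizers KS (\<lambda>s. y \<bullet> combination (\<alpha> s) s); m \<in> s; m' \<in> \<Union>KS\<rbrakk>
       \<Longrightarrow> (1 - \<epsilon>) * (y \<bullet> m') \<le> y \<bullet> m"
    by (fact S.perturbed_barycenters[OF \<epsilon>(1,2)])
  define a where "a s = combination (\<alpha> s) s" for s
  define I where "I = KS \<times> KT"
  \<comment> \<open>The vertices of A + B are among these points; the index runs over all pairs,
    compatible or not.\<close>
  define q where "q i = a (fst i) + b (snd i)" for i
  have finI: "finite I" using S.finite_K T.finite_K by (simp add: I_def)
  have q_sum: "(\<Sum>i\<in>I. c i *\<^sub>R q i) = (\<Sum>s\<in>KS. (\<Sum>t\<in>KT. c (s, t)) *\<^sub>R a s) + (\<Sum>t\<in>KT. (\<Sum>s\<in>KS. c (s, t)) *\<^sub>R b t)" for c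
    unfolding I_def q_def scaleR_right_distrib sum.distrib sum_marginals by (rule refl)
  have p_sum: "(\<Sum>i\<in>I. c i *\<^sub>R p i)
      = (\<Sum>s\<in>KS. (\<Sum>t\<in>KT. c (s, t)) *\<^sub>R centroid s, \<Sum>t\<in>KT. (\<Sum>s\<in>KS. c (s, t)) *\<^sub>R centroid t)" for c
    unfolding I_def p_def prod_eq_iff fst_sum snd_sum fst_scaleR snd_scaleR fst_conv snd_conv sum_marginals
    by (intro conjI refl)
  have cellsD: "\<exists>C D. J = C \<times> D \<and> C \<subseteq> KS \<and> C \<noteq> {} \<and> is_chain C \<and> D \<subseteq> KT \<and> D \<noteq> {} \<and> is_chain D \<and> compatible C D"
    if "J \<in> cells" for J using that by (auto simp: cells_def)

  have p_imp_marginals: "(\<forall>s. (\<Sum>t\<in>KT. c (s, t)) = (\<Sum>t\<in>KT. c' (s, t))) \<and> (\<forall>t. (\<Sum>s\<in>KS. c (s, t)) = (\<Sum>s\<in>KS. c' (s, t)))"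
    if "J \<in> cells" "J' \<in> cells" "weights_on J c" "weights_on J' c'"
      "(\<Sum>i\<in>I. c i *\<^sub>R p i) = (\<Sum>i\<in>I. c' i *\<^sub>R p i)" for J J' c c'
  proof -
    obtain C D where J: "J = C \<times> D" "C \<subseteq> KS" "is_chain C" "D \<subseteq> KT" "is_chain D" using cellsD[OF \<open>J \<in> cells\<close>] by blast
    obtain C' D' where J': "J' = C' \<times> D'" "C' \<subseteq> KS" "is_chain C'" "D' \<subseteq> KT" "is_chain D'" using cellsD[OF \<open>J' \<in> cells\<close>] by blast
    note w = weights_on_marginals[OF S.finite_K T.finite_K J(2,4) that(3)[unfolded J(1)]]
    note w' = weights_on_marginals[OF S.finite_K T.finite_K J'(2,4) that(4)[unfolded J'(1)]]
    note eq = that(5)[unfolded p_sum prod.inject]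
    show ?thesis
      using S.barycentric_unique[OF J(2,3) w(1) J'(2,3) w'(1) conjunct1[OF eq]]
        T.barycentric_unique[OF J(4,5) w(2) J'(4,5) w'(2) conjunct2[OF eq]] by blast
  qed
  \<comment> \<open>Paired with a vertex \<open>w\<close> of \<open>D\<close>, the A-part of a
    relation does not depend on \<open>w\<close>, by compatibility. Since the B-coefficients sum to
    0, their \<open>\<kappa>\<close>-part drops out, and the triangular system makes them vanish;
    the A-coefficients follow by linear independence.\<close>
  have q_imp_marginals: "(\<forall>s. (\<Sum>t\<in>KT. c (s, t)) = (\<Sum>t\<in>KT. c' (s, t))) \<and> (\<forall>t. (\<Sum>s\<in>KS. c (s, t)) = (\<Sum>s\<in>KS. c' (s, t)))"
    if "J \<in> cells" "weights_on J c" "weights_on J c'"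
      "(\<Sum>i\<in>I. c i *\<^sub>R q i) = (\<Sum>i\<in>I. c' i *\<^sub>R q i)" for J c c'
  proof -
    obtain C D where J: "J = C \<times> D" "C \<subseteq> KS" "C \<noteq> {}" "is_chain C" "D \<subseteq> KT" "D \<noteq> {}" "is_chain D" "compatible C D"
      using cellsD[OF \<open>J \<in> cells\<close>] by blast
    note w = weights_on_marginals[OF S.finite_K T.finite_K J(2,5) that(2)[unfolded J(1)]]
    note w' = weights_on_marginals[OF S.finite_K T.finite_K J(2,5) that(3)[unfolded J(1)]]
    define x where "x s = (\<Sum>t\<in>KT. c (s, t)) - (\<Sum>t\<in>KT. c' (s, t))" for s
    define y where "y t = (\<Sum>s\<in>KS. c (s, t)) - (\<Sum>s\<in>KS. c' (s, t))" for t
    have finC: "finite C" and finD: "finite D" using J S.finite_K T.finite_K finite_subset by blast+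
    have x_out: "x s = 0" if "s \<notin> C" for s
      using weights_on_outside[OF w(1) that] weights_on_outside[OF w'(1) that] by (simp add: x_def)
    have y_out: "y t = 0" if "t \<notin> D" for t
      using weights_on_outside[OF w(2) that] weights_on_outside[OF w'(2) that] by (simp add: y_def)
    have y0: "sum y D = 0"
      using w(2) w'(2) unfolding y_def by (simp add: sum_subtractf weights_on_def)
    have "(\<Sum>s\<in>KS. x s *\<^sub>R a s) + (\<Sum>t\<in>KT. y t *\<^sub>R b t) = 0"
      using that(4) unfolding q_sum x_def y_def by (simp add: scaleR_left_diff_distrib sum_subtractf algebra_simps)
    moreover have "(\<Sum>s\<in>KS. x s *\<^sub>R a s) = (\<Sum>s\<in>C. x s *\<^sub>R a s)"
      by (rule sum.mono_neutral_right) (use S.finite_K J x_out in auto)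
    moreover have "(\<Sum>t\<in>KT. y t *\<^sub>R b t) = (\<Sum>t\<in>D. y t *\<^sub>R b t)"
      by (rule sum.mono_neutral_right) (use T.finite_K J y_out in auto)
    ultimately have zero: "(\<Sum>s\<in>C. x s *\<^sub>R a s) + (\<Sum>t\<in>D. y t *\<^sub>R b t) = 0" by simp
    have a_w: "a s \<bullet> w = sum (\<alpha> s) s" if "s \<in> C" "w \<in> \<Union>D" for s w
    proof -
      have "w \<bullet> m = 1" if "m \<in> s" for m
        using J(8) that \<open>s \<in> C\<close> \<open>w \<in> \<Union>D\<close> unfolding compatible_def by (metis UnionE inner_commute)
      then show ?thesis by (simp add: a_def inner_commute[of _ w] inner_combination)
    qed
    define g where "g t w = b t \<bullet> w - \<kappa>T w" for t w
    have y_zero: "y t = 0" if "t \<in> D" for t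
    proof (rule chain_triangular_eq_0[where D = D and g = g and d = d and x = y and E = "- (\<Sum>s\<in>C. x s * sum (\<alpha> s) s)"])
      show "{} \<notin> D" using J(5) T.empty_notin_K by blast
      show "finite t" if "t \<in> D" for t using J(5) T.finite_member that by blast
      show "g t w = d t" if "t \<in> D" "w \<in> t" for t w using b(3)[of t w] that J(5) by (auto simp: g_def)
      show "0 < d t" if "t \<in> D" for t using b(2) that J(5) by blast
      show "g t w < 0" if "t \<in> D" "w \<in> \<Union>D" "w \<notin> t" for t w
        using b(4)[of t w] that J(5) by (auto simp: g_def)
      show "(\<Sum>t\<in>D. y t * g t w) = - (\<Sum>s\<in>C. x s * sum (\<alpha> s) s)" if "w \<in> \<Union>D" for w
      proof -
        have "0 = ((\<Sum>s\<in>C. x s *\<^sub>R a s) + (\<Sum>t\<in>D. y t *\<^sub>R b t)) \<bullet> w" unfolding zero by simp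
        also have "\<dots> = (\<Sum>s\<in>C. x s * (a s \<bullet> w)) + (\<Sum>t\<in>D. y t * (b t \<bullet> w))"
          by (simp add: inner_add_left inner_sum_left)
        also have "(\<Sum>s\<in>C. x s * (a s \<bullet> w)) = (\<Sum>s\<in>C. x s * sum (\<alpha> s) s)"
          by (intro sum.cong) (use a_w that in auto)
        also have "(\<Sum>t\<in>D. y t * (b t \<bullet> w)) = (\<Sum>t\<in>D. y t * g t w) + sum y D * \<kappa>T w"
          by (simp add: g_def right_diff_distrib sum_subtractf sum_distrib_right)
        finally show ?thesis using y0 by simp
      qed
    qed (use finD J y0 that in auto)
    then have "(\<Sum>s\<in>C. x s *\<^sub>R a s) = 0" using zero by simp
    then have "x s = 0" if "s \<in> C" for s
      using S.chain_combination_K[OF J(2,4), of \<alpha> x s] \<alpha> J(2) that unfolding a_def by blast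
    then show ?thesis using x_out y_zero y_out unfolding x_def y_def by (metis eq_iff_diff_eq_0)
  qed

  have max_compatible: "compatible (maximizers KS (\<lambda>s. y \<bullet> a s)) (maximizers KT (\<lambda>t. y \<bullet> b t)) \<and>
      is_chain (maximizers KT (\<lambda>t. y \<bullet> b t))" if y: "y \<noteq> 0" for y
  proof -
    obtain t' c where t': "t' \<in> KT" "\<forall>w\<in>t'. 0 \<le> c w" "y = (\<Sum>w\<in>t'. c w *\<^sub>R w)"
      using T.cones_cover[of y] by blast
    have fint': "finite t'" by (rule T.finite_member[OF t'(1)])
    have pos: "0 < sum c t'"
    proof (rule ccontr)
      assume "\<not> ?thesis"
      then have "sum c t' = 0" using sum_nonneg[of t' c] t'(2) by force
      then have "\<forall>w\<in>t'. c w = 0" using t'(2) fint' by (subst (asm) sum_nonneg_eq_0_iff) auto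
      then have "y = 0" unfolding t'(3) by simp
      then show False using y by simp
    qed
    have comm: "(\<lambda>t. y \<bullet> b t) = (\<lambda>t. b t \<bullet> (\<Sum>w\<in>t'. c w *\<^sub>R w))"
      by (simp add: inner_commute flip: t'(3))
    have nn: "\<And>w. w \<in> t' \<Longrightarrow> 0 \<le> c w" using t'(2) by blast
    obtain m' where m': "m' \<in> \<Union>KS" "\<And>w. w \<in> t' \<Longrightarrow> m' \<bullet> w = 1" using ex_dual_vertex[OF t'(1)] by blast
    have y_inner: "y \<bullet> m = (\<Sum>w\<in>t'. c w * (m \<bullet> w))" for m
      unfolding t'(3) by (simp add: inner_sum_right inner_commute[of _ m])
    \<comment> \<open>As no pairing exceeds 1, this is the maximum of \<open>y\<close> over the
      vertices of \<open>KS\<close>.\<close>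
    have ym': "y \<bullet> m' = sum c t'" unfolding y_inner using m'(2) by simp
    have "compatible (maximizers KS (\<lambda>s. y \<bullet> a s)) (maximizers KT (\<lambda>t. y \<bullet> b t))"
      unfolding compatible_def
    proof (intro ballI)
      fix s t m w assume s: "s \<in> maximizers KS (\<lambda>s. y \<bullet> a s)" and t: "t \<in> maximizers KT (\<lambda>t. y \<bullet> b t)"
        and m: "m \<in> s" and w: "w \<in> t"
      note t = t[unfolded comm]
      have "t \<subseteq> t'" by (rule b_sub[OF t'(1) nn pos t])
      then have wt': "w \<in> t'" using w by blast
      have big: "k * sum c t' \<le> c w" by (rule b_large[OF t'(1) nn pos t w])
      have mV: "m \<in> \<Union>KS" using s m by (auto simp: maximizers_def)
      have le1: "m \<bullet> v \<le> 1" if "v \<in> t'" for v using pairing_le[OF mV, of v] that t'(1) by blast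
      show "m \<bullet> w = 1"
      proof (rule ccontr)
        assume "m \<bullet> w \<noteq> 1"
        then have g: "gap \<le> 1 - m \<bullet> w" using gap(2)[OF mV, of w] wt' t'(1) by blast
        have "(1 - \<epsilon>) * sum c t' \<le> y \<bullet> m"
          using a_near[OF y s[unfolded a_def] m m'(1)] ym' by simp
        also have "y \<bullet> m = sum c t' - (\<Sum>v\<in>t'. c v * (1 - m \<bullet> v))"
          by (simp add: y_inner right_diff_distrib sum_subtractf)
        also have "\<dots> \<le> sum c t' - c w * (1 - m \<bullet> w)"
          using member_le_sum[of w t' "\<lambda>v. c v * (1 - m \<bullet> v)"] wt' fint' nn le1 by simp
        finally have "c w * (1 - m \<bullet> w) \<le> \<epsilon> * sum c t'" by (simp add: algebra_simps)
        moreover have "(k * sum c t') * gap \<le> c w * (1 - m \<bullet> w)"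
          using big g gap(1) b(1) pos nn[OF wt'] by (intro mult_mono) auto
        ultimately have "(k * gap) * sum c t' \<le> \<epsilon> * sum c t'" by (simp add: mult.assoc mult.left_commute mult.commute)
        then show False using \<epsilon>(3) pos by simp
      qed
    qed
    moreover have "is_chain (maximizers KT (\<lambda>t. y \<bullet> b t))" unfolding comm by (rule b_chain[OF t'(1) nn pos])
    ultimately show ?thesis by blast
  qed

  define U where "U = (\<Union>J\<in>cells. convex hull (p ` J))"
  have U: "U \<subseteq> Sigma_space Dv"
  proof -
    have "convex hull (p ` J) \<subseteq> Sigma_space Dv" if "J \<in> cells" for J
    proof -
      obtain C D where J: "J = C \<times> D" "C \<subseteq> KS" "D \<subseteq> KT" "compatible C D" using cellsD[OF \<open>J \<in> cells\<close>] by blast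
      then show ?thesis
        unfolding p_def J(1) cell_hull using product_in_Sigma_space_iff[OF J(2,3)] by simp
    qed
    then show ?thesis by (auto simp: U_def)
  qed
  have cells_sub: "cells \<subseteq> Pow I" "{} \<notin> cells" "I \<notin> cells"
    using not_all_cells by (auto simp: cells_def I_def)
  have argmax: "{i\<in>I. \<forall>j\<in>I. y \<bullet> q j \<le> y \<bullet> q i} \<in> cells" if y: "y \<noteq> 0" for y
  proof -
    have "{i\<in>I. \<forall>j\<in>I. y \<bullet> q j \<le> y \<bullet> q i} = maximizers KS (\<lambda>s. y \<bullet> a s) \<times> maximizers KT (\<lambda>t. y \<bullet> b t)"
      unfolding I_def q_def inner_add_right
      by (rule maximizers_sum[OF S.finite_K S.K_nonempty T.finite_K T.K_nonempty])
    moreover have "is_chain (maximizers KS (\<lambda>s. y \<bullet> a s))" unfolding a_def by (rule a_chain[OF y])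
    moreover have "maximizers KS (\<lambda>s. y \<bullet> a s) \<noteq> {}" "maximizers KT (\<lambda>t. y \<bullet> b t) \<noteq> {}"
      using maximizers_nonempty S.finite_K S.K_nonempty T.finite_K T.K_nonempty by blast+
    moreover have "maximizers KS (\<lambda>s. y \<bullet> a s) \<subseteq> KS" "maximizers KT (\<lambda>t. y \<bullet> b t) \<subseteq> KT"
      by (auto simp: maximizers_def)
    ultimately show ?thesis using max_compatible[OF y] unfolding cells_def by blast
  qed
  have q_imp_p: "(\<Sum>i\<in>I. c i *\<^sub>R p i) = (\<Sum>i\<in>I. c' i *\<^sub>R p i)"
    if "J \<in> cells" "weights_on J c" "weights_on J c'"
      "(\<Sum>i\<in>I. c i *\<^sub>R q i) = (\<Sum>i\<in>I. c' i *\<^sub>R q i)" for J c c'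
    using q_imp_marginals[OF that] unfolding p_sum by simp
  have p_imp_q: "(\<Sum>i\<in>I. c i *\<^sub>R q i) = (\<Sum>i\<in>I. c' i *\<^sub>R q i)"
    if "J \<in> cells" "J' \<in> cells" "weights_on J c" "weights_on J' c'"
      "(\<Sum>i\<in>I. c i *\<^sub>R p i) = (\<Sum>i\<in>I. c' i *\<^sub>R p i)" for J J' c c'
    using p_imp_marginals[OF that] unfolding q_sum by simp
  \<comment> \<open>Equal points have equal marginals, so a marginal of \<open>c'\<close> vanishes
    at \<open>s\<close> or at \<open>t\<close>; nonnegativity passes this on to each entry.\<close>
  have p_imp_support: "c' i = 0"
    if "J \<in> cells" "J' \<in> cells" "weights_on J c" "weights_on J' c'"
      "(\<Sum>i\<in>I. c i *\<^sub>R p i) = (\<Sum>i\<in>I. c' i *\<^sub>R p i)" "i \<notin> J" for J J' c c' i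
  proof (cases "i \<in> I")
    case False
    then have "i \<notin> J'" using cells_sub(1) that(2) by blast
    then show ?thesis by (rule weights_on_outside[OF that(4)])
  next
    case True
    obtain s t where i: "i = (s, t)" "s \<in> KS" "t \<in> KT" using True by (auto simp: I_def)
    obtain C D where J: "J = C \<times> D" "C \<subseteq> KS" "D \<subseteq> KT" using cellsD[OF \<open>J \<in> cells\<close>] by blast
    note w = weights_on_marginals[OF S.finite_K T.finite_K J(2,3) that(3)[unfolded J(1)]]
    note marg = p_imp_marginals[OF that(1-5)]
    note nn = weights_on_nonneg[OF that(4)]
    have "s \<notin> C \<or> t \<notin> D" using that(6) i J by auto
    then show ?thesis
    proof
      assume "s \<notin> C"
      then have "(\<Sum>t\<in>KT. c' (s, t)) = 0" using weights_on_outside[OF w(1)] marg by simp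
      then show ?thesis using sum_nonneg_eq_0_iff[OF T.finite_K, of "\<lambda>t. c' (s, t)"] nn i by simp
    next
      assume "t \<notin> D"
      then have "(\<Sum>s\<in>KS. c' (s, t)) = 0" using weights_on_outside[OF w(2)] marg by simp
      then show ?thesis using sum_nonneg_eq_0_iff[OF S.finite_K, of "\<lambda>s. c' (s, t)"] nn i by simp
    qed
  qed
  have dir: "continuous_on U direction" "inj_on direction U" "direction ` U \<subseteq> sphere 0 1"
    using direction_Sigma_space[of Dv] U continuous_on_subset inj_on_subset by blast+
  note R = complex_realization[where q = q and p = p and Good = cells and I = I and g = direction]
  note facts = finI cells_sub argmax q_imp_p p_imp_q p_imp_support dir[unfolded U_def]
  have "polytope (convex hull (q ` I))" by (rule R(1)) (fact facts)+
  moreover have "aff_dim (convex hull (q ` I)) = DIM(real ^ 'n)" by (rule R(2)) (fact facts)+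
  moreover have "isomorphic_complexes ((\<lambda>J. convex hull (p ` J)) ` cells) (boundary_complex (convex hull (q ` I)))"
    by (rule R(3)) (fact facts)+
  ultimately show "\<exists>Q :: (real ^ 'n) set. polytope Q \<and> aff_dim Q = int CARD('n) \<and>
      isomorphic_complexes ((\<lambda>J. convex hull (p ` J)) ` cells) (boundary_complex Q)"
    by (intro exI[of _ "convex hull (q ` I)"]) simp
  show "(\<Union>J\<in>cells. convex hull (p ` J)) homeomorphic sphere (0 :: real ^ 'n) 1"
    by (rule R(4)) (fact facts)+
qed

end

subsection \<open>Reflexive polytopes\<close>

lemma finite_bounded_lattice_points:
  fixes S :: "(real ^ 'n) set"
  assumes "bounded S"
  shows "finite (S \<inter> lattice_points)"
proof -
  obtain B where B: "\<And>x. x \<in> S \<Longrightarrow> norm x \<le> B" using assms by (auto simp: bounded_iff)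
  define F where "F = {k :: real. k \<in> \<int> \<and> \<bar>k\<bar> \<le> B}"
  have "finite F" unfolding F_def by (rule finite_abs_int_segment)
  then have "finite (vec_lambda ` (PiE (UNIV :: 'n set) (\<lambda>_. F)))"
    by (intro finite_imageI finite_PiE) auto
  moreover have "S \<inter> lattice_points \<subseteq> vec_lambda ` (PiE (UNIV :: 'n set) (\<lambda>_. F))"
  proof
    fix x assume x: "x \<in> S \<inter> lattice_points"
    have "\<bar>x $ i\<bar> \<le> B" for i using B[of x] component_le_norm_cart[of x i] x by simp
    then have "(\<lambda>i. x $ i) \<in> PiE UNIV (\<lambda>_. F)" using x by (auto simp: F_def lattice_points_def)
    moreover have "x = (\<chi> i. x $ i)" by simp
    ultimately show "x \<in> vec_lambda ` (PiE (UNIV :: 'n set) (\<lambda>_. F))" by blast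
  qed
  ultimately show ?thesis by (rule finite_subset[rotated])
qed

lemma bounded_polar_dual:
  assumes "0 \<in> interior P"
  shows "bounded (polar_dual P)"
proof -
  obtain e where e: "e > 0" "cball 0 e \<subseteq> P" using assms by (auto simp: mem_interior_cball)
  have "norm m \<le> 1 / e" if m: "m \<in> polar_dual P" for m
  proof (cases "m = 0")
    case False
    have "(e / norm m) *\<^sub>R m \<in> P" using e False by (intro subsetD[OF e(2)]) auto
    then have "m \<bullet> ((e / norm m) *\<^sub>R m) \<le> 1" using m unfolding polar_dual_def by blast
    moreover have "m \<bullet> ((e / norm m) *\<^sub>R m) = e * norm m"
      using False by (simp add: dot_square_norm power2_eq_square)
    ultimately have "e * norm m \<le> 1" by simp
    then show ?thesis using e by (simp add: field_simps)
  qed (use e in simp)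
  then show ?thesis by (auto simp: bounded_iff)
qed

lemma zero_in_interior_polar_dual:
  assumes "bounded P"
  shows "0 \<in> interior (polar_dual P)"
proof -
  obtain B where B: "B > 0" "\<And>x. x \<in> P \<Longrightarrow> norm x \<le> B" using assms by (auto simp: bounded_pos)
  have "m \<in> polar_dual P" if m: "m \<in> ball 0 (1 / B)" for m
    unfolding polar_dual_def
  proof (intro CollectI ballI)
    fix n assume "n \<in> P"
    have "m \<bullet> n \<le> norm m * norm n" by (rule norm_cauchy_schwarz)
    also have "\<dots> \<le> (1 / B) * B" using m B(1) B(2)[OF \<open>n \<in> P\<close>] by (intro mult_mono) auto
    finally show "m \<bullet> n \<le> 1" using B by simp
  qed
  then show ?thesis using B by (intro interiorI[of "ball 0 (1 / B)"]) auto
qed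

lemma central_triangulation_reflexive:
  assumes "reflexive_polytope Dv" "generic_heights Dv v" "central_heights Dv v"
  shows "central_triangulation Dv v"
proof -
  obtain V where V: "finite V" "V \<subseteq> lattice_points" "Dv = convex hull V"
    and int: "0 \<in> interior Dv" using assms(1) by (auto simp: reflexive_polytope_def)
  have "V \<subseteq> Dv" unfolding V(3) by (rule hull_subset)
  then have "Dv \<subseteq> convex hull (Dv \<inter> lattice_points)"
    using V(2) hull_mono[of V "Dv \<inter> lattice_points" convex] by (simp add: V(3))
  moreover have "convex hull (Dv \<inter> lattice_points) \<subseteq> Dv"
    by (rule hull_minimal) (simp_all add: V(3))
  moreover have "bounded Dv"
    unfolding V(3) using V(1) by (simp add: bounded_convex_hull finite_imp_bounded)
  ultimately show ?thesis
    using int assms(2,3) by unfold_locales (auto intro: finite_bounded_lattice_points)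
qed

text \<open>Reflexivity enters here: the extreme points of the polar body are lattice points, and by
  Krein-Milman they span it.\<close>

lemma central_triangulation_polar_dual:
  assumes "reflexive_polytope Dv" "generic_heights (polar_dual Dv) l" "central_heights (polar_dual Dv) l"
  shows "central_triangulation (polar_dual Dv) l"
proof -
  let ?P = "polar_dual Dv"
  obtain V where V: "finite V" "Dv = convex hull V"
    and int: "0 \<in> interior Dv" and ext: "\<And>m. m extreme_point_of ?P \<Longrightarrow> m \<in> lattice_points"
    using assms(1) by (auto simp: reflexive_polytope_def)
  have bdd: "bounded ?P" by (rule bounded_polar_dual[OF int])
  then have "compact ?P" using closed_polar_dual compact_eq_bounded_closed by blast
  then have "?P = convex hull {m. m extreme_point_of ?P}"
    by (rule Krein_Milman_Minkowski[OF _ convex_polar_dual])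
  moreover have "{m. m extreme_point_of ?P} \<subseteq> ?P \<inter> lattice_points"
    using ext by (auto simp: extreme_point_of_def)
  ultimately have "?P \<subseteq> convex hull (?P \<inter> lattice_points)"
    using hull_mono by metis
  moreover have "convex hull (?P \<inter> lattice_points) \<subseteq> ?P"
    by (rule hull_minimal) (auto simp: convex_polar_dual)
  moreover have "bounded Dv"
    unfolding V(2) using V(1) by (simp add: bounded_convex_hull finite_imp_bounded)
  ultimately show ?thesis
    using assms(2,3) bdd zero_in_interior_polar_dual[of Dv]
    by unfold_locales (auto intro: finite_bounded_lattice_points)
qed

theorem lemma2p1:
  fixes Dv :: "(real ^ 'n) set" and l v :: "real ^ 'n \<Rightarrow> int"
  assumes "reflexive_polytope Dv"
    and "generic_heights (polar_dual Dv) l" and "central_heights (polar_dual Dv) l"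
    and "generic_heights Dv v" and "central_heights Dv v"
  shows "(\<exists>Q :: (real ^ 'n) set. polytope Q \<and> aff_dim Q = int CARD('n) \<and>
            isomorphic_complexes (Sigma_complex Dv l v) (boundary_complex Q)) \<and>
         \<Union>(Sigma_complex Dv l v) homeomorphic sphere (0 :: real ^ 'n) 1"
proof -
  interpret CS: central_triangulation "polar_dual Dv" l
    by (rule central_triangulation_polar_dual[OF assms(1-3)])
  interpret CT: central_triangulation Dv v
    by (rule central_triangulation_reflexive[OF assms(1,4,5)])
  obtain \<phi>S \<psi>S where S: "central_fan (polar_dual Dv) CS.vertex_sets (\<lambda>m. CS.H 0 - CS.H m) \<phi>S \<psi>S"
    by (rule CS.central_fan)
  obtain \<phi>T \<psi>T where T: "central_fan Dv CT.vertex_sets (\<lambda>m. CT.H 0 - CT.H m) \<phi>T \<psi>T"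
    by (rule CT.central_fan)
  interpret dual_fans Dv CS.vertex_sets "\<lambda>m. CS.H 0 - CS.H m" \<phi>S \<psi>S
      CT.vertex_sets "\<lambda>m. CT.H 0 - CT.H m" \<phi>T \<psi>T
    by (intro dual_fans.intro S T dual_fans_axioms.intro CT.convex_P)
  let ?p = "\<lambda>i :: (real ^ 'n) set \<times> (real ^ 'n) set. (centroid (fst i), centroid (snd i))"
  \<comment> \<open>Restriction to the support of \<Sigma> becomes compatibility of the two chains,
    which identifies the cells with the index sets of \<open>realization\<close>.\<close>
  have "Sigma_complex Dv l v = (\<lambda>J. convex hull (?p ` J)) ` cells"
  proof (intro equalityI subsetI)
    fix X assume "X \<in> Sigma_complex Dv l v"
    then obtain C D where "X = (convex hull (centroid ` C)) \<times> (convex hull (centroid ` D))"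
        "C \<subseteq> CS.vertex_sets" "C \<noteq> {}" "is_chain C" "D \<subseteq> CT.vertex_sets" "D \<noteq> {}" "is_chain D" "X \<subseteq> Sigma_space Dv"
      unfolding Sigma_complex_def CS.boundary_triangulation_eq CT.boundary_triangulation_eq S.bsd_hulls T.bsd_hulls
      by blast
    then have "X = convex hull (?p ` (C \<times> D))" "C \<times> D \<in> cells"
      using product_in_Sigma_space_iff[of C D] unfolding cell_hull cells_def by blast+
    then show "X \<in> (\<lambda>J. convex hull (?p ` J)) ` cells" by blast
  next
    fix X assume "X \<in> (\<lambda>J. convex hull (?p ` J)) ` cells"
    then obtain C D where "X = (convex hull (centroid ` C)) \<times> (convex hull (centroid ` D))"
        "C \<subseteq> CS.vertex_sets" "C \<noteq> {}" "is_chain C" "D \<subseteq> CT.vertex_sets" "D \<noteq> {}" "is_chain D" "compatible C D"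
      unfolding cells_def using cell_hull by blast
    then show "X \<in> Sigma_complex Dv l v"
      unfolding Sigma_complex_def CS.boundary_triangulation_eq CT.boundary_triangulation_eq S.bsd_hulls T.bsd_hulls
      using product_in_Sigma_space_iff[of C D] by blast
  qed
  then show ?thesis using realization by simp
qed

end
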